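(* Every subcubic planar graph of girth at least $9$ can be decomposed into a linear forest and a matching, i.e. there is a partition $E(G)=E(L)\cup E(M)$ where $L$ is a linear forest and $M$ is a matching.
   Context: A graph is subcubic if every vertex has degree at most $3$. The girth of a graph is the length of its shortest cycle ($\infty$ if acyclic); girth at least $9$ in particular excludes parallel edges. A linear forest is a graph each of whose connected components is a path. A decomposition of $G$ means a pair of spanning subgraphs whose edge sets partition $E(G)$. *)

theory Defs
  imports "HOL-Analysis.Analysis"
begin

definition simple_graph :: "'a set \<Rightarrow> 'a set set \<Rightarrow> bool" where
  "simple_graph V E \<longleftrightarrow> finite V \<and>
     (\<forall>e\<in>E. \<exists>u v. e = {u, v} \<and> u \<noteq> v \<and> u \<in> V \<and> v \<in> V)"

definition degree :: "'a set set \<Rightarrow> 'a \<Rightarrow> nat" where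
  "degree E v = card {e\<in>E. v \<in> e}"

definition subcubic :: "'a set \<Rightarrow> 'a set set \<Rightarrow> bool" where
  "subcubic V E \<longleftrightarrow> (\<forall>v\<in>V. degree E v \<le> 3)"

definition is_cycle :: "'a set set \<Rightarrow> 'a list \<Rightarrow> bool" where
  "is_cycle E xs \<longleftrightarrow> length xs \<ge> 3 \<and> distinct xs \<and>
     (\<forall>i < length xs. {xs ! i, xs ! ((i + 1) mod length xs)} \<in> E)"

definition girth_at_least :: "'a set set \<Rightarrow> nat \<Rightarrow> bool" where
  "girth_at_least E g \<longleftrightarrow> (\<forall>xs. is_cycle E xs \<longrightarrow> length xs \<ge> g)"

definition planar :: "'a set \<Rightarrow> 'a set set \<Rightarrow> bool" where
  "planar V E \<longleftrightarrow> (\<exists>(p :: 'a \<Rightarrow> real \<times> real) (\<gamma> :: 'a set \<Rightarrow> real \<Rightarrow> real \<times> real).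
     inj_on p V \<and>
     (\<forall>e\<in>E. arc (\<gamma> e) \<and> {pathstart (\<gamma> e), pathfinish (\<gamma> e)} = p ` e \<and>
              path_image (\<gamma> e) \<inter> p ` V = p ` e) \<and>
     (\<forall>e\<in>E. \<forall>e'\<in>E. e \<noteq> e' \<longrightarrow> path_image (\<gamma> e) \<inter> path_image (\<gamma> e') \<subseteq> p ` (e \<inter> e')))"

definition adj :: "'a set set \<Rightarrow> 'a \<Rightarrow> 'a \<Rightarrow> bool" where
  "adj F u v \<longleftrightarrow> {u, v} \<in> F"

definition component :: "'a set set \<Rightarrow> 'a \<Rightarrow> 'a set" where
  "component F v = {u. (adj F)\<^sup>*\<^sup>* v u}"

definition linear_forest :: "'a set \<Rightarrow> 'a set set \<Rightarrow> bool" where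
  "linear_forest V F \<longleftrightarrow> (\<forall>v\<in>V. \<exists>xs. distinct xs \<and> set xs = component F v \<and>
      {e\<in>F. e \<subseteq> set xs} = {{xs ! i, xs ! Suc i} | i. Suc i < length xs})"

definition matching :: "'a set set \<Rightarrow> bool" where
  "matching M \<longleftrightarrow> (\<forall>e\<in>M. \<forall>e'\<in>M. e \<noteq> e' \<longrightarrow> e \<inter> e' = {})"

end

theory Submission
  imports Defs
begin

text \<open>In a minimal counterexample every vertex has degree 2 or 3, and 2-vertices are pairwise
  nonadjacent. Write \<open>o\<close> and \<open>i\<close> for the numbers of 3-vertices of a cycle whose third edge leads
  outside and inside the cycle. If an ear splits the cycle, then \<open>o - i - 6\<close> is additive, so by the
  theta curve theorem it is nonnegative for all cycles as soon as it is for those with \<open>i = 0\<close>.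
  Applied to both sides of one cycle this gives \<open>o \<ge> i + 6\<close> and \<open>i \<ge> o + 6\<close>, a contradiction.
  (Bridges are dealt with by working in an end part behind at most one bridge.)

  Hence there is a cycle with \<open>i = 0\<close> and at most five 3-vertices. Girth 9 forces it to have length 9
  or 10 and to alternate between 2- and 3-vertices, with one exception in the first case. Removing its
  edges leaves a decomposition that extends over the cycle unless (essentially) the third edges at all
  its 3-vertices lie in the matching. To exclude this, a 3-vertex of the cycle with its two
  2-neighbours is first replaced by a star, which forces one of three consecutive third edges out of
  the matching. The replacement could only violate the girth condition if there were a short ear
  between the outer two of the three 3-vertices; but two short ears for overlapping triples would
  cross and thereby create a cycle of length at most 8.\<close>

section \<open>Walks, paths and cycles\<close>

text \<open>The obstacle is an alternating cycle whose third edges all lie in the matching: both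
  cycle edges at each 3-vertex are then forced into the forest, and the whole cycle closes up there.
  A single 3-vertex missed by the matching resolves this, since one of its cycle edges may become a
  matching edge.

  The shape of the star comes from the girth. Let the removed 3-vertex have 2-neighbours leading to
  l and r, and third neighbour w. Joining a new centre directly to l, r and w would bring w closer
  to l and r, so the edge to w is subdivided by one of the freed 2-vertices. Only the distance
  between l and r then shrinks, along this configuration from 4 to 2, and it suffices that every
  other walk between them has length at least 7.

  The constant 6 comes from the two ends of an ear. Such a vertex counts -1 on the old cycle, its
  third edge being the ear, but 1 on each of the two new cycles: a surplus of 3. An inner 3-vertex
  of the ear counts 1 on one new cycle and -1 on the other. An end part is needed because ears exist
  only where no bridge gets in the way.\<close>

primrec walk :: "'a set set \<Rightarrow> nat \<Rightarrow> 'a \<Rightarrow> 'a \<Rightarrow> bool" where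
  "walk F 0 u v \<longleftrightarrow> u = v"
| "walk F (Suc n) u v \<longleftrightarrow> (\<exists>w. {u, w} \<in> F \<and> walk F n w v)"

definition conn :: "'a set set \<Rightarrow> 'a \<Rightarrow> 'a \<Rightarrow> bool" where
  "conn F u v \<longleftrightarrow> (\<exists>n. walk F n u v)"

text \<open>Distance at least \<open>k\<close>. Walks rather than paths, so that pieces can be cut
  and concatenated without any check of distinctness.\<close>

definition far :: "'a set set \<Rightarrow> nat \<Rightarrow> 'a \<Rightarrow> 'a \<Rightarrow> bool" where
  "far F k u v \<longleftrightarrow> (\<forall>n<k. \<not> walk F n u v)"

text \<open>The walk of length 0 counts as well, so loops are excluded.\<close>

definition girth9 :: "'a set set \<Rightarrow> bool" where
  "girth9 F \<longleftrightarrow> (\<forall>u v. {u, v} \<in> F \<longrightarrow> far (F - {{u, v}}) 8 u v)"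

fun pedges :: "'a list \<Rightarrow> 'a set set" where
  "pedges (x # y # zs) = insert {x, y} (pedges (y # zs))"
| "pedges _ = {}"

definition cedges :: "'a list \<Rightarrow> 'a set set" where
  "cedges xs = pedges (xs @ [hd xs])"

definition cyc :: "'a set set \<Rightarrow> 'a list \<Rightarrow> bool" where
  "cyc F xs \<longleftrightarrow> length xs \<ge> 3 \<and> distinct xs \<and> cedges xs \<subseteq> F"

definition edgeset :: "'a set set \<Rightarrow> bool" where
  "edgeset F \<longleftrightarrow> finite F \<and> (\<forall>e\<in>F. \<exists>u v. e = {u, v} \<and> u \<noteq> v)"

section \<open>Basic properties of walks, connectivity and distance\<close>

lemma walk_mono: "F \<subseteq> G \<Longrightarrow> walk F n u v \<Longrightarrow> walk G n u v"
  by (induction n arbitrary: u) auto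

lemma walk_trans: "walk F i u v \<Longrightarrow> walk F j v w \<Longrightarrow> walk F (i + j) u w"
  by (induction i arbitrary: u) auto

lemma walk_edge: "{u, v} \<in> F \<Longrightarrow> walk F 1 u v"
  by simp

lemma walk_sym: "walk F n u v \<Longrightarrow> walk F n v u"
proof (induction n arbitrary: u)
  case (Suc n)
  then obtain w where "{u, w} \<in> F" "walk F n v w" by auto
  then show ?case using walk_trans[of F n v w 1 u] by (auto simp: insert_commute)
qed simp

lemma walk_isolated: "walk F n u v \<Longrightarrow> u \<notin> \<Union>F \<Longrightarrow> n = 0 \<and> v = u"
  by (cases n) auto

lemma conn_refl [simp]: "conn F u u"
  unfolding conn_def by (metis walk.simps(1))

lemma conn_sym: "conn F u v \<Longrightarrow> conn F v u"
  unfolding conn_def using walk_sym by metis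

lemma conn_trans: "conn F u v \<Longrightarrow> conn F v w \<Longrightarrow> conn F u w"
  unfolding conn_def using walk_trans by metis

lemma conn_edge: "{u, v} \<in> F \<Longrightarrow> conn F u v"
  unfolding conn_def using walk_edge by metis

lemma conn_mono: "F \<subseteq> G \<Longrightarrow> conn F u v \<Longrightarrow> conn G u v"
  unfolding conn_def using walk_mono by metis

lemma conn_isolated: "conn F u v \<Longrightarrow> u \<notin> \<Union>F \<Longrightarrow> v = u"
  unfolding conn_def using walk_isolated by metis

lemma conn_iff_rtranclp: "conn F u v \<longleftrightarrow> (adj F)\<^sup>*\<^sup>* u v"
proof
  assume "conn F u v"
  then obtain n where "walk F n u v" by (auto simp: conn_def)
  then show "(adj F)\<^sup>*\<^sup>* u v"
    by (induction n arbitrary: u) (auto simp: adj_def intro: converse_rtranclp_into_rtranclp)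
next
  assume "(adj F)\<^sup>*\<^sup>* u v"
  then show "conn F u v"
    by (induction rule: rtranclp_induct) (auto simp: adj_def intro: conn_edge conn_trans)
qed

lemma far_mono: "F \<subseteq> G \<Longrightarrow> far G k u v \<Longrightarrow> far F k u v"
  unfolding far_def by (meson walk_mono)

lemma farD: "far F k u v \<Longrightarrow> walk F n u v \<Longrightarrow> n < k \<Longrightarrow> False"
  by (auto simp: far_def)

lemma far_sym: "far F k u v \<Longrightarrow> far F k v u"
  unfolding far_def by (meson walk_sym)

lemma far_isolated: "u \<notin> \<Union>F \<Longrightarrow> u \<noteq> v \<Longrightarrow> far F k u v"
  unfolding far_def by (metis walk_isolated)

lemma girth9_mono: "F \<subseteq> G \<Longrightarrow> girth9 G \<Longrightarrow> girth9 F"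
  unfolding girth9_def by (meson Diff_mono far_mono order_refl subsetD)

section \<open>The effect of a new edge on distance, connectivity and girth\<close>

text \<open>The piece before the first use of the new edge and the piece after its last use both
  avoid that edge. They meet it at opposite ends, or at the same end, where they join to a walk in
  \<open>F\<close>.\<close>

lemma walk_insert:
  assumes "walk (insert {u, v} F) n a b"
  shows "(\<exists>m\<le>n. walk F m a b) \<or>
    (\<exists>i j. i + j < n \<and> (walk F i a u \<and> walk F j v b \<or> walk F i a v \<and> walk F j u b))"
  using assms
proof (induction n arbitrary: a)
  case (Suc n)
  then obtain a' where a': "{a, a'} \<in> insert {u, v} F" "walk (insert {u, v} F) n a' b"
    by auto
  note IH = Suc.IH[OF a'(2)]
  show ?case
  proof (cases "{a, a'} \<in> F")
    case True
    then have step: "walk F m a' c \<Longrightarrow> walk F (Suc m) a c" for m c by auto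
    from IH show ?thesis
    proof
      assume "\<exists>m\<le>n. walk F m a' b"
      then show ?thesis using step by (meson Suc_le_mono)
    next
      assume "\<exists>i j. i + j < n \<and> (walk F i a' u \<and> walk F j v b \<or> walk F i a' v \<and> walk F j u b)"
      then obtain i j where ij: "i + j < n" "walk F i a' u \<and> walk F j v b \<or> walk F i a' v \<and> walk F j u b"
        by blast
      then have "Suc i + j < Suc n" by simp
      moreover have "walk F (Suc i) a u \<and> walk F j v b \<or> walk F (Suc i) a v \<and> walk F j u b"
        using ij(2) step by blast
      ultimately show ?thesis by blast
    qed
  next
    case False
    then have uv: "a = u \<and> a' = v \<or> a = v \<and> a' = u"
      using a'(1) by (auto simp: doubleton_eq_iff)
    have refl: "walk F 0 x x" for x by simp
    from IH show ?thesis
    proof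
      assume "\<exists>m\<le>n. walk F m a' b"
      then obtain m where m: "0 + m < Suc n" "walk F m a' b" by (auto simp: less_Suc_eq_le)
      then show ?thesis using uv refl by blast
    next
      assume "\<exists>i j. i + j < n \<and> (walk F i a' u \<and> walk F j v b \<or> walk F i a' v \<and> walk F j u b)"
      then obtain i j where ij: "i + j < n" "walk F i a' u \<and> walk F j v b \<or> walk F i a' v \<and> walk F j u b"
        by blast
      then have *: "0 + j < Suc n" "j \<le> Suc n" by auto
      then show ?thesis using ij(2) uv refl by blast
    qed
  qed
qed auto

lemma far_insert:
  assumes "far F k a b" "\<And>i j. i + j + 1 < k \<Longrightarrow> walk F i a u \<Longrightarrow> walk F j v b \<Longrightarrow> False"
    "\<And>i j. i + j + 1 < k \<Longrightarrow> walk F i a v \<Longrightarrow> walk F j u b \<Longrightarrow> False"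
  shows "far (insert {u, v} F) k a b"
  unfolding far_def
proof (intro allI impI notI)
  fix n assume n: "n < k" "walk (insert {u, v} F) n a b"
  from walk_insert[OF n(2)] show False
  proof
    assume "\<exists>m\<le>n. walk F m a b" then show False using assms(1) n(1) by (auto simp: far_def)
  next
    assume "\<exists>i j. i + j < n \<and> (walk F i a u \<and> walk F j v b \<or> walk F i a v \<and> walk F j u b)"
    then obtain i j where "i + j < n" "walk F i a u \<and> walk F j v b \<or> walk F i a v \<and> walk F j u b"
      by blast
    moreover have "i + j + 1 < k" using calculation(1) n(1) by simp
    ultimately show False using assms(2,3) by blast
  qed
qed

text \<open>The only edge at \<open>x\<close> leads to \<open>y\<close>, so distances grow by one.
  The distance bounds for the star are built up in this way.\<close>

lemma far_insert_pendant:
  assumes "far F k y t" "x \<notin> \<Union>F" "t \<noteq> x"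
  shows "far (insert {x, y} F) (Suc k) x t"
proof (rule far_insert)
  show "far F (Suc k) x t" using far_isolated assms by fastforce
next
  fix i j assume *: "i + j + 1 < Suc k" "walk F i x x" "walk F j y t"
  then show False using assms(1) by (auto simp: far_def)
next
  fix i j assume *: "walk F j x t"
  then show False using walk_isolated[OF * assms(2)] assms(3) by simp
qed

lemma far_insert_other:
  assumes "far F k s t" "x \<notin> \<Union>F" "s \<noteq> x" "t \<noteq> x"
  shows "far (insert {x, y} F) k s t"
proof (rule far_insert)
  fix i j assume "walk F i s x"
  then have "walk F i x s" by (rule walk_sym)
  then show False using walk_isolated[of F i x s] assms by blast
next
  fix i j assume "walk F j x t"
  then show False using walk_isolated[of F j x t] assms by blast
qed (use assms in auto)

lemma conn_insert:
  assumes "conn (insert {u, v} F) a b"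
  shows "conn F a b \<or> conn F a u \<and> conn F v b \<or> conn F a v \<and> conn F u b"
proof -
  obtain n where "walk (insert {u, v} F) n a b" using assms by (auto simp: conn_def)
  from walk_insert[OF this] show ?thesis unfolding conn_def by blast
qed

lemma not_conn_insert_pendant:
  assumes "\<not> conn F y t" "x \<notin> \<Union>F" "t \<noteq> x"
  shows "\<not> conn (insert {x, y} F) x t"
  using conn_insert[of x y F x t] conn_isolated[of F x] assms by blast

lemma not_conn_insert_other:
  assumes "\<not> conn F s t" "x \<notin> \<Union>F" "s \<noteq> x" "t \<noteq> x"
  shows "\<not> conn (insert {x, y} F) s t"
  using conn_insert[of x y F s t] conn_isolated[of F x] conn_sym[of F s x] assms by blast

text \<open>A short detour around an old edge \<open>{a, b}\<close> that uses the new edge turns,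
  closed up through \<open>{a, b}\<close>, into an equally short walk from \<open>u\<close> to
  \<open>v\<close> in \<open>F\<close>.\<close>

lemma girth9_insert:
  assumes "girth9 F" "far F 8 u v"
  shows "girth9 (insert {u, v} F)"
  unfolding girth9_def
proof (intro allI impI)
  fix a b assume ab: "{a, b} \<in> insert {u, v} F"
  show "far (insert {u, v} F - {{a, b}}) 8 a b"
  proof (cases "{a, b} = {u, v}")
    case True
    then have "insert {u, v} F - {{a, b}} \<subseteq> F" by auto
    moreover have "far F 8 a b" using assms(2) True far_sym by (metis doubleton_eq_iff)
    ultimately show ?thesis by (rule far_mono)
  next
    case False
    then have abF: "{a, b} \<in> F" and eq: "insert {u, v} F - {{a, b}} = insert {u, v} (F - {{a, b}})"
      using ab by auto
    have sub: "F - {{a,b}} \<subseteq> F" by auto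
    show ?thesis unfolding eq
    proof (rule far_insert)
      show "far (F - {{a, b}}) 8 a b" using assms(1) abF by (simp add: girth9_def)
    next
      fix i j assume *: "i + j + 1 < (8::nat)" "walk (F - {{a, b}}) i a u" "walk (F - {{a, b}}) j v b"
      have "walk F (i + (1 + j)) u v"
        using walk_trans[OF walk_sym[OF walk_mono[OF sub *(2)]]
            walk_trans[OF walk_edge[OF abF] walk_sym[OF walk_mono[OF sub *(3)]]]] .
      from farD[OF assms(2) this] *(1) show False by simp
    next
      fix i j assume *: "i + j + 1 < (8::nat)" "walk (F - {{a, b}}) i a v" "walk (F - {{a, b}}) j u b"
      have "walk F (i + (1 + j)) v u"
        using walk_trans[OF walk_sym[OF walk_mono[OF sub *(2)]]
            walk_trans[OF walk_edge[OF abF] walk_sym[OF walk_mono[OF sub *(3)]]]] .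
      then have "walk F (i + (1 + j)) u v" by (rule walk_sym)
      from farD[OF assms(2) this] *(1) show False by simp
    qed
  qed
qed

section \<open>Edge sets of paths and cycles given as vertex lists\<close>

lemma pedges_append: "pedges (xs @ y # ys) = pedges (xs @ [y]) \<union> pedges (y # ys)"
proof (induction xs)
  case (Cons a xs) then show ?case by (cases xs) auto
qed simp

lemma pedges_neighbours:
  assumes "xs = as @ v # bs"
  shows "as \<noteq> [] \<Longrightarrow> {last as, v} \<in> pedges xs" "bs \<noteq> [] \<Longrightarrow> {v, hd bs} \<in> pedges xs"
proof -
  assume "as \<noteq> []"
  then have eq: "xs = butlast as @ last as # v # bs" using assms by simp
  show "{last as, v} \<in> pedges xs" using pedges_append[of "butlast as" "last as" "v # bs"] eq by auto
next
  assume "bs \<noteq> []"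
  then show "{v, hd bs} \<in> pedges xs" using assms pedges_append[of as v bs] by (cases bs) auto
qed

lemma pedges_snoc: "xs \<noteq> [] \<Longrightarrow> pedges (xs @ [y]) = insert {last xs, y} (pedges xs)"
proof (cases xs rule: rev_cases)
  case (snoc ys z)
  then show ?thesis using pedges_append[of ys z "[y]"] by auto
qed simp

lemma pedges_rev: "pedges (rev xs) = pedges xs"
proof (induction xs rule: pedges.induct)
  case (1 x y zs)
  have "pedges (rev (x # y # zs)) = pedges (rev zs @ [y]) \<union> pedges [y, x]"
    using pedges_append[of "rev zs" y "[x]"] by simp
  then show ?case using 1 by (auto simp: insert_commute)
qed auto

lemma pedges_nth: "pedges xs = {{xs ! i, xs ! Suc i} | i. Suc i < length xs}"
proof (induction xs rule: pedges.induct)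
  case (1 x y zs)
  have "{{(x # y # zs) ! i, (x # y # zs) ! Suc i} |i. Suc i < length (x # y # zs)}
      = insert {x, y} {{(y # zs) ! i, (y # zs) ! Suc i} |i. Suc i < length (y # zs)}" (is "?L = ?R")
  proof
    show "?L \<subseteq> ?R"
    proof
      fix e assume "e \<in> ?L"
      then obtain i where "e = {(x # y # zs) ! i, (x # y # zs) ! Suc i}" "Suc i < length (x # y # zs)"
        by blast
      then show "e \<in> ?R" by (cases i) auto
    qed
    show "?R \<subseteq> ?L"
    proof
      fix e assume "e \<in> ?R"
      then consider "e = {x, y}" | i where "e = {(y # zs) ! i, (y # zs) ! Suc i}" "Suc i < length (y # zs)"
        by blast
      then show "e \<in> ?L"
      proof cases
        case 1 then have "e = {(x # y # zs) ! 0, (x # y # zs) ! Suc 0} \<and> Suc 0 < length (x # y # zs)" by simp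
        then show ?thesis by blast
      next
        case 2 then have "e = {(x # y # zs) ! Suc i, (x # y # zs) ! Suc (Suc i)} \<and> Suc (Suc i) < length (x # y # zs)" by simp
        then show ?thesis by blast
      qed
    qed
  qed
  then show ?case using 1 by simp
qed auto

lemma pedges_subset: "e \<in> pedges xs \<Longrightarrow> e \<subseteq> set xs"
  by (induction xs rule: pedges.induct) auto

lemma Union_pedges: "length xs \<ge> 2 \<Longrightarrow> \<Union>(pedges xs) = set xs"
proof (induction xs rule: pedges.induct)
  case (1 x y zs) then show ?case by (cases zs) auto
qed auto

lemma finite_pedges [simp]: "finite (pedges xs)"
  by (induction xs rule: pedges.induct) auto

lemma finite_cedges [simp]: "finite (cedges xs)"
  by (simp add: cedges_def)

lemma walk_pedges:
  "xs \<noteq> [] \<Longrightarrow> pedges xs \<subseteq> F \<Longrightarrow> walk F (length xs - 1) (hd xs) (last xs)"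
proof (induction xs rule: pedges.induct)
  case (1 x y zs)
  then have "walk F (length zs) y (last (y # zs))" "{x, y} \<in> F" by auto
  then show ?case by auto
qed auto

lemma walk_imp_path:
  assumes "walk F n u v"
  obtains xs where "distinct xs" "xs \<noteq> []" "hd xs = u" "last xs = v" "pedges xs \<subseteq> F" "length xs \<le> Suc n"
  using assms
proof (induction n arbitrary: u thesis rule: less_induct)
  case (less n)
  show ?case
  proof (cases n)
    case 0
    then show ?thesis using less.prems(1)[of "[u]"] less.prems(2) by simp
  next
    case (Suc m)
    then obtain w where w: "{u, w} \<in> F" "walk F m w v"
      using less.prems(2) by auto
    obtain xs where xs: "distinct xs" "xs \<noteq> []" "hd xs = w" "last xs = v" "pedges xs \<subseteq> F" "length xs \<le> Suc m"
      using less.IH[of m w] w Suc by auto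
    show ?thesis
    proof (cases "u \<in> set xs")
      case False
      then show ?thesis using xs w Suc less.prems(1)[of "u # xs"]
        by (cases xs) auto
    next
      case True
      then obtain ys zs where yz: "xs = ys @ u # zs" by (meson split_list)
      then have "pedges (u # zs) \<subseteq> F" using xs(5) pedges_append[of ys u zs] by auto
      then show ?thesis using xs yz Suc less.prems(1)[of "u # zs"] by (auto split: if_splits)
    qed
  qed
qed

lemma conn_imp_path:
  assumes "conn F u v"
  obtains xs where "distinct xs" "xs \<noteq> []" "hd xs = u" "last xs = v" "pedges xs \<subseteq> F"
proof -
  obtain n where "walk F n u v" using assms by (auto simp: conn_def)
  from walk_imp_path[OF this] show thesis using that by blast
qed

lemma cedges_eq: "xs \<noteq> [] \<Longrightarrow> cedges xs = insert {last xs, hd xs} (pedges xs)"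
  by (simp add: cedges_def pedges_snoc)

lemma cedges_rotate: "cedges (xs @ ys) = cedges (ys @ xs)"
proof (cases "xs = [] \<or> ys = []")
  case False
  then obtain x xs' y ys' where [simp]: "xs = x # xs'" "ys = y # ys'" by (meson neq_Nil_conv)
  have "cedges (xs @ ys) = pedges ((x # xs') @ y # (ys' @ [x]))" by (simp add: cedges_def)
  also have "\<dots> = pedges (x # xs' @ [y]) \<union> pedges (y # ys' @ [x])"
    by (subst pedges_append) simp
  also have "\<dots> = pedges ((y # ys') @ x # (xs' @ [y]))"
    by (subst pedges_append) (auto simp: Un_commute)
  finally show ?thesis by (simp add: cedges_def)
qed auto

lemma cedges_split: "cedges (x # as @ y # bs) = pedges (x # as @ [y]) \<union> pedges (y # bs @ [x])"
  using pedges_append[of "x # as" y "bs @ [x]"] by (simp add: cedges_def)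

lemma cyc_rotate: "cyc F (xs @ ys) \<Longrightarrow> cyc F (ys @ xs)"
  unfolding cyc_def using cedges_rotate[of xs ys] by auto

lemma cyc_rotate_to:
  assumes "cyc F xs" "x \<in> set xs"
  obtains ys where "cyc F (x # ys)" "set (x # ys) = set xs" "cedges (x # ys) = cedges xs"
proof -
  obtain as bs where "xs = as @ x # bs" using assms(2) by (meson split_list)
  then show thesis using that[of "bs @ as"] cyc_rotate[of F as "x # bs"] assms(1)
      cedges_rotate[of as "x # bs"] by auto
qed

lemma Union_cedges: "cyc F xs \<Longrightarrow> \<Union>(cedges xs) = set xs"
  using Union_pedges[of "xs @ [hd xs]"] by (cases xs) (auto simp: cyc_def cedges_def)

text \<open>Removing the closing edge of a cycle leaves the rest intact, as needed to turn a cycle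
  into a walk around one of its edges.\<close>

lemma path_closing_edge:
  assumes "distinct xs" "length xs \<ge> 3"
  shows "{last xs, hd xs} \<notin> pedges xs"
proof
  assume "{last xs, hd xs} \<in> pedges xs"
  then obtain i where i: "Suc i < length xs" "{last xs, hd xs} = {xs ! i, xs ! Suc i}"
    by (auto simp: pedges_nth)
  have ne: "xs \<noteq> []" using assms by auto
  then have *: "last xs = xs ! (length xs - 1)" "hd xs = xs ! 0" by (auto simp: last_conv_nth hd_conv_nth)
  have "(length xs - 1 = i \<and> 0 = Suc i) \<or> (length xs - 1 = Suc i \<and> 0 = i)"
    using i(2) unfolding * doubleton_eq_iff using assms(1) i(1) ne
    by (auto simp: nth_eq_iff_index_eq)
  then show False using assms(2) i(1) by auto
qed

lemma girth9_cyc: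
  assumes "girth9 F" "cyc F xs" shows "length xs \<ge> 9"
proof (rule ccontr)
  assume "\<not> length xs \<ge> 9"
  have ne: "xs \<noteq> []" "length xs \<ge> 3" "distinct xs" using assms(2) by (auto simp: cyc_def)
  have ce: "cedges xs = insert {last xs, hd xs} (pedges xs)"
    using ne(1) by (rule cedges_eq)
  have "pedges xs \<subseteq> F - {{hd xs, last xs}}"
    using ce path_closing_edge[OF ne(3,2)] assms(2) by (auto simp: cyc_def insert_commute)
  from walk_pedges[OF ne(1) this] have "walk (F - {{hd xs, last xs}}) (length xs - 1) (hd xs) (last xs)" .
  moreover have "{hd xs, last xs} \<in> F" using ce assms(2) by (auto simp: cyc_def insert_commute)
  ultimately show False using assms(1) \<open>\<not> length xs \<ge> 9\<close> ne by (auto simp: girth9_def far_def)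
qed

lemma path_imp_cyc:
  assumes "distinct xs" "length xs \<ge> 3" "pedges xs \<subseteq> F" "{last xs, hd xs} \<in> F"
  shows "cyc F xs"
proof -
  have "cedges xs = insert {last xs, hd xs} (pedges xs)"
    using assms(2) by (intro cedges_eq) auto
  then show ?thesis using assms by (simp add: cyc_def)
qed

lemma cyc_is_cycle:
  assumes "cyc F xs" shows "is_cycle F xs"
proof -
  have ne: "length xs \<ge> 3" "distinct xs" "cedges xs \<subseteq> F" using assms by (auto simp: cyc_def)
  have "{xs ! i, xs ! ((i + 1) mod length xs)} \<in> F" if i: "i < length xs" for i
  proof -
    let ?ys = "xs @ [hd xs]"
    have "xs \<noteq> []" using ne(1) by auto
    then have "?ys ! Suc i = xs ! ((i + 1) mod length xs)" using i
      by (cases "Suc i = length xs") (auto simp: nth_append hd_conv_nth)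
    moreover have "?ys ! i = xs ! i" using i by (simp add: nth_append)
    moreover have "{?ys ! i, ?ys ! Suc i} \<in> cedges xs" unfolding cedges_def pedges_nth
      using i by auto
    ultimately show ?thesis using ne(3) by auto
  qed
  then show ?thesis using ne by (simp add: is_cycle_def)
qed

lemma path_of_short_walk:
  assumes "u \<noteq> v" "walk (F - {{u, v}}) n u v" "{u, v} \<in> F"
  obtains xs where "cyc F xs" "length xs \<le> Suc n" "hd xs = u" "last xs = v" "pedges xs \<subseteq> F - {{u, v}}"
proof -
  obtain xs where xs: "distinct xs" "xs \<noteq> []" "hd xs = u" "last xs = v" "pedges xs \<subseteq> F - {{u, v}}" "length xs \<le> Suc n"
    using walk_imp_path[OF assms(2)] .
  have "length xs \<noteq> 1" using xs assms(1) by (auto simp: length_Suc_conv)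
  moreover have "length xs \<noteq> 2" using xs by (auto simp: length_Suc_conv numeral_2_eq_2)
  moreover have "length xs \<noteq> 0" using xs(2) by simp
  ultimately have "length xs \<ge> 3" by linarith
  then have "cyc F xs" using path_imp_cyc[of xs F] xs assms(3) by (auto simp: insert_commute)
  then show thesis using that xs by blast
qed

lemma girth_imp_girth9:
  assumes "girth_at_least E 9" "edgeset E" shows "girth9 E"
  unfolding girth9_def far_def
proof (intro allI impI notI)
  fix u v n assume uv: "{u, v} \<in> E" "n < 8" "walk (E - {{u, v}}) n u v"
  have "u \<noteq> v" using assms(2) uv(1) unfolding edgeset_def by (metis doubleton_eq_iff insert_absorb2)
  then obtain xs where "cyc E xs" "length xs \<le> Suc n" using path_of_short_walk uv by metis
  then show False using assms(1) cyc_is_cycle uv(2) by (fastforce simp: girth_at_least_def)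
qed

section \<open>Partial decompositions\<close>

lemma degree_mono: "finite G \<Longrightarrow> F \<subseteq> G \<Longrightarrow> degree F v \<le> degree G v"
  unfolding degree_def by (intro card_mono) auto

lemma degree_0: "v \<notin> \<Union>F \<Longrightarrow> degree F v = 0"
  unfolding degree_def by (metis (mono_tags, lifting) Collect_empty_eq UnionI card.empty)

lemma degree_insert_le: "degree (insert e F) v \<le> Suc (degree F v)"
proof (cases "v \<in> e")
  case True
  then have "{f \<in> insert e F. v \<in> f} = insert e {f \<in> F. v \<in> f}" by auto
  then show ?thesis unfolding degree_def by (simp add: card_insert_le_m1 card_insert_if)
next
  case False
  then have "{f \<in> insert e F. v \<in> f} = {f \<in> F. v \<in> f}" by auto
  then show ?thesis unfolding degree_def by simp
qed

lemma degree_insert_other: "v \<notin> e \<Longrightarrow> degree (insert e F) v = degree F v"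
  unfolding degree_def by (rule arg_cong[where f = card]) auto

text \<open>Every edge is a bridge. A loop fails this by the walk of length 0.\<close>

definition acyc :: "'a set set \<Rightarrow> bool" where
  "acyc L \<longleftrightarrow> (\<forall>u v. {u, v} \<in> L \<longrightarrow> \<not> conn (L - {{u, v}}) u v)"

text \<open>Acyclic with maximum degree 2 describes a linear forest in a form that is easy to check
  when single edges are added.\<close>

definition ok :: "'a set set \<Rightarrow> 'a set set \<Rightarrow> bool" where
  "ok L M \<longleftrightarrow> finite L \<and> acyc L \<and> (\<forall>v. degree L v \<le> 2) \<and> matching M \<and> L \<inter> M = {}"

definition dec :: "'a set set \<Rightarrow> bool" where
  "dec E \<longleftrightarrow> (\<exists>L M. ok L M \<and> L \<union> M = E)"

lemma acyc_mono: "K \<subseteq> L \<Longrightarrow> acyc L \<Longrightarrow> acyc K"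
  unfolding acyc_def by (meson Diff_mono conn_mono order_refl subsetD)

lemma acyc_insert:
  assumes "acyc L" "\<not> conn L u v"
  shows "acyc (insert {u, v} L)"
  unfolding acyc_def
proof (intro allI impI notI)
  fix a b assume ab: "{a, b} \<in> insert {u, v} L" "conn (insert {u, v} L - {{a, b}}) a b"
  show False
  proof (cases "{a, b} = {u, v}")
    case True
    then have "insert {u, v} L - {{a, b}} \<subseteq> L" by auto
    then have "conn L a b" using ab(2) conn_mono by metis
    then show False using True assms(2) conn_sym by (metis doubleton_eq_iff)
  next
    case False
    then have L: "{a, b} \<in> L" "insert {u, v} L - {{a, b}} = insert {u, v} (L - {{a, b}})" using ab by auto
    have c: "conn L a b" "conn L b a" using L(1) conn_edge conn_sym by metis+
    have m: "conn (L - {{a, b}}) s t \<Longrightarrow> conn L s t" for s t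
      using conn_mono[of "L - {{a,b}}" L] by blast
    from conn_insert[of u v "L - {{a, b}}" a b] ab(2) L assms(1)
    have "conn (L - {{a, b}}) a u \<and> conn (L - {{a, b}}) v b \<or> conn (L - {{a, b}}) a v \<and> conn (L - {{a, b}}) u b"
      unfolding acyc_def by auto
    then have "conn L u v" using m c conn_sym conn_trans by metis
    then show False using assms(2) by blast
  qed
qed

lemma acyc_no_cyc: "acyc L \<Longrightarrow> cyc L xs \<Longrightarrow> False"
proof -
  assume a: "acyc L" "cyc L xs"
  have ne: "xs \<noteq> []" "length xs \<ge> 3" "distinct xs" using a(2) by (auto simp: cyc_def)
  have ce: "cedges xs = insert {last xs, hd xs} (pedges xs)"
    using ne(1) by (rule cedges_eq)
  have "pedges xs \<subseteq> L - {{hd xs, last xs}}"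
    using ce path_closing_edge[OF ne(3,2)] a(2) by (auto simp: cyc_def insert_commute)
  from walk_pedges[OF ne(1) this] have "conn (L - {{hd xs, last xs}}) (hd xs) (last xs)"
    unfolding conn_def by blast
  moreover have "{hd xs, last xs} \<in> L" using ce a(2) by (auto simp: cyc_def insert_commute)
  ultimately show False using a(1) by (auto simp: acyc_def)
qed

lemma ok_subset: "ok L M \<Longrightarrow> K \<subseteq> L \<Longrightarrow> N \<subseteq> M \<Longrightarrow> ok K N"
  unfolding ok_def matching_def using acyc_mono degree_mono
  by (smt (verit) disjoint_iff finite_subset le_trans subsetD)

lemma ok_insert_L:
  assumes "ok L M" "\<not> conn L x y" "degree L x \<le> 1" "degree L y \<le> 1" "{x, y} \<notin> M"
  shows "ok (insert {x, y} L) M"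
proof -
  have "degree (insert {x, y} L) v \<le> 2" for v
  proof (cases "v \<in> {x, y}")
    case True
    then have "degree L v \<le> 1" using assms(3,4) by blast
    then show ?thesis using degree_insert_le[of "{x,y}" L v] by linarith
  next
    case False
    then show ?thesis using degree_insert_other[of v "{x, y}" L] assms(1) by (simp add: ok_def)
  qed
  then show ?thesis using assms acyc_insert unfolding ok_def by auto
qed

lemma ok_insert_pendant:
  assumes "ok L M" "x \<notin> \<Union>L" "x \<noteq> y" "degree L y \<le> 1" "{x, y} \<notin> M"
  shows "ok (insert {x, y} L) M"
  using ok_insert_L[OF assms(1)] conn_isolated[OF _ assms(2)] degree_0[OF assms(2)] assms by fastforce

lemma ok_insert_M:
  assumes "ok L M" "x \<notin> \<Union>M" "y \<notin> \<Union>M" "{x, y} \<notin> L"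
  shows "ok L (insert {x, y} M)"
  using assms unfolding ok_def matching_def by auto

lemma card_nbrs_le_degree:
  assumes "finite L" "\<And>w. w \<in> W \<Longrightarrow> {v, w} \<in> L"
  shows "card W \<le> degree L v"
proof -
  have "inj_on (\<lambda>w. {v, w}) W" by (auto simp: inj_on_def doubleton_eq_iff)
  moreover have "(\<lambda>w. {v, w}) ` W \<subseteq> {e \<in> L. v \<in> e}" using assms(2) by auto
  moreover have "finite {e \<in> L. v \<in> e}" using assms(1) by simp
  ultimately show ?thesis unfolding degree_def by (rule card_inj_on_le)
qed

lemma degree_insert_edge_other:
  "v \<noteq> a \<Longrightarrow> v \<noteq> b \<Longrightarrow> degree (insert {a, b} L) v = degree L v"
  by (simp add: degree_insert_other)

lemma degree_frame:
  "L \<subseteq> L' \<Longrightarrow> L' \<subseteq> L \<union> K \<Longrightarrow> t \<notin> \<Union>K \<Longrightarrow> degree L' t = degree L t"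
  unfolding degree_def by (rule arg_cong[where f = card]) auto

text \<open>A path has only two ends. The path from \<open>x\<close> to \<open>y\<close> uses up the
  degrees of all its vertices, so it cannot be left, and \<open>z\<close> would be an inner vertex
  of it with two neighbours.\<close>

lemma three_leaves:
  assumes fin: "finite L" and deg: "\<And>v. degree L v \<le> 2"
    and leaf: "degree L x \<le> 1" "degree L y \<le> 1" "degree L z \<le> 1"
    and ne: "x \<noteq> y" "x \<noteq> z" "y \<noteq> z" and con: "conn L x y" "conn L x z"
  shows False
proof -
  obtain xs where xs: "distinct xs" "xs \<noteq> []" "hd xs = x" "last xs = y" "pedges xs \<subseteq> L"
    using con(1) by (rule conn_imp_path)
  have pre: "{last as, v} \<in> L" if "xs = as @ v # bs" "as \<noteq> []" for as v bs
    using pedges_neighbours(1)[OF that] xs(5) by auto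
  have post: "{v, hd bs} \<in> L" if "xs = as @ v # bs" "bs \<noteq> []" for as v bs
    using pedges_neighbours(2)[OF that] xs(5) by auto
  have W: "card W \<le> degree L v" if "\<And>w. w \<in> W \<Longrightarrow> {v, w} \<in> L" for v W
    using card_nbrs_le_degree[OF fin that] .
  have closed: "w \<in> set xs" if v: "v \<in> set xs" "{v, w} \<in> L" for v w
  proof (rule ccontr)
    assume w: "w \<notin> set xs"
    obtain as bs where ab: "xs = as @ v # bs" using v(1) by (meson split_list)
    show False
    proof (cases "as = [] \<or> bs = []")
      case False
      then have "card {last as, hd bs, w} \<le> degree L v"
        using pre[OF ab] post[OF ab] v(2) by (intro W) (auto simp: insert_commute)
      moreover have "last as \<noteq> hd bs" "last as \<noteq> w" "hd bs \<noteq> w"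
        using xs(1) ab w False by (auto simp: disjoint_iff) (metis hd_in_set last_in_set)
      ultimately show False using deg[of v] by simp
    next
      case True
      then consider "as = []" "bs \<noteq> []" | "as \<noteq> []" "bs = []" using xs(3,4) ab ne(1) by force
      then show False
      proof cases
        case 1
        then have "card {hd bs, w} \<le> degree L v" using post[OF ab] v(2) by (intro W) auto
        moreover have "hd bs \<noteq> w" using ab w 1 by auto
        moreover have "v = x" using xs(3) ab 1 by simp
        ultimately show False using leaf(1) by simp
      next
        case 2
        then have "card {last as, w} \<le> degree L v" using pre[OF ab] v(2)
          by (intro W) (auto simp: insert_commute)
        moreover have "last as \<noteq> w" using ab w 2 by auto
        moreover have "v = y" using xs(4) ab 2 by simp
        ultimately show False using leaf(2) by simp
      qed
    qed
  qed
  have "walk L n u v \<Longrightarrow> u \<in> set xs \<Longrightarrow> v \<in> set xs" for n u v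
    by (induction n arbitrary: u) (use closed in auto)
  then have "z \<in> set xs" using con(2) xs(2,3) unfolding conn_def by (metis hd_in_set)
  then obtain as bs where ab: "xs = as @ z # bs" by (meson split_list)
  have ne': "as \<noteq> []" "bs \<noteq> []" using xs(3,4) ab ne by auto
  then have "card {last as, hd bs} \<le> degree L z"
    using pre[OF ab] post[OF ab] by (intro W) (auto simp: insert_commute)
  moreover have "last as \<noteq> hd bs"
    using xs(1) ab last_in_set[OF ne'(1)] hd_in_set[OF ne'(2)] by auto
  ultimately show False using leaf(3) by simp
qed

section \<open>Reinserting a cycle\<close>

text \<open>A chain \<open>u, a\<^sub>1, y\<^sub>1, a\<^sub>2, y\<^sub>2, \<dots>\<close> is given by \<open>u\<close> and the list of the pairs \<open>(a\<^sub>i, y\<^sub>i)\<close>;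
  the \<open>a\<^sub>i\<close> are the 2-vertices.\<close>

fun zig :: "'a \<Rightarrow> ('a \<times> 'a) list \<Rightarrow> 'a set set" where
  "zig u [] = {}"
| "zig u ((a, y) # ps) = {{u, a}, {a, y}} \<union> zig y ps"

fun zverts :: "('a \<times> 'a) list \<Rightarrow> 'a list" where
  "zverts [] = []"
| "zverts ((a, y) # ps) = a # y # zverts ps"

fun zend :: "'a \<Rightarrow> ('a \<times> 'a) list \<Rightarrow> 'a" where
  "zend u [] = u"
| "zend u ((a, y) # ps) = zend y ps"

text \<open>A vertex of the removed cycle can be served again if it is not met by \<open>L\<close> (its remaining edge
  is in \<open>M\<close>, or it has none) or is a leaf of \<open>L\<close> not covered by \<open>M\<close>.\<close>

definition avail :: "'a set set \<Rightarrow> 'a set set \<Rightarrow> 'a \<Rightarrow> bool" where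
  "avail L M v \<longleftrightarrow> v \<notin> \<Union>L \<or> degree L v \<le> 1 \<and> v \<notin> \<Union>M"

definition fits :: "'a set set \<Rightarrow> 'a set set \<Rightarrow> ('a \<times> 'a) list \<Rightarrow> bool" where
  "fits L M ps \<longleftrightarrow> (\<forall>(a, y) \<in> set ps. a \<notin> \<Union>L \<and> a \<notin> \<Union>M \<and> avail L M y)"

lemma Union_zig: "\<Union>(zig u ps) \<subseteq> insert u (set (zverts ps))"
  by (induction u ps rule: zig.induct) auto

lemma zend_in: "zend u ps \<in> insert u (set (zverts ps))"
  by (induction u ps rule: zig.induct) auto

lemma set_zverts: "(a, y) \<in> set ps \<Longrightarrow> a \<in> set (zverts ps) \<and> y \<in> set (zverts ps)"
  by (induction ps rule: zverts.induct) auto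

lemma avail_frame:
  assumes "avail L M t" "L \<subseteq> L'" "L' \<subseteq> L \<union> K" "M' \<subseteq> M \<union> K" "t \<notin> \<Union>K"
  shows "avail L' M' t"
  using assms degree_frame[OF assms(2,3,5)] unfolding avail_def by auto

lemma fits_frame:
  assumes "fits L M ps" "L \<subseteq> L'" "L' \<subseteq> L \<union> K" "M' \<subseteq> M \<union> K" "\<Union>K \<inter> set (zverts ps) = {}"
  shows "fits L' M' ps"
  unfolding fits_def
proof clarify
  fix a y assume ay: "(a, y) \<in> set ps"
  then have *: "a \<notin> \<Union>K" "y \<notin> \<Union>K" using set_zverts[OF ay] assms(5) by auto
  have "a \<notin> \<Union>L" "a \<notin> \<Union>M" "avail L M y" using assms(1) ay by (auto simp: fits_def)
  then show "a \<notin> \<Union>L' \<and> a \<notin> \<Union>M' \<and> avail L' M' y"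
    using avail_frame[of L M y L' K M'] assms(2-4) * by blast
qed

text \<open>\<open>{u, a}\<close> goes into \<open>L\<close>. If \<open>y\<close> is not met by
  \<open>L\<close>, then \<open>{a, y}\<close> joins \<open>L\<close> as well, otherwise it becomes
  a matching edge. No question of connectivity arises, because \<open>a\<close> is new to
  \<open>L\<close>; and \<open>y\<close> keeps degree at most 1, so the next link can start there.
  The inclusions feed \<open>fits_frame\<close>.\<close>

lemma link:
  assumes ok: "ok L M" and av: "avail L M y" and a: "a \<notin> \<Union>L" "a \<notin> \<Union>M"
    and u: "degree L u \<le> 1" and d: "distinct [u, a, y]"
  obtains L' M' where "ok L' M'" "L' \<union> M' = L \<union> M \<union> {{u, a}, {a, y}}" "degree L' y \<le> 1"
    "L \<subseteq> L'" "L' \<subseteq> L \<union> {{u, a}, {a, y}}" "M \<subseteq> M'" "M' \<subseteq> insert {a, y} M"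
proof -
  let ?L = "insert {a, u} L"
  have aM: "{a, x} \<notin> M" "{a, x} \<notin> L" for x using a by auto
  have ok1: "ok ?L M" using ok_insert_pendant[OF ok a(1), of u] u d aM by auto
  have da: "degree ?L a \<le> 1" using degree_insert_le[of "{a,u}" L a] degree_0[OF a(1)] by simp
  show thesis
  proof (cases "y \<in> \<Union>L")
    case False
    then have y: "y \<notin> \<Union>?L" using d by auto
    have "ok (insert {y, a} ?L) M"
      using ok_insert_pendant[OF ok1 y, of a] da aM d by (auto simp: insert_commute)
    moreover have "degree (insert {y, a} ?L) y \<le> 1"
      using degree_insert_le[of "{y,a}" ?L y] degree_0[OF y] by simp
    ultimately show thesis by (intro that[of "insert {y, a} ?L" M]) (auto simp: insert_commute)
  next
    case True
    then have y: "degree L y \<le> 1" "y \<notin> \<Union>M" using av by (auto simp: avail_def)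
    have "{a, y} \<notin> ?L" using aM d by (auto simp: doubleton_eq_iff)
    then have "ok ?L (insert {a, y} M)" using ok_insert_M[OF ok1 a(2) y(2)] by simp
    moreover have "degree ?L y \<le> 1" using y(1) d by (auto simp: degree_insert_edge_other)
    ultimately show thesis by (intro that[of ?L "insert {a, y} M"]) (auto simp: insert_commute)
  qed
qed

text \<open>Iteration of \<open>link\<close> with no condition at the far end. New matching edges
  avoid \<open>u\<close>, which reserves \<open>u\<close> for a later matching edge.\<close>

lemma dead_chain:
  assumes "ok L M" "degree L u \<le> 1" "distinct (u # zverts ps)" "fits L M ps"
  shows "\<exists>L' M'. ok L' M' \<and> L' \<union> M' = L \<union> M \<union> zig u ps \<and> degree L' (zend u ps) \<le> 1 \<and>
    L \<subseteq> L' \<and> L' \<subseteq> L \<union> zig u ps \<and> M \<subseteq> M' \<and> M' \<subseteq> M \<union> zig u ps \<and> (\<forall>e\<in>M' - M. u \<notin> e)"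
  using assms
proof (induction u ps arbitrary: L M rule: zig.induct)
  case (1 u)
  then show ?case by (intro exI[of _ L] exI[of _ M]) auto
next
  case (2 u a y ps)
  have f: "avail L M y" "a \<notin> \<Union>L" "a \<notin> \<Union>M" "fits L M ps" using 2(5) by (auto simp: fits_def)
  have d: "distinct [u, a, y]" using 2(4) by auto
  obtain L1 M1 where 1: "ok L1 M1" "L1 \<union> M1 = L \<union> M \<union> {{u, a}, {a, y}}" "degree L1 y \<le> 1"
    "L \<subseteq> L1" "L1 \<subseteq> L \<union> {{u, a}, {a, y}}" "M \<subseteq> M1" "M1 \<subseteq> insert {a, y} M"
    using link[OF 2(2) f(1-3) 2(3) d] .
  have "fits L1 M1 ps" using 1 2(4) by (intro fits_frame[OF f(4), of L1 "{{u, a}, {a, y}}"]) auto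
  then obtain L' M' where L': "ok L' M'" "L' \<union> M' = L1 \<union> M1 \<union> zig y ps" "degree L' (zend y ps) \<le> 1"
    "L1 \<subseteq> L'" "L' \<subseteq> L1 \<union> zig y ps" "M1 \<subseteq> M'" "M' \<subseteq> M1 \<union> zig y ps"
    using 2(1)[OF 1(1,3)] 2(4) by auto
  have "u \<notin> \<Union>(zig y ps)" using Union_zig[of y ps] 2(4) by auto
  then have "\<forall>e\<in>M' - M. u \<notin> e" using L'(7) 1(7) d by auto
  moreover have "L' \<union> M' = L \<union> M \<union> zig u ((a, y) # ps)" using L'(2) 1(2) by auto
  moreover have "L' \<subseteq> L \<union> zig u ((a, y) # ps)" "M' \<subseteq> M \<union> zig u ((a, y) # ps)"
    using L'(5,7) 1(5,7) by auto
  moreover have "L \<subseteq> L'" "M \<subseteq> M'" using L'(4,6) 1(4,6) by blast+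
  moreover have "degree L' (zend u ((a, y) # ps)) \<le> 1" using L'(3) by simp
  ultimately show ?case using L'(1) by blast
qed

lemma ok_close:
  assumes "ok L M" "degree L y \<le> 1" "b \<notin> \<Union>L" "b \<notin> \<Union>M" "u \<notin> \<Union>M" "distinct [u, b, y]"
  shows "ok (insert {y, b} L) (insert {b, u} M)"
proof -
  have "{b, x} \<notin> M" "{b, x} \<notin> L" for x using assms by auto
  then have "ok (insert {b, y} L) M" using ok_insert_pendant[OF assms(1,3)] assms by auto
  moreover have "{b, u} \<notin> insert {b, y} L" using assms by (auto simp: doubleton_eq_iff)
  ultimately have "ok (insert {b, y} L) (insert {b, u} M)" using ok_insert_M assms(4,5) by metis
  then show ?thesis by (simp add: insert_commute)
qed

text \<open>Once around the cycle from a vertex \<open>u\<close> missed by \<open>M\<close>: the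
  last edge \<open>{b, u}\<close> becomes a matching edge, so \<open>L\<close> does not close
  up.\<close>

lemma cycle_close:
  assumes "ok L M" "degree L u \<le> 1" "u \<notin> \<Union>M" "fits L M ps" "b \<notin> \<Union>L" "b \<notin> \<Union>M"
    "distinct (u # zverts ps @ [b])" "ps \<noteq> []"
  shows "dec (L \<union> M \<union> zig u ps \<union> {{zend u ps, b}, {b, u}})"
proof -
  obtain L' M' where L': "ok L' M'" "L' \<union> M' = L \<union> M \<union> zig u ps" "degree L' (zend u ps) \<le> 1"
    "L' \<subseteq> L \<union> zig u ps" "M' \<subseteq> M \<union> zig u ps" "\<forall>e\<in>M' - M. u \<notin> e"
    using dead_chain[OF assms(1,2) _ assms(4)] assms(7) by auto
  have b: "b \<notin> \<Union>(zig u ps)" using Union_zig[of u ps] assms(7) by auto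
  obtain a y qs where "ps = (a, y) # qs" using assms(8) by (metis list.exhaust surj_pair)
  then have "zend u ps \<noteq> u" "zend u ps \<noteq> b" using zend_in[of y qs] assms(7) by auto
  then have "ok (insert {zend u ps, b} L') (insert {b, u} M')"
    using L' b assms by (intro ok_close) auto
  then show ?thesis unfolding dec_def using L'(2) by blast
qed

text \<open>For a cycle with two consecutive 3-vertices, \<open>zend u ps\<close> and
  \<open>q\<close>. As \<open>q\<close> is not met by \<open>L\<close>, the edge between them enters
  \<open>L\<close> as a pendant edge, and a second chain starts at \<open>q\<close>.\<close>

lemma cycle_close_direct:
  assumes "ok L M" "degree L u \<le> 1" "u \<notin> \<Union>M" "fits L M ps" "q \<notin> \<Union>L" "fits L M qs"
    "b \<notin> \<Union>L" "b \<notin> \<Union>M" "{zend u ps, q} \<notin> M"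
    "distinct (u # zverts ps @ q # zverts qs @ [b])"
  shows "dec (L \<union> M \<union> zig u ps \<union> {{zend u ps, q}} \<union> zig q qs \<union> {{zend q qs, b}, {b, u}})"
proof -
  obtain L1 M1 where 1: "ok L1 M1" "L1 \<union> M1 = L \<union> M \<union> zig u ps" "degree L1 (zend u ps) \<le> 1"
    "L \<subseteq> L1" "L1 \<subseteq> L \<union> zig u ps" "M1 \<subseteq> M \<union> zig u ps" "\<forall>e\<in>M1 - M. u \<notin> e"
    using dead_chain[OF assms(1,2) _ assms(4)] assms(10) by auto
  let ?p = "zend u ps"
  have p: "?p \<in> insert u (set (zverts ps))" by (rule zend_in)
  have Z: "\<Union>(zig u ps) \<subseteq> insert u (set (zverts ps))" by (rule Union_zig)
  have q: "q \<notin> \<Union>L1" "q \<noteq> ?p" using 1(5) assms(5,10) Z p by auto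
  have "{q, ?p} \<notin> M1" using 1(6) Z assms(9,10) by (auto simp: insert_commute)
  then have ok2: "ok (insert {q, ?p} L1) M1" using ok_insert_pendant[OF 1(1) q 1(3)] by simp
  have dq: "degree (insert {q, ?p} L1) q \<le> 1"
    using degree_insert_le[of "{q, ?p}" L1 q] degree_0[OF q(1)] by simp
  have ff: "fits (insert {q, ?p} L1) M1 qs"
  proof (rule fits_frame[OF assms(6)])
    show "insert {q, ?p} L1 \<subseteq> L \<union> insert {q, ?p} (zig u ps)" "L \<subseteq> insert {q, ?p} L1"
      "M1 \<subseteq> M \<union> insert {q, ?p} (zig u ps)" using 1 by auto
    show "\<Union> (insert {q, ?p} (zig u ps)) \<inter> set (zverts qs) = {}" using Z p assms(10) by auto
  qed
  have dd: "distinct (q # zverts qs)" using assms(10) by auto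
  obtain L2 M2 where D: "ok L2 M2 \<and> L2 \<union> M2 = insert {q, ?p} L1 \<union> M1 \<union> zig q qs \<and>
      degree L2 (zend q qs) \<le> 1 \<and> insert {q, ?p} L1 \<subseteq> L2 \<and> L2 \<subseteq> insert {q, ?p} L1 \<union> zig q qs \<and>
      M1 \<subseteq> M2 \<and> M2 \<subseteq> M1 \<union> zig q qs \<and> (\<forall>e\<in>M2 - M1. q \<notin> e)"
    using dead_chain[OF ok2 dq dd ff] by (elim exE) (rule that)
  then have 2: "ok L2 M2" "L2 \<union> M2 = insert {q, ?p} L1 \<union> M1 \<union> zig q qs"
    "degree L2 (zend q qs) \<le> 1" "L2 \<subseteq> insert {q, ?p} L1 \<union> zig q qs" "M2 \<subseteq> M1 \<union> zig q qs"
    by simp_all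
  have Z2: "\<Union>(zig q qs) \<subseteq> insert q (set (zverts qs))" by (rule Union_zig)
  have e: "zend q qs \<in> insert q (set (zverts qs))" by (rule zend_in)
  have bz: "b \<notin> \<Union>(zig u ps)" "b \<notin> \<Union>(zig q qs)" "b \<noteq> q" "b \<noteq> ?p" "u \<notin> \<Union>(zig q qs)"
    using Z Z2 p assms(10) by auto
  have "b \<notin> \<Union>L1" "b \<notin> \<Union>M1" using 1(5,6) bz(1) assms(7,8) by blast+
  then have b: "b \<notin> \<Union>L2" "b \<notin> \<Union>M2" using 2(4,5) bz by blast+
  have "u \<notin> \<Union>M1" using 1(7) assms(3) by blast
  then have u: "u \<notin> \<Union>M2" using 2(5) bz(5) by blast
  have "ok (insert {zend q qs, b} L2) (insert {b, u} M2)"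
    using 2(1,3) b u e assms(10) by (intro ok_close) auto
  moreover have "insert {zend q qs, b} L2 \<union> insert {b, u} M2 =
     L \<union> M \<union> zig u ps \<union> {{zend u ps, q}} \<union> zig q qs \<union> {{zend q qs, b}, {b, u}}"
    using 2(2) 1(2) by (auto simp: insert_commute)
  ultimately show ?thesis unfolding dec_def by blast
qed

text \<open>Both ends of the chain are already served, so one of the gaps between consecutive leaves of
  \<open>L\<close> on the chain must lie in \<open>L\<close> entirely. Such a gap is harmless if its two ends are not
  connected, and since a path of \<open>L\<close> has only two ends, a gap of this kind exists.\<close>

lemma live_chain:
  assumes "ok L M" "degree L x \<le> 1" "degree L y \<le> 1" "fits L M ps" "b \<notin> \<Union>L" "b \<notin> \<Union>M"
    "distinct (x # zverts ps @ [b, y])"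
    "\<not> conn L x y \<or> (\<exists>(a, z) \<in> set ps. z \<in> \<Union>L)"
  shows "dec (L \<union> M \<union> zig x ps \<union> {{zend x ps, b}, {b, y}})"
  using assms
proof (induction "length ps" arbitrary: ps L M x rule: less_induct)
  case less
  note ok = less.prems(1) and dx = less.prems(2) and dy = less.prems(3) and f = less.prems(4)
    and b = less.prems(5,6) and d = less.prems(7) and c = less.prems(8)
  have fin: "finite L" "\<And>v. degree L v \<le> 2" using ok by (auto simp: ok_def)
  show ?case
  proof (cases ps)
    case Nil
    have bM: "{b, s} \<notin> M" "{b, s} \<notin> L" for s using b by auto
    have ok1: "ok (insert {b, x} L) M" using ok_insert_pendant[OF ok b(1)] dx d bM by auto
    have "\<not> conn L x y" using c Nil by simp
    then have "\<not> conn (insert {b, x} L) b y" using b(1) d by (intro not_conn_insert_pendant) auto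
    moreover have "degree (insert {b, x} L) b \<le> 1"
      using degree_insert_le[of "{b,x}" L b] degree_0[OF b(1)] by simp
    moreover have "degree (insert {b, x} L) y \<le> 1"
      using d dy by (auto simp: degree_insert_edge_other)
    ultimately have "ok (insert {b, y} (insert {b, x} L)) M" using ok_insert_L[OF ok1] bM by blast
    moreover have "insert {b, y} (insert {b, x} L) \<union> M = L \<union> M \<union> zig x ps \<union> {{zend x ps, b}, {b, y}}"
      using Nil by (auto simp: insert_commute)
    ultimately show ?thesis unfolding dec_def by blast
  next
    case (Cons p qs)
    obtain a z where p: "ps = (a, z) # qs" using Cons by (cases p) auto
    have a: "a \<notin> \<Union>L" "a \<notin> \<Union>M" and av: "avail L M z" and fq: "fits L M qs"
      using f p by (auto simp: fits_def)
    have aM: "{a, s} \<notin> M" "{a, s} \<notin> L" for s using a by auto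
    have ok1: "ok (insert {a, x} L) M" using ok_insert_pendant[OF ok a(1)] dx d aM p by auto
    have da: "degree (insert {a, x} L) a \<le> 1"
      using degree_insert_le[of "{a,x}" L a] degree_0[OF a(1)] by simp
    have len: "length qs < length ps" using p by simp
    show ?thesis
    proof (cases "z \<in> \<Union>L")
      case False
      let ?L = "insert {z, a} (insert {a, x} L)"
      have z: "z \<notin> \<Union>(insert {a, x} L)" using False d p by auto
      have "{z, a} \<notin> M" using aM(1)[of z] by (simp add: insert_commute)
      then have ok2: "ok ?L M" using ok_insert_pendant[OF ok1 z, of a] da d p by auto
      have 1: "degree ?L z \<le> 1" using degree_insert_le[of "{z,a}" "insert {a,x} L" z] degree_0[OF z] by simp
      have 2: "degree ?L y \<le> 1" using d dy p by (auto simp: degree_insert_edge_other)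
      have 3: "fits ?L M qs" using d p by (intro fits_frame[OF fq, of ?L "{{z,a},{a,x}}"]) auto
      have 4: "\<not> conn ?L z y \<or> (\<exists>(a, z) \<in> set qs. z \<in> \<Union>?L)"
      proof (cases "conn L x y")
        case True
        then show ?thesis using c p False by auto
      next
        case False
        then have "\<not> conn (insert {a, x} L) a y" using a d p by (intro not_conn_insert_pendant) auto
        moreover have "y \<noteq> z" using d p by auto
        ultimately have "\<not> conn ?L z y" using not_conn_insert_pendant[OF _ z] by blast
        then show ?thesis by blast
      qed
      have 5: "b \<notin> \<Union>?L" "distinct (z # zverts qs @ [b, y])" using b d p by auto
      have "dec (?L \<union> M \<union> zig z qs \<union> {{zend z qs, b}, {b, y}})"
        using less.hyps[OF len ok2 1 2 3 5(1) b(2) 5(2) 4] .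
      moreover have "?L \<union> M \<union> zig z qs \<union> {{zend z qs, b}, {b, y}} = L \<union> M \<union> zig x ps \<union> {{zend x ps, b}, {b, y}}"
        using p by (auto simp: insert_commute)
      ultimately show ?thesis by simp
    next
      case True
      then have z: "degree L z \<le> 1" "z \<notin> \<Union>M" using av by (auto simp: avail_def)
      show ?thesis
      proof (cases "\<not> conn L z y \<or> (\<exists>(a, z) \<in> set qs. z \<in> \<Union>L)")
        case True
        let ?L = "insert {a, x} L" and ?M = "insert {a, z} M"
        have "{a, z} \<notin> ?L" using aM d p by (auto simp: doubleton_eq_iff)
        then have ok2: "ok ?L ?M" using ok_insert_M[OF ok1 a(2) z(2)] by simp
        have 1: "degree ?L z \<le> 1" using d z p by (auto simp: degree_insert_edge_other)
        have 2: "degree ?L y \<le> 1" using d dy p by (auto simp: degree_insert_edge_other)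
        have 3: "fits ?L ?M qs" using d p by (intro fits_frame[OF fq, of ?L "{{a,z},{a,x}}"]) auto
        have 4: "\<not> conn ?L z y \<or> (\<exists>(a, z) \<in> set qs. z \<in> \<Union>?L)"
          using True not_conn_insert_other[of L z y a x] a d p by auto
        have 5: "b \<notin> \<Union>?L" "b \<notin> \<Union>?M" "distinct (z # zverts qs @ [b, y])" using b d p by auto
        have "dec (?L \<union> ?M \<union> zig z qs \<union> {{zend z qs, b}, {b, y}})"
          using less.hyps[OF len ok2 1 2 3 5(1,2,3) 4] .
        moreover have "?L \<union> ?M \<union> zig z qs \<union> {{zend z qs, b}, {b, y}} = L \<union> M \<union> zig x ps \<union> {{zend x ps, b}, {b, y}}"
          using p by (auto simp: insert_commute)
        ultimately show ?thesis by simp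
      next
        case False
        \<comment> \<open>Here \<open>z\<close> is the last leaf of \<open>L\<close> on the chain
          and lies on the same path as \<open>y\<close>, so \<open>x\<close> lies on another path.
          The gap from \<open>x\<close> to \<open>z\<close> goes into \<open>L\<close> as a whole,
          and the gap after \<open>z\<close> starts with a matching edge at
          \<open>z\<close>.\<close>
        then have zy: "conn L z y" and noL: "\<And>a z. (a, z) \<in> set qs \<Longrightarrow> z \<notin> \<Union>L" by auto
        have "\<not> conn L x z"
        proof
          assume "conn L x z"
          then have "conn L z x" by (rule conn_sym)
          then show False using three_leaves[OF fin z(1) dy dx _ _ _ zy] d p by auto
        qed
        then have nc: "\<not> conn (insert {a, x} L) a z" using a d p by (intro not_conn_insert_pendant) auto
        have dz: "degree (insert {a, x} L) z \<le> 1" using d z p by (auto simp: degree_insert_edge_other)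
        let ?L = "insert {a, z} (insert {a, x} L)"
        have ok2: "ok ?L M" using ok_insert_L[OF ok1 nc da dz] aM by blast
        show ?thesis
        proof (cases qs)
          case Nil
          have "{b, z} \<notin> ?L" using b d p by (auto simp: doubleton_eq_iff)
          have "degree ?L y \<le> 1" using d dy p by (auto simp: degree_insert_edge_other)
          then have "ok (insert {y, b} ?L) (insert {b, z} M)"
            using ok_close[OF ok2, of y b z] b z d p by auto
          moreover have "insert {y, b} ?L \<union> insert {b, z} M = L \<union> M \<union> zig x ps \<union> {{zend x ps, b}, {b, y}}"
            using p Nil by (auto simp: insert_commute)
          ultimately show ?thesis unfolding dec_def by blast
        next
          case (Cons p' rs)
          obtain a' z' where p': "qs = (a', z') # rs" using Cons by (cases p') auto
          have a': "a' \<notin> \<Union>L" "a' \<notin> \<Union>M" and fr: "fits L M rs" and z'L: "z' \<notin> \<Union>L"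
            using fq p' noL by (auto simp: fits_def)
          let ?L2 = "insert {z', a'} ?L" and ?M2 = "insert {a', z} M"
          have z': "z' \<notin> \<Union>?L" "a' \<notin> \<Union>?L" using z'L a' d p p' by auto
          have "degree ?L z' \<le> 1" using degree_0[OF z'(1)] by simp
          then have ok3: "ok ?L2 ?M2" using ok_close[OF ok2, of z' a' z] z' a' z d p p' by auto
          have 1: "degree ?L2 z' \<le> 1" using degree_insert_le[of "{z',a'}" ?L z'] degree_0[OF z'(1)] by simp
          have 2: "degree ?L2 y \<le> 1" using d p p' dy by (auto simp: degree_insert_edge_other)
          have 3: "fits ?L2 ?M2 rs" using d p p'
            by (intro fits_frame[OF fr, of ?L2 "{{z',a'},{a,z},{a,x},{a',z}}"]) auto
          \<comment> \<open>\<open>a'\<close> and \<open>z'\<close> are new to \<open>L\<close>, so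
            the piece to be continued is separate from the path of \<open>y\<close>, and the first
            alternative of the condition holds from now on.\<close>
          have "\<not> conn ?L a' y" using conn_isolated[OF _ z'(2)] d p p' by auto
          then have "\<not> conn ?L2 z' y" using z' d p p' by (intro not_conn_insert_pendant) auto
          then have 4: "\<not> conn ?L2 z' y \<or> (\<exists>(a, z) \<in> set rs. z \<in> \<Union>?L2)" by blast
          have 5: "b \<notin> \<Union>?L2" "b \<notin> \<Union>?M2" "distinct (z' # zverts rs @ [b, y])" "length rs < length ps"
            using b d p p' by auto
          have "dec (?L2 \<union> ?M2 \<union> zig z' rs \<union> {{zend z' rs, b}, {b, y}})"
            using less.hyps[OF 5(4) ok3 1 2 3 5(1,2,3) 4] .
          moreover have "?L2 \<union> ?M2 \<union> zig z' rs \<union> {{zend z' rs, b}, {b, y}} = L \<union> M \<union> zig x ps \<union> {{zend x ps, b}, {b, y}}"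
            using p p' by (auto simp: insert_commute)
          ultimately show ?thesis by simp
        qed
      qed
    qed
  qed
qed

section \<open>Plane drawings\<close>

text \<open>The parametrization is forgotten, so that arcs can be reversed, glued and split as point
  sets.\<close>

definition is_arc :: "complex set \<Rightarrow> complex \<Rightarrow> complex \<Rightarrow> bool" where
  "is_arc S a b \<longleftrightarrow> (\<exists>g. arc g \<and> path_image g = S \<and> pathstart g = a \<and> pathfinish g = b)"

text \<open>The vertices are those of \<open>\<Union>E\<close>, so a drawing depends on the edge set
  alone. Complex numbers serve as the plane for the sake of Jordan curves and of inversion.\<close>

definition drawing :: "'a set set \<Rightarrow> ('a \<Rightarrow> complex) \<Rightarrow> ('a set \<Rightarrow> complex set) \<Rightarrow> bool" where
  "drawing E p S \<longleftrightarrow> inj_on p (\<Union>E) \<and>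
     (\<forall>u v. {u, v} \<in> E \<longrightarrow> is_arc (S {u, v}) (p u) (p v)) \<and>
     (\<forall>e\<in>E. S e \<inter> p ` \<Union>E = p ` e) \<and>
     (\<forall>e\<in>E. \<forall>e'\<in>E. e \<noteq> e' \<longrightarrow> S e \<inter> S e' \<subseteq> p ` (e \<inter> e'))"

definition drawable :: "'a set set \<Rightarrow> bool" where
  "drawable E \<longleftrightarrow> (\<exists>p S. drawing E p S)"

definition curve :: "('a set \<Rightarrow> complex set) \<Rightarrow> 'a set set \<Rightarrow> complex set" where
  "curve S K = \<Union>(S ` K)"

text \<open>Only the open edge has to lie inside, since its ends may lie on the curve.\<close>

definition insE :: "'a set set \<Rightarrow> ('a \<Rightarrow> complex) \<Rightarrow> ('a set \<Rightarrow> complex set) \<Rightarrow> 'a set set \<Rightarrow> 'a set set" where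
  "insE E p S K = {e \<in> E - K. S e - p ` e \<subseteq> inside (curve S K)}"

definition insV :: "'a set set \<Rightarrow> ('a \<Rightarrow> complex) \<Rightarrow> ('a set \<Rightarrow> complex set) \<Rightarrow> 'a set set \<Rightarrow> 'a set" where
  "insV E p S K = {v \<in> \<Union>E. p v \<in> inside (curve S K)}"

section \<open>Arcs in the plane\<close>

lemma is_arc_sym: "is_arc S a b \<Longrightarrow> is_arc S b a"
  unfolding is_arc_def by (metis arc_reversepath path_image_reversepath pathfinish_reversepath pathstart_reversepath)

lemma is_arc_facts:
  assumes "is_arc S a b"
  shows "a \<noteq> b" "a \<in> S" "b \<in> S" "compact S" "connected (S - {a, b})" "connected (S - {a})"
    "connected (S - {b})" "S - {a, b} \<noteq> {}"
proof -
  obtain g where g: "arc g" "path_image g = S" "pathstart g = a" "pathfinish g = b"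
    using assms by (auto simp: is_arc_def)
  show "a \<noteq> b" "a \<in> S" "b \<in> S" "compact S"
    using arc_distinct_ends[OF g(1)] g by (auto simp: compact_arc_image)
  have inj: "inj_on g {0..1}" and cont: "continuous_on {0..1} g" using g(1) by (auto simp: arc_def path_def)
  have img: "S = g ` {0..1}" "a = g 0" "b = g 1" using g by (auto simp: path_image_def pathstart_def pathfinish_def)
  have "g ` {0..1} - g ` X = g ` ({0..1} - X)" if "X \<subseteq> {0..1}" for X
    using inj that by (auto simp: inj_on_def)
  from this[of "{0, 1}"] this[of "{0}"] this[of "{1}"]
  have e: "S - {a, b} = g ` {0<..<1}" "S - {a} = g ` {0<..1}" "S - {b} = g ` {0..<1}"
    by (auto simp: img intro!: arg_cong[where f = "\<lambda>X. g ` X"])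
  show "connected (S - {a, b})" "connected (S - {a})" "connected (S - {b})" "S - {a, b} \<noteq> {}"
    unfolding e by (auto intro!: connected_continuous_image continuous_on_subset[OF cont])
qed

lemma is_arc_join:
  assumes "is_arc S a b" "is_arc T b c" "S \<inter> T \<subseteq> {b}"
  shows "is_arc (S \<union> T) a c"
proof -
  obtain g h where g: "arc g" "path_image g = S" "pathstart g = a" "pathfinish g = b"
    and h: "arc h" "path_image h = T" "pathstart h = b" "pathfinish h = c"
    using assms by (auto simp: is_arc_def)
  then have "arc (g +++ h)" using assms(3) by (intro arc_join) auto
  then show ?thesis unfolding is_arc_def using g h
    by (intro exI[of _ "g +++ h"]) (auto simp: path_image_join)
qed

lemma is_arc_split:
  assumes "is_arc S a b"
  obtains c S1 S2 where "S = S1 \<union> S2" "is_arc S1 a c" "is_arc S2 c b" "S1 \<inter> S2 = {c}" "c \<noteq> a" "c \<noteq> b"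
proof -
  obtain g where g: "arc g" "path_image g = S" "pathstart g = a" "pathfinish g = b"
    using assms by (auto simp: is_arc_def)
  have inj: "inj_on g {0..1}" using g(1) by (simp add: arc_def)
  let ?S1 = "g ` {0..1/2}" and ?S2 = "g ` {1/2..1}" and ?c = "g (1/2)"
  have "{0..1/2} \<union> {1/2..1} = {0..1::real}" "{0..1/2} \<inter> {1/2..1} = {1/2::real}" by auto
  then have "S = ?S1 \<union> ?S2" using g(2) by (metis image_Un path_image_def)
  moreover have "?S1 \<inter> ?S2 = {?c}"
    using inj_on_image_Int[OF inj, of "{0..1/2}" "{1/2..1}"] \<open>{0..1/2} \<inter> {1/2..1} = {1/2::real}\<close> by simp
  moreover have e: "g 0 = a" "g 1 = b" using g by (auto simp: pathstart_def pathfinish_def)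
  moreover have "is_arc ?S1 a ?c" unfolding is_arc_def using e(1) arc_subpath_arc[OF g(1), of 0 "1/2"]
    by (intro exI[of _ "subpath 0 (1/2) g"]) (auto simp: path_image_subpath)
  moreover have "is_arc ?S2 ?c b" unfolding is_arc_def using e(2) arc_subpath_arc[OF g(1), of "1/2" 1]
    by (intro exI[of _ "subpath (1/2) 1 g"]) (auto simp: path_image_subpath)
  moreover have "?c \<noteq> a" "?c \<noteq> b"
    using e inj_on_eq_iff[OF inj, of "1/2" 0] inj_on_eq_iff[OF inj, of "1/2" 1] by auto
  ultimately show thesis using that by blast
qed

lemma is_arc_image:
  fixes f :: "complex \<Rightarrow> complex"
  assumes "is_arc S a b" "continuous_on S f" "inj_on f S"
  shows "is_arc (f ` S) (f a) (f b)"
proof -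
  obtain g where g: "arc g" "path_image g = S" "pathstart g = a" "pathfinish g = b"
    using assms by (auto simp: is_arc_def)
  have "arc (f \<circ> g)"
    using g assms(2,3) unfolding arc_def
    by (auto intro!: path_continuous_image comp_inj_on simp: path_image_def)
  then show ?thesis unfolding is_arc_def using g
    by (intro exI[of _ "f \<circ> g"]) (auto simp: path_image_compose pathstart_compose pathfinish_compose)
qed

text \<open>Otherwise an open subset of the plane would embed in the line. This yields a point
  inside a cycle and off the whole drawing.\<close>

lemma interior_is_arc:
  assumes "is_arc S a b" shows "interior S = {}"
proof (rule ccontr)
  assume ne: "interior S \<noteq> {}"
  obtain g where g: "arc g" "path_image g = S" using assms by (auto simp: is_arc_def)
  obtain h where h: "homeomorphism {0..1} S g h" using homeomorphism_arc[OF g(1)] g(2) by metis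
  have "continuous_on S h" using h by (simp add: homeomorphism_def)
  then have 1: "continuous_on (interior S) h" by (rule continuous_on_subset) (rule interior_subset)
  have "\<And>y. y \<in> S \<Longrightarrow> g (h y) = y" using h by (simp add: homeomorphism_def)
  then have "inj_on h S" by (rule inj_on_inverseI)
  then have 2: "inj_on h (interior S)" by (rule inj_on_subset) (rule interior_subset)
  have "DIM(complex) \<le> DIM(real)" by (rule invariance_of_dimension[OF 1 open_interior 2 ne])
  then show False by simp
qed

section \<open>Drawings under deletion, suppression and subdivision\<close>

lemma drawing_arc: "drawing E p S \<Longrightarrow> {u, v} \<in> E \<Longrightarrow> is_arc (S {u, v}) (p u) (p v)"
  by (simp add: drawing_def)

lemma drawing_inj: "drawing E p S \<Longrightarrow> u \<in> \<Union>E \<Longrightarrow> v \<in> \<Union>E \<Longrightarrow> p u = p v \<longleftrightarrow> u = v"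
  unfolding drawing_def by (metis inj_on_eq_iff)

lemma drawing_vertex: "drawing E p S \<Longrightarrow> e \<in> E \<Longrightarrow> v \<in> \<Union>E \<Longrightarrow> p v \<in> S e \<longleftrightarrow> v \<in> e"
proof -
  assume d: "drawing E p S" and e: "e \<in> E" and v: "v \<in> \<Union>E"
  have "S e \<inter> p ` \<Union>E = p ` e" using d e by (simp add: drawing_def)
  then have "p v \<in> S e \<longleftrightarrow> p v \<in> p ` e" using v by blast
  also have "\<dots> \<longleftrightarrow> v \<in> e" using drawing_inj[OF d] v e by blast
  finally show ?thesis .
qed

lemma drawing_Int: "drawing E p S \<Longrightarrow> e \<in> E \<Longrightarrow> e' \<in> E \<Longrightarrow> e \<noteq> e' \<Longrightarrow> S e \<inter> S e' \<subseteq> p ` (e \<inter> e')"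
  by (simp add: drawing_def)

lemma image_trace:
  assumes "\<And>x. x \<in> U \<Longrightarrow> p x \<in> X \<longleftrightarrow> x \<in> e" "e \<subseteq> U"
  shows "X \<inter> p ` U = p ` e"
proof
  show "X \<inter> p ` U \<subseteq> p ` e" using assms(1) by auto
  show "p ` e \<subseteq> X \<inter> p ` U"
  proof
    fix z assume "z \<in> p ` e"
    then obtain x where "x \<in> e" "z = p x" by auto
    then show "z \<in> X \<inter> p ` U" using assms(1)[of x] assms(2) by auto
  qed
qed

lemma drawable_subset:
  assumes "drawable E" "F \<subseteq> E" shows "drawable F"
proof -
  obtain p S where d: "drawing E p S" using assms(1) by (auto simp: drawable_def)
  have U: "\<Union>F \<subseteq> \<Union>E" using assms(2) by blast
  have "drawing F p S" unfolding drawing_def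
  proof (intro conjI allI ballI impI)
    have "inj_on p (\<Union>E)" using d by (simp add: drawing_def)
    then show "inj_on p (\<Union>F)" using U by (rule inj_on_subset)
    show "S e \<inter> p ` \<Union>F = p ` e" if "e \<in> F" for e
    proof -
      have eE: "e \<in> E" using that assms(2) by auto
      have "p x \<in> S e \<longleftrightarrow> x \<in> e" if "x \<in> \<Union>F" for x
        using drawing_vertex[OF d eE, of x] that U by auto
      moreover have "e \<subseteq> \<Union>F" using that by auto
      ultimately show ?thesis by (rule image_trace)
    qed
    show "is_arc (S {u, v}) (p u) (p v)" if "{u, v} \<in> F" for u v
      by (rule drawing_arc[OF d]) (use that assms(2) in blast)
    show "S e \<inter> S f \<subseteq> p ` (e \<inter> f)" if "e \<in> F" "f \<in> F" "e \<noteq> f" for e f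
      by (rule drawing_Int[OF d]) (use that assms(2) in blast)+
  qed
  then show ?thesis by (auto simp: drawable_def)
qed

text \<open>Suppression of the 2-vertex \<open>a\<close>: the arcs of its two edges meet only in
  \<open>a\<close> and form a single arc.\<close>

lemma drawable_contract:
  assumes dr: "drawable E" and E: "{v, a} \<in> E" "{a, l} \<in> E" "{v, l} \<notin> E"
    and ne: "v \<noteq> a" "l \<noteq> a" "v \<noteq> l" and only: "\<And>e. e \<in> E \<Longrightarrow> a \<in> e \<Longrightarrow> e = {v, a} \<or> e = {a, l}"
  shows "drawable (insert {v, l} (E - {{v, a}, {a, l}}))"
proof -
  obtain p S where d: "drawing E p S" using dr by (auto simp: drawable_def)
  define F where "F = insert {v, l} (E - {{v, a}, {a, l}})"
  define S' where "S' = S({v, l} := S {v, a} \<union> S {a, l})"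
  have F: "e \<in> F \<longleftrightarrow> e = {v, l} \<or> e \<in> E - {{v, a}, {a, l}}" for e by (simp add: F_def)
  have U: "\<Union>F \<subseteq> \<Union>E - {a}"
  proof
    fix x assume "x \<in> \<Union>F"
    then obtain e where e: "e \<in> F" "x \<in> e" by blast
    show "x \<in> \<Union>E - {a}"
    proof (cases "e = {v, l}")
      case True
      then have "x = v \<or> x = l" using e(2) by simp
      then show ?thesis using E(1,2) ne by auto
    next
      case False
      then have eE: "e \<in> E" "e \<noteq> {v, a}" "e \<noteq> {a, l}" using e(1) F[of e] by simp_all
      then have "a \<notin> e" using only[OF eE(1)] by metis
      then have "x \<noteq> a" using e(2) by metis
      then show ?thesis using e(2) eE(1) by auto
    qed
  qed
  have ne': "{v, a} \<noteq> {a, l}" using ne by (auto simp: doubleton_eq_iff)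
  have va: "S {v, a} \<inter> S {a, l} \<subseteq> {p a}"
    using drawing_Int[OF d E(1,2) ne'] ne by auto
  have arc: "is_arc (S {v, a} \<union> S {a, l}) (p v) (p l)"
    by (rule is_arc_join[OF drawing_arc[OF d E(1)] drawing_arc[OF d E(2)] va])
  have S: "S' e = S e" if "e \<in> E" for e using that E(3) by (auto simp: S'_def)
  have Sv: "S' {v, l} = S {v, a} \<union> S {a, l}" by (simp add: S'_def)
  have new: "(S {v, a} \<union> S {a, l}) \<inter> S e \<subseteq> p ` ({v, l} \<inter> e)" if "e \<in> E - {{v, a}, {a, l}}" for e
    using drawing_Int[OF d E(1), of e] drawing_Int[OF d E(2), of e] that only[of e] by auto
  have "drawing F p S'" unfolding drawing_def
  proof (intro conjI allI ballI impI)
    have "inj_on p (\<Union>E)" using d by (simp add: drawing_def)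
    then show "inj_on p (\<Union>F)" by (rule inj_on_subset) (use U in auto)
  next
    fix x y assume xy: "{x, y} \<in> F"
    show "is_arc (S' {x, y}) (p x) (p y)"
    proof (cases "{x, y} = {v, l}")
      case True
      then have e: "S' {x, y} = S {v, a} \<union> S {a, l}" using Sv by simp
      show ?thesis unfolding e using True arc is_arc_sym[OF arc] by (auto simp: doubleton_eq_iff)
    next
      case False
      then have xyE: "{x, y} \<in> E" using xy F[of "{x, y}"] False by simp
      show ?thesis unfolding S[OF xyE] by (rule drawing_arc[OF d xyE])
    qed
  next
    fix e assume e: "e \<in> F"
    show "S' e \<inter> p ` \<Union>F = p ` e"
    proof (cases "e = {v, l}")
      case False
      then have eE: "e \<in> E" using e F[of e] by simp
      have "p x \<in> S e \<longleftrightarrow> x \<in> e" if "x \<in> \<Union>F" for x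
        using drawing_vertex[OF d eE, of x] that U by auto
      moreover have "e \<subseteq> \<Union>F" using e by auto
      ultimately show ?thesis unfolding S[OF eE] by (rule image_trace)
    next
      case True
      have "p x \<in> S {v, a} \<union> S {a, l} \<longleftrightarrow> x \<in> {v, l}" if "x \<in> \<Union>F" for x
      proof -
        have "x \<in> \<Union>E" "x \<noteq> a" using that U by auto
        then show ?thesis using drawing_vertex[OF d E(1), of x] drawing_vertex[OF d E(2), of x] by auto
      qed
      moreover have "{v, l} \<subseteq> \<Union>F" using e True by auto
      ultimately have "(S {v, a} \<union> S {a, l}) \<inter> p ` \<Union>F = p ` {v, l}" by (rule image_trace)
      then show ?thesis unfolding True Sv .
    qed
  next
    fix e f assume e: "e \<in> F" "f \<in> F" "e \<noteq> f"
    consider "e = {v, l}" "f \<in> E - {{v, a}, {a, l}}" | "f = {v, l}" "e \<in> E - {{v, a}, {a, l}}"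
      | "e \<in> E" "f \<in> E" using e F[of e] F[of f] by auto
    then show "S' e \<inter> S' f \<subseteq> p ` (e \<inter> f)"
    proof cases
      case 1
      then have "S' e = S {v, a} \<union> S {a, l}" "S' f = S f" using Sv S[of f] by auto
      then show ?thesis using new[OF 1(2)] 1(1) by simp
    next
      case 2
      then have "S' f = S {v, a} \<union> S {a, l}" "S' e = S e" using Sv S[of e] by auto
      then show ?thesis using new[OF 2(2)] 2(1) by (simp add: Int_commute)
    next
      case 3
      then show ?thesis using S[OF 3(1)] S[OF 3(2)] drawing_Int[OF d 3 e(3)] by simp
    qed
  qed
  then show ?thesis unfolding F_def drawable_def by blast
qed

lemma drawable_subdivide:
  assumes dr: "drawable E" and E: "{v, w} \<in> E" "v \<noteq> w" and b: "b \<notin> \<Union>E"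
  shows "drawable (insert {v, b} (insert {b, w} (E - {{v, w}})))"
proof -
  obtain p S where d: "drawing E p S" using dr by (auto simp: drawable_def)
  obtain c S1 S2 where c: "S {v, w} = S1 \<union> S2" "is_arc S1 (p v) c" "is_arc S2 c (p w)" "S1 \<inter> S2 = {c}" "c \<noteq> p v" "c \<noteq> p w"
    using is_arc_split[OF drawing_arc[OF d E(1)]] .
  define F where "F = insert {v, b} (insert {b, w} (E - {{v, w}}))"
  have F: "e \<in> F \<longleftrightarrow> e = {v, b} \<or> e = {b, w} \<or> e \<in> E - {{v, w}}" for e by (simp add: F_def)
  let ?p = "p(b := c)"
  define S' where "S' = S({v, b} := S1, {b, w} := S2)"
  have bv: "b \<noteq> v" "b \<noteq> w" using b E(1) by auto
  have vw: "v \<in> \<Union>E" "w \<in> \<Union>E" using E(1) by auto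
  have U: "\<Union>F \<subseteq> insert b (\<Union>E)"
  proof
    fix x assume "x \<in> \<Union>F"
    then obtain e where "e \<in> F" "x \<in> e" by blast
    then show "x \<in> insert b (\<Union>E)" using F[of e] E(1) by auto
  qed
  have UF: "v \<in> \<Union>F" "w \<in> \<Union>F" "b \<in> \<Union>F" unfolding F_def by auto
  have cE: "c \<notin> p ` \<Union>E"
  proof
    assume "c \<in> p ` \<Union>E"
    then obtain x where x: "x \<in> \<Union>E" "c = p x" by blast
    have "c \<in> S {v, w}" using c by auto
    then show False using drawing_vertex[OF d E(1) x(1)] x(2) c(5,6) by auto
  qed
  have ends: "p v \<in> S1" "p w \<in> S2" "p v \<notin> S2" "p w \<notin> S1"
    using is_arc_facts(2,3)[OF c(2)] is_arc_facts(2,3)[OF c(3)] c(4,5,6) by auto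
  have ne: "{v, b} \<noteq> {b, w}" using E(2) bv by (auto simp: doubleton_eq_iff)
  have bE: "{v, b} \<notin> E" "{b, w} \<notin> E" using b by auto
  have S: "S' e = S e" if "e \<in> E" for e using that bE by (auto simp: S'_def)
  have Sv: "S' {v, b} = S1" "S' {b, w} = S2" using ne by (auto simp: S'_def)
  have pE: "?p ` X = p ` X" if "X \<subseteq> \<Union>E" for X using that b by auto
  have x1: "S1 \<inter> S e \<subseteq> p ` ({v} \<inter> e)" "S2 \<inter> S e \<subseteq> p ` ({w} \<inter> e)" if "e \<in> E - {{v, w}}" for e
    using drawing_Int[OF d E(1), of e] that c(1) ends by auto
  have "drawing F ?p S'" unfolding drawing_def
  proof (intro conjI allI ballI impI)
    have "inj_on ?p (insert b (\<Union>E))" using d b cE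
      by (auto simp: drawing_def inj_on_def)
    then show "inj_on ?p (\<Union>F)" using U by (rule inj_on_subset)
  next
    fix x y assume xy: "{x, y} \<in> F"
    consider "{x, y} = {v, b}" | "{x, y} = {b, w}" | "{x, y} \<in> E" using xy F[of "{x, y}"] by auto
    then show "is_arc (S' {x, y}) (?p x) (?p y)"
    proof cases
      case 1
      then have e: "S' {x, y} = S1" using Sv by simp
      show ?thesis unfolding e using 1 c(2) is_arc_sym[OF c(2)] bv by (auto simp: doubleton_eq_iff)
    next
      case 2
      then have e: "S' {x, y} = S2" using Sv by simp
      show ?thesis unfolding e using 2 c(3) is_arc_sym[OF c(3)] bv by (auto simp: doubleton_eq_iff)
    next
      case 3
      then have "x \<noteq> b" "y \<noteq> b" using b by auto
      then show ?thesis using S[OF 3] drawing_arc[OF d 3] by simp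
    qed
  next
    fix e assume e: "e \<in> F"
    have X: "p x \<in> S1 \<longleftrightarrow> x = v" "p x \<in> S2 \<longleftrightarrow> x = w" if "x \<in> \<Union>E" for x
      using drawing_vertex[OF d E(1) that] c(1) ends by auto
    have cc: "c \<in> S1" "c \<in> S2" using c(4) by auto
    consider "e = {v, b}" | "e = {b, w}" | "e \<in> E - {{v, w}}" using e F[of e] by auto
    then show "S' e \<inter> ?p ` \<Union>F = ?p ` e"
    proof cases
      case 1
      have "S1 \<inter> ?p ` \<Union>F = {p v, c}"
      proof
        show "S1 \<inter> ?p ` \<Union>F \<subseteq> {p v, c}"
        proof
          fix z assume z: "z \<in> S1 \<inter> ?p ` \<Union>F"
          then obtain x where x: "x \<in> insert b (\<Union>E)" "z = ?p x" using U by blast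
          show "z \<in> {p v, c}" using z x X(1)[of x] by (cases "x = b") auto
        qed
        show "{p v, c} \<subseteq> S1 \<inter> ?p ` \<Union>F" using ends cc bv UF by (auto simp: image_iff simp del: Union_iff)
      qed
      then show ?thesis using 1 Sv bv by auto
    next
      case 2
      have "S2 \<inter> ?p ` \<Union>F = {p w, c}"
      proof
        show "S2 \<inter> ?p ` \<Union>F \<subseteq> {p w, c}"
        proof
          fix z assume z: "z \<in> S2 \<inter> ?p ` \<Union>F"
          then obtain x where x: "x \<in> insert b (\<Union>E)" "z = ?p x" using U by blast
          show "z \<in> {p w, c}" using z x X(2)[of x] by (cases "x = b") auto
        qed
        show "{p w, c} \<subseteq> S2 \<inter> ?p ` \<Union>F" using ends cc bv UF by (auto simp: image_iff simp del: Union_iff)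
      qed
      then show ?thesis using 2 Sv bv by auto
    next
      case 3
      then have eE: "e \<in> E" "b \<notin> e" using b by auto
      have "c \<notin> S e" using x1(1)[OF 3] cc c(5) by auto
      have "S e \<inter> ?p ` \<Union>F = p ` e"
      proof
        show "S e \<inter> ?p ` \<Union>F \<subseteq> p ` e"
        proof
          fix z assume z: "z \<in> S e \<inter> ?p ` \<Union>F"
          then obtain x where x: "x \<in> insert b (\<Union>E)" "z = ?p x" using U by blast
          show "z \<in> p ` e" using z x drawing_vertex[OF d eE(1), of x] \<open>c \<notin> S e\<close> by (cases "x = b") auto
        qed
        show "p ` e \<subseteq> S e \<inter> ?p ` \<Union>F"
        proof
          fix z assume "z \<in> p ` e"
          then obtain x where x: "x \<in> e" "z = p x" by blast
          then have "z = ?p x" "x \<in> \<Union>F" using eE e by auto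
          moreover have "z \<in> S e" using x drawing_vertex[OF d eE(1), of x] eE by auto
          ultimately show "z \<in> S e \<inter> ?p ` \<Union>F" by blast
        qed
      qed
      then show ?thesis using S[OF eE(1)] pE[of e] eE by auto
    qed
  next
    fix e f assume ef: "e \<in> F" "f \<in> F" "e \<noteq> f"
    have main: "S' e \<inter> S' f \<subseteq> ?p ` (e \<inter> f)" if "e \<in> {{v, b}, {b, w}}" "f \<in> F" "e \<noteq> f" for e f
    proof (cases "f \<in> {{v, b}, {b, w}}")
      case True
      then have "S' e \<inter> S' f = {c}" using that Sv c(4) by auto
      moreover have "b \<in> e \<inter> f" using True that by auto
      ultimately show ?thesis by (auto simp: image_iff)
    next
      case False
      then have f: "f \<in> E - {{v, w}}" using that(2) F[of f] by auto
      have Sf: "S' f = S f" using S f by blast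
      have "S' e \<inter> S' f \<subseteq> p ` (e \<inter> f)"
      proof (cases "e = {v, b}")
        case True
        then have "S' e = S1" using Sv by simp
        then show ?thesis unfolding Sf using x1(1)[OF f] True by blast
      next
        case False
        then have e: "e = {b, w}" using that(1) by blast
        then have "S' e = S2" using Sv by simp
        then show ?thesis unfolding Sf using x1(2)[OF f] e by blast
      qed
      moreover have "b \<notin> f" using f b by auto
      ultimately show ?thesis by auto
    qed
    show "S' e \<inter> S' f \<subseteq> ?p ` (e \<inter> f)"
    proof (cases "e \<in> E \<and> f \<in> E")
      case True
      then have "S' e = S e" "S' f = S f" using S by blast+
      then have "S' e \<inter> S' f \<subseteq> p ` (e \<inter> f)" using drawing_Int[OF d, of e f] True ef(3) by simp
      then show ?thesis using pE[of "e \<inter> f"] True by blast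
    next
      case False
      then have "e \<in> {{v, b}, {b, w}} \<or> f \<in> {{v, b}, {b, w}}" using ef F[of e] F[of f] by auto
      then show ?thesis 
        using main[OF _ ef(2,3)] main[OF _ ef(1) ef(3)[symmetric]] by (metis Int_commute)
    qed
  qed
  then show ?thesis unfolding F_def drawable_def by blast
qed

lemma planar_drawable:
  assumes "planar V E" "simple_graph V E" shows "drawable E"
proof -
  obtain p :: "'a \<Rightarrow> real \<times> real" and \<gamma> where pl: "inj_on p V \<and>
     (\<forall>e\<in>E. arc (\<gamma> e) \<and> {pathstart (\<gamma> e), pathfinish (\<gamma> e)} = p ` e \<and>
              path_image (\<gamma> e) \<inter> p ` V = p ` e) \<and>
     (\<forall>e\<in>E. \<forall>e'\<in>E. e \<noteq> e' \<longrightarrow> path_image (\<gamma> e) \<inter> path_image (\<gamma> e') \<subseteq> p ` (e \<inter> e'))"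
    using assms(1) unfolding planar_def by (elim exE) (rule that)
  have p: "inj_on p V" using pl by simp
  have g: "arc (\<gamma> e) \<and> {pathstart (\<gamma> e), pathfinish (\<gamma> e)} = p ` e \<and> path_image (\<gamma> e) \<inter> p ` V = p ` e"
    if "e \<in> E" for e using pl that by simp
  have x: "path_image (\<gamma> e) \<inter> path_image (\<gamma> e') \<subseteq> p ` (e \<inter> e')" if "e \<in> E" "e' \<in> E" "e \<noteq> e'" for e e'
    using pl that by simp
  have UV: "\<Union>E \<subseteq> V" using assms(2) by (auto simp: simple_graph_def)
  define h where "h = (\<lambda>z::real \<times> real. Complex (fst z) (snd z))"
  have inj: "inj h" by (auto simp: inj_def h_def prod_eq_iff)
  have cont: "continuous_on UNIV h" unfolding h_def Complex_eq by (intro continuous_intros)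
  let ?S = "\<lambda>e. h ` path_image (\<gamma> e)"
  have "drawing E (h \<circ> p) ?S" unfolding drawing_def
  proof (intro conjI allI ballI impI)
    show "inj_on (h \<circ> p) (\<Union>E)"
      by (rule comp_inj_on[OF inj_on_subset[OF p UV] inj_on_subset[OF inj]]) simp
  next
    fix u v assume uv: "{u, v} \<in> E"
    let ?g = "h \<circ> \<gamma> {u, v}"
    have a: "path (\<gamma> {u, v})" "inj_on (\<gamma> {u, v}) {0..1}" using g[OF uv] by (auto simp: arc_def)
    have "path ?g" using a(1) continuous_on_subset[OF cont subset_UNIV] by (rule path_continuous_image)
    moreover have "inj_on ?g {0..1}" by (rule comp_inj_on[OF a(2) inj_on_subset[OF inj]]) simp
    ultimately have "arc ?g" by (simp add: arc_def)
    then have "is_arc (?S {u, v}) (h (pathstart (\<gamma> {u, v}))) (h (pathfinish (\<gamma> {u, v})))"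
      unfolding is_arc_def by (intro exI[of _ ?g]) (auto simp: path_image_compose pathstart_compose pathfinish_compose)
    moreover have "pathstart (\<gamma> {u, v}) = p u \<and> pathfinish (\<gamma> {u, v}) = p v \<or>
       pathstart (\<gamma> {u, v}) = p v \<and> pathfinish (\<gamma> {u, v}) = p u"
      using g[OF uv] by (auto simp: doubleton_eq_iff)
    ultimately show "is_arc (?S {u, v}) ((h \<circ> p) u) ((h \<circ> p) v)" using is_arc_sym by auto
  next
    fix e assume e: "e \<in> E"
    have "p x \<in> path_image (\<gamma> e) \<longleftrightarrow> x \<in> e" if "x \<in> \<Union>E" for x
    proof -
      have "x \<in> V" "e \<subseteq> V" using that UV e by auto
      then have "p x \<in> path_image (\<gamma> e) \<longleftrightarrow> p x \<in> p ` e" using g[OF e] by auto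
      then show ?thesis using inj_on_image_mem_iff[OF p \<open>x \<in> V\<close> \<open>e \<subseteq> V\<close>] by simp
    qed
    moreover have "e \<subseteq> \<Union>E" using e by auto
    ultimately have "path_image (\<gamma> e) \<inter> p ` \<Union>E = p ` e" by (rule image_trace)
    then have "h ` (path_image (\<gamma> e) \<inter> p ` \<Union>E) = h ` p ` e" by simp
    then show "?S e \<inter> (h \<circ> p) ` \<Union>E = (h \<circ> p) ` e"
      unfolding image_Int[OF inj] image_comp .
  next
    fix e f assume "e \<in> E" "f \<in> E" "e \<noteq> f"
    then have "h ` (path_image (\<gamma> e) \<inter> path_image (\<gamma> f)) \<subseteq> h ` p ` (e \<inter> f)"
      by (intro image_mono x)
    then show "?S e \<inter> ?S f \<subseteq> (h \<circ> p) ` (e \<inter> f)" unfolding image_Int[OF inj] image_comp .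
  qed
  then show ?thesis unfolding drawable_def by blast
qed

section \<open>The two sides of a cycle\<close>

lemma inside_absorb:
  assumes "connected T" "T \<inter> X = {}" "t \<in> T" "t \<in> inside X"
  shows "T \<subseteq> inside X"
proof
  fix y assume "y \<in> T"
  then have "connected_component (- X) t y" unfolding connected_component_def
    using assms(1-3) by (intro exI[of _ T]) auto
  then show "y \<in> inside X" using assms(4) by (rule inside_same_component)
qed

lemma outside_absorb:
  assumes "connected T" "T \<inter> X = {}" "t \<in> T" "t \<in> outside X"
  shows "T \<subseteq> outside X"
proof
  fix y assume "y \<in> T"
  then have "connected_component (- X) t y" unfolding connected_component_def
    using assms(1-3) by (intro exI[of _ T]) auto
  then show "y \<in> outside X" using assms(4) by (rule outside_same_component)
qed

lemma curve_Un [simp]: "curve S (K \<union> K') = curve S K \<union> curve S K'"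
  by (simp add: curve_def image_Un Union_Un_distrib)

lemma curve_vertex:
  assumes "drawing E p S" "K \<subseteq> E" "v \<in> \<Union>E"
  shows "p v \<in> curve S K \<longleftrightarrow> v \<in> \<Union>K"
proof -
  have "p v \<in> S e \<longleftrightarrow> v \<in> e" if "e \<in> K" for e
    using drawing_vertex[OF assms(1) _ assms(3)] that assms(2) by auto
  then show ?thesis by (auto simp: curve_def)
qed

lemma curve_Int:
  assumes "drawing E p S" "K \<subseteq> E" "K' \<subseteq> E" "K \<inter> K' = {}"
  shows "curve S K \<inter> curve S K' \<subseteq> p ` (\<Union>K \<inter> \<Union>K')"
proof
  fix z assume "z \<in> curve S K \<inter> curve S K'"
  then obtain e f where ef: "e \<in> K" "f \<in> K'" "z \<in> S e" "z \<in> S f" by (auto simp: curve_def)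
  then have "e \<in> E" "f \<in> E" "e \<noteq> f" using assms by auto
  from drawing_Int[OF assms(1) this] have "z \<in> p ` (e \<inter> f)" using ef by auto
  then show "z \<in> p ` (\<Union>K \<inter> \<Union>K')" using ef by auto
qed

lemma edge_curve_disjoint:
  assumes d: "drawing E p S" and K: "K \<subseteq> E" and e: "e \<in> E" "e \<notin> K"
  shows "(S e - p ` (e \<inter> \<Union>K)) \<inter> curve S K = {}"
proof (rule ccontr)
  assume "\<not> ?thesis"
  then obtain z f where z: "z \<in> S e" "z \<notin> p ` (e \<inter> \<Union>K)" "f \<in> K" "z \<in> S f" by (auto simp: curve_def)
  then have "f \<in> E" "e \<noteq> f" using K e(2) by auto
  then have "z \<in> p ` (e \<inter> f)" using drawing_Int[OF d e(1)] z by auto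
  then show False using z(2,3) by auto
qed

lemma open_edge:
  assumes d: "drawing E p S" and es: "edgeset E" and e: "e \<in> E"
  shows "connected (S e - p ` e)" "S e - p ` e \<noteq> {}"
    "K \<subseteq> E \<Longrightarrow> e \<notin> K \<Longrightarrow> (S e - p ` e) \<inter> curve S K = {}"
proof -
  obtain u v where uv: "e = {u, v}" using es e by (auto simp: edgeset_def)
  have a: "is_arc (S e) (p u) (p v)" using drawing_arc[OF d] e uv by simp
  show "connected (S e - p ` e)" "S e - p ` e \<noteq> {}"
    using is_arc_facts(5,8)[OF a] uv by auto
  show "(S e - p ` e) \<inter> curve S K = {}" if "K \<subseteq> E" "e \<notin> K"
    using edge_curve_disjoint[OF d that(1) e that(2)] by auto
qed

text \<open>The edge without its other end is a connected set that contains \<open>p v\<close> and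
  avoids the curve. This carries sides from vertices to edges and back.\<close>

lemma half_open_edge:
  assumes d: "drawing E p S" and es: "edgeset E" and K: "K \<subseteq> E" and e: "e \<in> E" "v \<in> e" "v \<notin> \<Union>K"
  obtains T where "connected T" "p v \<in> T" "S e - p ` e \<subseteq> T" "T \<subseteq> S e" "T \<inter> curve S K = {}"
proof -
  obtain u where uv: "e = {v, u}" "u \<noteq> v" using es e(1,2) unfolding edgeset_def
    by (metis doubleton_eq_iff empty_iff insert_iff insert_commute)
  have a: "is_arc (S e) (p v) (p u)" using drawing_arc[OF d] e uv by simp
  have eK: "e \<notin> K" using e by auto
  have "(S e - {p u}) \<inter> curve S K = {}"
    using edge_curve_disjoint[OF d K e(1) eK] e(3) uv by auto
  moreover have "p v \<in> S e - {p u}" using is_arc_facts(1,2)[OF a] by auto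
  ultimately show thesis using is_arc_facts(7)[OF a] uv by (intro that[of "S e - {p u}"]) auto
qed

lemma insE_of_insV:
  assumes d: "drawing E p S" and es: "edgeset E" and K: "K \<subseteq> E"
    and v: "v \<in> insV E p S K" and e: "e \<in> E" "v \<in> e"
  shows "e \<in> insE E p S K"
proof -
  have vi: "v \<in> \<Union>E" "p v \<in> inside (curve S K)" using v by (auto simp: insV_def)
  have "p v \<notin> curve S K" using vi(2) inside_no_overlap[of "curve S K"] by blast
  then have vK: "v \<notin> \<Union>K" using curve_vertex[OF d K vi(1)] by simp
  obtain T where T: "connected T" "p v \<in> T" "S e - p ` e \<subseteq> T" "T \<inter> curve S K = {}"
    using half_open_edge[OF d es K e vK] by metis
  have "T \<subseteq> inside (curve S K)" by (rule inside_absorb[OF T(1,4,2) vi(2)])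
  moreover have "e \<notin> K" using e vK by auto
  ultimately show ?thesis using T(3) e(1) unfolding insE_def by auto
qed

lemma insE_endpoint:
  assumes d: "drawing E p S" and es: "edgeset E" and K: "K \<subseteq> E"
    and e: "e \<in> insE E p S K" "v \<in> e"
  shows "v \<in> \<Union>K \<or> v \<in> insV E p S K"
proof (rule disjCI)
  assume "v \<notin> insV E p S K"
  show "v \<in> \<Union>K"
  proof (rule ccontr)
    assume vK: "v \<notin> \<Union>K"
    have eE: "e \<in> E" "S e - p ` e \<subseteq> inside (curve S K)" using e(1) by (auto simp: insE_def)
    obtain T where T: "connected T" "p v \<in> T" "S e - p ` e \<subseteq> T" "T \<inter> curve S K = {}"
      using half_open_edge[OF d es K eE(1) e(2) vK] by metis
    obtain t where t: "t \<in> S e - p ` e" using open_edge(2)[OF d es eE(1)] by auto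
    have "T \<subseteq> inside (curve S K)" using t T(3) eE(2) by (intro inside_absorb[OF T(1,4), of t]) auto
    then have "v \<in> insV E p S K" using T(2) eE(1) e(2) by (auto simp: insV_def)
    then show False using \<open>v \<notin> insV E p S K\<close> by simp
  qed
qed

lemma insE_sub: "insE E p S K \<subseteq> E - K"
  by (auto simp: insE_def)

lemma insV_disjoint:
  assumes "drawing E p S" "K \<subseteq> E" shows "insV E p S K \<inter> \<Union>K = {}"
proof (rule ccontr)
  assume "insV E p S K \<inter> \<Union>K \<noteq> {}"
  then obtain v where v: "v \<in> \<Union>E" "p v \<in> inside (curve S K)" "v \<in> \<Union>K" by (auto simp: insV_def)
  then have "p v \<in> curve S K" using curve_vertex[OF assms v(1)] by simp
  then show False using v(2) inside_no_overlap[of "curve S K"] by blast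
qed

section \<open>A cycle with an ear as a theta curve\<close>

lemma path_is_arc:
  assumes d: "drawing E p S"
  shows "distinct xs \<Longrightarrow> length xs \<ge> 2 \<Longrightarrow> pedges xs \<subseteq> E \<Longrightarrow> is_arc (curve S (pedges xs)) (p (hd xs)) (p (last xs))"
proof (induction xs rule: pedges.induct)
  case (1 x y zs)
  have xy: "{x, y} \<in> E" using 1(4) by simp
  have a: "is_arc (S {x, y}) (p x) (p y)" by (rule drawing_arc[OF d xy])
  show ?case
  proof (cases "zs = []")
    case True
    then show ?thesis using a by (simp add: curve_def)
  next
    case False
    then have b: "is_arc (curve S (pedges (y # zs))) (p y) (p (last (y # zs)))"
      using 1 by (cases zs) auto
    have "S {x, y} \<inter> curve S (pedges (y # zs)) \<subseteq> {p y}"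
    proof
      fix z assume "z \<in> S {x, y} \<inter> curve S (pedges (y # zs))"
      then obtain f where f: "f \<in> pedges (y # zs)" "z \<in> S {x, y}" "z \<in> S f" by (auto simp: curve_def)
      have xf: "x \<notin> f" using pedges_subset[OF f(1)] 1(2) by auto
      then have "{x, y} \<noteq> f" "f \<in> E" using f(1) 1(4) by auto
      then have "z \<in> p ` ({x, y} \<inter> f)" using drawing_Int[OF d xy] f by auto
      then show "z \<in> {p y}" using xf by auto
    qed
    from is_arc_join[OF a b this] show ?thesis by (simp add: curve_def)
  qed
qed auto

lemma pedges_two: "distinct xs \<Longrightarrow> e \<in> pedges xs \<Longrightarrow> \<exists>u v. e = {u, v} \<and> u \<noteq> v"
  by (induction xs rule: pedges.induct) auto

text \<open>A common edge could only be \<open>{x, y}\<close>, but this is the closing edge of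
  whichever of the two paths has an inner vertex.\<close>

lemma pedges_disjoint:
  assumes "distinct (x # as @ y # bs)" "as \<noteq> [] \<or> bs \<noteq> []"
  shows "pedges (x # as @ [y]) \<inter> pedges (y # bs @ [x]) = {}"
proof (rule ccontr)
  assume "\<not> ?thesis"
  then obtain e where e: "e \<in> pedges (x # as @ [y])" "e \<in> pedges (y # bs @ [x])" by auto
  have "e \<subseteq> {x, y}" using pedges_subset[OF e(1)] pedges_subset[OF e(2)] assms(1) by auto
  moreover obtain u v where "e = {u, v}" "u \<noteq> v" using pedges_two[OF _ e(1)] assms(1) by auto
  ultimately have exy: "e = {x, y}" by auto
  show False
  proof (cases "as = []")
    case False
    then have "length (x # as @ [y]) \<ge> 3" by (cases as) auto
    then show False using path_closing_edge[of "x # as @ [y]"] assms(1) e(1) exy by (auto simp: insert_commute)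
  next
    case True
    then have "length (y # bs @ [x]) \<ge> 3" using assms(2) by (cases bs) auto
    then show False using path_closing_edge[of "y # bs @ [x]"] assms(1) e(2) exy by (auto simp: insert_commute)
  qed
qed

lemma curve_paths_Int:
  assumes d: "drawing E p S" and K: "pedges (x # as @ [y]) \<subseteq> E" "pedges (x # bs @ [y]) \<subseteq> E"
    and dj: "pedges (x # as @ [y]) \<inter> pedges (x # bs @ [y]) = {}" "set as \<inter> set bs = {}"
    "x \<notin> set as" "y \<notin> set as"
  shows "curve S (pedges (x # as @ [y])) \<inter> curve S (pedges (x # bs @ [y])) = {p x, p y}"
proof
  have U: "\<Union>(pedges (x # as @ [y])) = {x, y} \<union> set as" "\<Union>(pedges (x # bs @ [y])) = {x, y} \<union> set bs"
    by (subst Union_pedges; auto)+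
  have "({x, y} \<union> set as) \<inter> ({x, y} \<union> set bs) = {x, y}" using dj by auto
  then have "\<Union>(pedges (x # as @ [y])) \<inter> \<Union>(pedges (x # bs @ [y])) = {x, y}" unfolding U .
  then show "curve S (pedges (x # as @ [y])) \<inter> curve S (pedges (x # bs @ [y])) \<subseteq> {p x, p y}"
    using curve_Int[OF d K dj(1)] by simp
  have "x \<in> \<Union>(pedges (x # as @ [y]))" "y \<in> \<Union>(pedges (x # as @ [y]))" unfolding U by simp_all
  then have "x \<in> \<Union>E" "y \<in> \<Union>E" using Union_mono[OF K(1)] by (simp_all only: subsetD)
  then show "{p x, p y} \<subseteq> curve S (pedges (x # as @ [y])) \<inter> curve S (pedges (x # bs @ [y]))"
    using curve_vertex[OF d K(1)] curve_vertex[OF d K(2)] U by auto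
qed

text \<open>The three arcs from \<open>x\<close> to \<open>y\<close> form a theta curve. Since the
  ear has an edge \<open>e0\<close> inside the cycle, the theta curve theorem splits the inside of
  the cycle into the ear and the insides of the two new cycles. An open edge is connected and avoids
  the curves it does not belong to, so it falls into exactly one of these pieces.\<close>

lemma split_sides:
  fixes E :: "'a set set"
  assumes d: "drawing E p S" and es: "edgeset E"
    and dist: "distinct (x # as @ y # bs)" "distinct (x # zs @ [y])" "set zs \<inter> (set as \<union> set bs) = {}"
    and K1: "K1 = pedges (x # as @ [y])" and K2: "K2 = pedges (y # bs @ [x])" and K: "K = pedges (x # zs @ [y])"
    and sub: "K1 \<subseteq> E" "K2 \<subseteq> E" "K \<subseteq> E" and disj: "K1 \<inter> K2 = {}" "K1 \<inter> K = {}" "K2 \<inter> K = {}"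
    and e0: "e0 \<in> K" "e0 \<in> insE E p S (K1 \<union> K2)"
  shows "insE E p S (K1 \<union> K2) = insE E p S (K1 \<union> K) \<union> insE E p S (K2 \<union> K) \<union> K"
    "insE E p S (K1 \<union> K) \<inter> insE E p S (K2 \<union> K) = {}"
    "insV E p S (K1 \<union> K2) = insV E p S (K1 \<union> K) \<union> insV E p S (K2 \<union> K) \<union> set zs"
    "insV E p S (K1 \<union> K) \<inter> insV E p S (K2 \<union> K) = {}"
    "(insV E p S (K1 \<union> K) \<union> insV E p S (K2 \<union> K)) \<inter> set zs = {}"
proof -
  have K2': "K2 = pedges (x # rev bs @ [y])" using pedges_rev[of "x # rev bs @ [y]"] K2 by simp
  have Ux: "\<Union>K = {x, y} \<union> set zs" unfolding K by (subst Union_pedges) auto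
  have "{x, y} \<union> set zs \<subseteq> \<Union>E" using Union_mono[OF sub(3)] unfolding Ux .
  then have xyE: "x \<in> \<Union>E" "y \<in> \<Union>E" and zE: "set zs \<subseteq> \<Union>E" by simp_all
  have a1: "is_arc (curve S K1) (p x) (p y)" using path_is_arc[OF d, of "x # as @ [y]"] dist sub K1 by auto
  have a2: "is_arc (curve S K2) (p x) (p y)" using path_is_arc[OF d, of "x # rev bs @ [y]"] dist sub K2' by auto
  have a: "is_arc (curve S K) (p x) (p y)" using path_is_arc[OF d, of "x # zs @ [y]"] dist sub K by auto
  have c12: "curve S K1 \<inter> curve S K2 = {p x, p y}" unfolding K1 K2'
    by (rule curve_paths_Int[OF d]) (use dist sub disj K1 K2' in auto)
  have c1: "curve S K1 \<inter> curve S K = {p x, p y}" unfolding K1 K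
    by (rule curve_paths_Int[OF d]) (use dist sub disj K1 K in auto)
  have c2: "curve S K2 \<inter> curve S K = {p x, p y}" unfolding K2' K
    by (rule curve_paths_Int[OF d]) (use dist sub disj K2' K in auto)
  let ?I = "inside (curve S K1 \<union> curve S K2)" and ?I1 = "inside (curve S K1 \<union> curve S K)"
    and ?I2 = "inside (curve S K2 \<union> curve S K)"
  have e0E: "e0 \<in> E" "S e0 - p ` e0 \<subseteq> ?I" using e0 by (auto simp: insE_def)
  have "S e0 \<subseteq> curve S K" using e0(1) by (auto simp: curve_def)
  then have ne: "curve S K \<inter> ?I \<noteq> {}" using open_edge(2)[OF d es e0E(1)] e0E(2) by auto
  obtain g1 where g1: "arc g1" "path_image g1 = curve S K1" "pathstart g1 = p x" "pathfinish g1 = p y"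
    using a1 by (auto simp: is_arc_def)
  obtain g2 where g2: "arc g2" "path_image g2 = curve S K2" "pathstart g2 = p x" "pathfinish g2 = p y"
    using a2 by (auto simp: is_arc_def)
  obtain g where g: "arc g" "path_image g = curve S K" "pathstart g = p x" "pathfinish g = p y"
    using a by (auto simp: is_arc_def)
  have D: "?I1 \<inter> ?I2 = {}" "?I1 \<union> ?I2 \<union> (curve S K - {p x, p y}) = ?I"
    using split_inside_simple_closed_curve[OF arc_imp_simple_path[OF g1(1)] g1(3,4)
        arc_imp_simple_path[OF g2(1)] g2(3,4) arc_imp_simple_path[OF g(1)] g(3,4) is_arc_facts(1)[OF a],
        unfolded g1(2) g2(2) g(2), OF c12 c1 c2 ne] by metis+
  have oK: "S e - p ` e \<subseteq> curve S K - {p x, p y}" if e: "e \<in> K" for e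
  proof
    fix z assume z: "z \<in> S e - p ` e"
    then have "z \<in> curve S K" using e by (auto simp: curve_def)
    moreover have "p x \<in> S e \<longrightarrow> x \<in> e" "p y \<in> S e \<longrightarrow> y \<in> e"
      using drawing_vertex[OF d, of e] xyE e sub(3) by auto
    ultimately show "z \<in> curve S K - {p x, p y}" using z by auto
  qed
  have X: "?I \<inter> (curve S K1 \<union> curve S K2) = {}" by (rule inside_no_overlap)
  have s1: "K1 \<union> K \<subseteq> E" "K2 \<union> K \<subseteq> E" using sub by auto
  have notin: "e \<notin> K1 \<union> K2" if e: "e \<in> E" "S e - p ` e \<subseteq> ?I" for e
  proof
    assume "e \<in> K1 \<union> K2"
    then have "S e \<subseteq> curve S K1 \<union> curve S K2" by (auto simp: curve_def)
    moreover obtain t where "t \<in> S e - p ` e" using open_edge(2)[OF d es e(1)] by auto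
    ultimately have "t \<in> ?I \<inter> (curve S K1 \<union> curve S K2)" using e(2) by blast
    then show False unfolding X by simp
  qed
  show "insE E p S (K1 \<union> K2) = insE E p S (K1 \<union> K) \<union> insE E p S (K2 \<union> K) \<union> K"
  proof
    show "insE E p S (K1 \<union> K2) \<subseteq> insE E p S (K1 \<union> K) \<union> insE E p S (K2 \<union> K) \<union> K"
    proof
      fix e assume "e \<in> insE E p S (K1 \<union> K2)"
      then have e: "e \<in> E" "e \<notin> K1" "e \<notin> K2" "S e - p ` e \<subseteq> ?I" by (auto simp: insE_def)
      show "e \<in> insE E p S (K1 \<union> K) \<union> insE E p S (K2 \<union> K) \<union> K"
      proof (cases "e \<in> K")
        case False
        obtain t where t: "t \<in> S e - p ` e" using open_edge(2)[OF d es e(1)] by auto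
        have o: "(S e - p ` e) \<inter> (curve S K1 \<union> curve S K) = {}" "(S e - p ` e) \<inter> (curve S K2 \<union> curve S K) = {}"
          using open_edge(3)[OF d es e(1) s1(1)] open_edge(3)[OF d es e(1) s1(2)] e False by auto
        have "t \<notin> curve S K" using t o(1) by auto
        then have "t \<in> ?I1 \<or> t \<in> ?I2" using D(2) t e(4) by auto
        then have "S e - p ` e \<subseteq> ?I1 \<or> S e - p ` e \<subseteq> ?I2"
          using inside_absorb[OF open_edge(1)[OF d es e(1)] o(1) t] inside_absorb[OF open_edge(1)[OF d es e(1)] o(2) t] by auto
        then show ?thesis using e False by (auto simp: insE_def)
      qed auto
    qed
    show "insE E p S (K1 \<union> K) \<union> insE E p S (K2 \<union> K) \<union> K \<subseteq> insE E p S (K1 \<union> K2)"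
    proof
      fix e assume "e \<in> insE E p S (K1 \<union> K) \<union> insE E p S (K2 \<union> K) \<union> K"
      then have eE: "e \<in> E" "S e - p ` e \<subseteq> ?I1 \<or> S e - p ` e \<subseteq> ?I2 \<or> S e - p ` e \<subseteq> curve S K - {p x, p y}"
        using sub(3) oK by (auto simp: insE_def)
      then have "S e - p ` e \<subseteq> ?I" using D(2) by auto
      then show "e \<in> insE E p S (K1 \<union> K2)" using eE(1) notin by (auto simp: insE_def)
    qed
  qed
  show "insE E p S (K1 \<union> K) \<inter> insE E p S (K2 \<union> K) = {}"
  proof (rule ccontr)
    assume "\<not> ?thesis"
    then obtain e where "e \<in> E" "S e - p ` e \<subseteq> ?I1" "S e - p ` e \<subseteq> ?I2" by (auto simp: insE_def)
    then show False using open_edge(2)[OF d es] D(1) by (metis Int_greatest subset_empty)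
  qed
  have pz: "p v \<in> curve S K - {p x, p y} \<longleftrightarrow> v \<in> set zs" if v: "v \<in> \<Union>E" for v
    using curve_vertex[OF d sub(3) v] Ux drawing_inj[OF d v xyE(1)] drawing_inj[OF d v xyE(2)] dist(2) by auto
  have I: "p v \<in> ?I \<longleftrightarrow> p v \<in> ?I1 \<or> p v \<in> ?I2 \<or> v \<in> set zs" if v: "v \<in> \<Union>E" for v
    using D(2) pz[OF v] by auto
  show "insV E p S (K1 \<union> K2) = insV E p S (K1 \<union> K) \<union> insV E p S (K2 \<union> K) \<union> set zs"
  proof (rule set_eqI)
    fix v show "v \<in> insV E p S (K1 \<union> K2) \<longleftrightarrow> v \<in> insV E p S (K1 \<union> K) \<union> insV E p S (K2 \<union> K) \<union> set zs"
    proof (cases "v \<in> \<Union>E")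
      case True
      then show ?thesis using I[OF True] by (simp add: insV_def del: Union_iff)
    next
      case False
      then show ?thesis using zE by (auto simp: insV_def simp del: Union_iff)
    qed
  qed
  show "insV E p S (K1 \<union> K) \<inter> insV E p S (K2 \<union> K) = {}"
    using D(1) unfolding insV_def curve_Un by auto
  show "(insV E p S (K1 \<union> K) \<union> insV E p S (K2 \<union> K)) \<inter> set zs = {}"
    using insV_disjoint[OF d s1(1)] insV_disjoint[OF d s1(2)] Ux by auto
qed


lemma cycle_curve_loop:
  assumes d: "drawing E p S" and c: "cyc E xs"
  obtains g where "simple_path g" "pathfinish g = pathstart g" "path_image g = curve S (cedges xs)"
proof -
  have len: "length xs \<ge> 3" and dist: "distinct xs" and sub: "cedges xs \<subseteq> E" using c by (auto simp: cyc_def)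
  then obtain x y bs where xs: "xs = x # y # bs" "bs \<noteq> []"
    by (cases xs; cases "tl xs"; cases "tl (tl xs)") auto
  let ?K1 = "pedges (x # [] @ [y])" and ?K2 = "pedges (y # bs @ [x])" and ?K2' = "pedges (x # rev bs @ [y])"
  have ce: "cedges xs = ?K1 \<union> ?K2" using cedges_split[of x "[]" y bs] xs by simp
  have r: "?K2 = ?K2'" using pedges_rev[of "x # rev bs @ [y]"] by simp
  have s: "?K1 \<subseteq> E" "?K2' \<subseteq> E" using sub ce r by auto
  have "?K1 \<inter> ?K2' = {}" unfolding r[symmetric] using dist xs by (intro pedges_disjoint) auto
  then have I: "curve S ?K1 \<inter> curve S ?K2' = {p x, p y}"
    by (intro curve_paths_Int[OF d s]) auto
  obtain g1 where g1: "arc g1" "path_image g1 = curve S ?K1" "pathstart g1 = p x" "pathfinish g1 = p y"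
    using path_is_arc[OF d, of "x # [] @ [y]"] s(1) dist xs by (auto simp: is_arc_def)
  have "is_arc (curve S ?K2') (p x) (p y)" using path_is_arc[OF d, of "x # rev bs @ [y]"] s(2) dist xs by auto
  from is_arc_sym[OF this] obtain g2 where g2: "arc g2" "path_image g2 = curve S ?K2'"
    "pathstart g2 = p y" "pathfinish g2 = p x"
    by (auto simp: is_arc_def)
  have "simple_path (g1 +++ g2)" using g1 g2 I by (intro simple_path_join_loop) auto
  moreover have "path_image (g1 +++ g2) = path_image g1 \<union> path_image g2"
    using g1(4) g2(3) by (intro path_image_join) simp
  then have "path_image (g1 +++ g2) = curve S (cedges xs)" unfolding ce r curve_Un g1(2) g2(2) .
  moreover have "pathfinish (g1 +++ g2) = pathstart (g1 +++ g2)" using g1 g2 by simp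
  ultimately show thesis using that by blast
qed

text \<open>Inversion in a point inside the cycle and off the drawing swaps the two sides of the cycle.\<close>

lemma swap_sides:
  assumes d: "drawing E p S" and es: "edgeset E" and c: "cyc E xs"
  obtains p' S' where "drawing E p' S'"
    "insE E p' S' (cedges xs) = E - cedges xs - insE E p S (cedges xs)"
    "insV E p' S' (cedges xs) = \<Union>E - set xs - insV E p S (cedges xs)"
proof -
  let ?X = "curve S (cedges xs)"
  have K: "cedges xs \<subseteq> E" using c by (simp add: cyc_def)
  obtain g where g: "simple_path g" "pathfinish g = pathstart g" "path_image g = ?X"
    using cycle_curve_loop[OF d c] .
  note J = Jordan_inside_outside[OF g(1,2), unfolded g(3)]
  have fin: "finite E" using es by (simp add: edgeset_def)
  have arcs: "closed (S e) \<and> interior (S e) = {}" if "e \<in> E" for e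
  proof -
    obtain u v where "e = {u, v}" using es \<open>e \<in> E\<close> by (auto simp: edgeset_def)
    then have a: "is_arc (S e) (p u) (p v)" using drawing_arc[OF d] that by simp
    show ?thesis using interior_is_arc[OF a] is_arc_facts(4)[OF a] compact_imp_closed by auto
  qed
  \<comment> \<open>A finite union of arcs has empty interior, so it cannot cover the open set
    \<open>inside ?X\<close>. The centre \<open>p0\<close> of the inversion is a point that is left
    over.\<close>
  have "finite F \<Longrightarrow> F \<subseteq> E \<Longrightarrow> closed (\<Union>(S ` F)) \<and> interior (\<Union>(S ` F)) = {}" for F
  proof (induction F rule: finite_induct)
    case (insert e F)
    then have e: "closed (S e)" "interior (S e) = {}" "closed (\<Union>(S ` F))" "interior (\<Union>(S ` F)) = {}"
      using arcs[of e] by auto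
    then show ?case using interior_closed_Un_empty_interior[OF e(1,4)] by (simp add: closed_Un)
  qed simp
  then have "interior (\<Union>(S ` E)) = {}" using fin by simp
  then have "\<not> inside ?X \<subseteq> \<Union>(S ` E)" using J interior_maximal[of "inside ?X" "\<Union>(S ` E)"] by auto
  then obtain p0 where p0: "p0 \<in> inside ?X" "p0 \<notin> \<Union>(S ` E)" by auto
  define \<psi> where "\<psi> = (\<lambda>z. inverse (z - p0))"
  define p' where "p' = (\<lambda>v. \<psi> (p v))"
  define S' where "S' = (\<lambda>e. \<psi> ` S e)"
  have inj: "inj_on \<psi> (- {p0})" by (auto simp: inj_on_def \<psi>_def)
  have cont: "continuous_on (- {p0}) \<psi>" unfolding \<psi>_def by (intro continuous_intros) auto
  have pS: "S e \<subseteq> - {p0}" if "e \<in> E" for e using p0(2) that by auto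
  have pv: "p ` \<Union>E \<subseteq> - {p0}"
  proof
    fix z assume "z \<in> p ` \<Union>E"
    then obtain v e where "z = p v" "v \<in> e" "e \<in> E" by auto
    then have "z \<in> S e" using drawing_vertex[OF d, of e v] by auto
    then show "z \<in> - {p0}" using pS[OF \<open>e \<in> E\<close>] by auto
  qed
  have img: "p' ` A = \<psi> ` p ` A" for A by (auto simp: p'_def)
  have d': "drawing E p' S'" unfolding drawing_def
  proof (intro conjI allI ballI impI)
    have "inj_on p (\<Union>E)" using d by (simp add: drawing_def)
    then have "inj_on (\<psi> \<circ> p) (\<Union>E)" by (rule comp_inj_on) (rule inj_on_subset[OF inj pv])
    then show "inj_on p' (\<Union>E)" by (simp add: p'_def comp_def)
  next
    fix u v assume uv: "{u, v} \<in> E"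
    show "is_arc (S' {u, v}) (p' u) (p' v)" unfolding S'_def p'_def
      by (rule is_arc_image[OF drawing_arc[OF d uv] continuous_on_subset[OF cont pS[OF uv]] inj_on_subset[OF inj pS[OF uv]]])
  next
    fix e assume e: "e \<in> E"
    have "S e \<inter> p ` \<Union>E = p ` e" using d e by (simp add: drawing_def)
    then show "S' e \<inter> p' ` \<Union>E = p' ` e"
      unfolding S'_def img using inj_on_image_Int[OF inj pS[OF e] pv] by simp
  next
    fix e f assume ef: "e \<in> E" "f \<in> E" "e \<noteq> f"
    have "\<psi> ` (S e \<inter> S f) \<subseteq> \<psi> ` p ` (e \<inter> f)" using drawing_Int[OF d ef] by (rule image_mono)
    then show "S' e \<inter> S' f \<subseteq> p' ` (e \<inter> f)"
      unfolding S'_def img using inj_on_image_Int[OF inj pS[OF ef(1)] pS[OF ef(2)]] by simp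
  qed
  let ?Y = "curve S' (cedges xs)"
  have Y: "?Y = \<psi> ` ?X" by (auto simp: curve_def S'_def)
  obtain h where h: "simple_path h" "pathfinish h = pathstart h" "path_image h = ?Y"
    using cycle_curve_loop[OF d' c] .
  note J' = Jordan_inside_outside[OF h(1,2), unfolded h(3)]
  have Xp: "?X \<subseteq> - {p0}" using pS K by (auto simp: curve_def)
  have psiY: "\<psi> z \<in> ?Y \<longleftrightarrow> z \<in> ?X" if "z \<noteq> p0" for z
    unfolding Y using inj_on_image_mem_iff[OF inj _ Xp] that by simp
  have "open (inside ?X)" using J by simp
  then obtain r where r: "r > 0" "ball p0 r \<subseteq> inside ?X" using p0(1) open_contains_ball by metis
  \<comment> \<open>The punctured inside is connected, so its image would lie inside
    \<open>?Y\<close> altogether. But the image is unbounded, as points close to \<open>p0\<close>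
    are sent far away.\<close>
  have Q2: "\<psi> q \<in> outside ?Y" if q: "q \<in> inside ?X" "q \<noteq> p0" for q
  proof (rule ccontr)
    assume n: "\<psi> q \<notin> outside ?Y"
    have "q \<notin> ?X" using q(1) inside_no_overlap[of ?X] by blast
    then have "\<psi> q \<notin> ?Y" using psiY q(2) by simp
    then have i: "\<psi> q \<in> inside ?Y" using n inside_Un_outside[of ?Y] by blast
    let ?T = "\<psi> ` (inside ?X - {p0})"
    have co: "connected (inside ?X - {p0})" by (rule connected_open_delete) (use J in auto)
    have "connected ?T" by (rule connected_continuous_image[OF continuous_on_subset[OF cont] co]) auto
    moreover have "?T \<inter> ?Y = {}" using psiY inside_no_overlap[of ?X] by blast
    moreover have "\<psi> q \<in> ?T" using q by auto
    ultimately have "?T \<subseteq> inside ?Y" using i by (rule inside_absorb)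
    moreover have "bounded (inside ?Y)" using J' by simp
    ultimately have "bounded ?T" by (rule bounded_subset[rotated])
    then obtain B where B: "B > 0" "\<And>z. z \<in> ?T \<Longrightarrow> norm z \<le> B" by (meson bounded_pos)
    \<comment> \<open>Small enough that \<open>p0 + \<epsilon>\<close> stays in the ball while its
      image has norm at least \<open>2 * B\<close>.\<close>
    define \<epsilon> where "\<epsilon> = min (r / 2) (1 / (2 * B))"
    have \<epsilon>: "\<epsilon> > 0" "\<epsilon> < r" "\<epsilon> \<le> 1 / (2 * B)" using r(1) B(1) by (auto simp: \<epsilon>_def)
    have "p0 + of_real \<epsilon> \<in> ball p0 r" using \<epsilon> by (simp add: dist_norm)
    then have "p0 + of_real \<epsilon> \<in> inside ?X - {p0}" using r(2) \<epsilon>(1) by auto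
    then have "\<psi> (p0 + of_real \<epsilon>) \<in> ?T" by (rule imageI)
    from B(2)[OF this] have "inverse \<epsilon> \<le> B" using \<epsilon>(1) by (simp add: \<psi>_def norm_inverse)
    moreover have "inverse \<epsilon> \<ge> 2 * B" using \<epsilon> B(1) by (simp add: field_simps)
    ultimately show False using B(1) by simp
  qed
  \<comment> \<open>Conversely, the inverse map \<open>\<phi>\<close> would take the outside of
    \<open>?Y\<close>, apart from its pole 0, into the outside of \<open>?X\<close>. But the outside
    of \<open>?Y\<close> is unbounded, and points of large norm are taken close to
    \<open>p0\<close>.\<close>
  have Q1: "\<psi> q \<in> inside ?Y" if q: "q \<in> outside ?X" for q
  proof (rule ccontr)
    assume n: "\<psi> q \<notin> inside ?Y"
    have qX: "q \<notin> ?X" using q outside_no_overlap[of ?X] by blast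
    have qp: "q \<noteq> p0" using q p0(1) inside_Int_outside[of ?X] by blast
    then have "\<psi> q \<notin> ?Y" using psiY qX by simp
    then have i: "\<psi> q \<in> outside ?Y" using n inside_Un_outside[of ?Y] by blast
    let ?U = "outside ?Y - {0}"
    define \<phi> where "\<phi> = (\<lambda>y::complex. p0 + inverse y)"
    have \<psi>\<phi>: "\<psi> (\<phi> y) = y" "\<phi> y \<noteq> p0" if "y \<noteq> 0" for y using that by (auto simp: \<psi>_def \<phi>_def)
    have \<phi>q: "\<phi> (\<psi> q) = q" "\<psi> q \<noteq> 0" using qp by (auto simp: \<psi>_def \<phi>_def)
    have co: "connected ?U" by (rule connected_open_delete) (use J' in auto)
    have "continuous_on ?U \<phi>" unfolding \<phi>_def by (intro continuous_intros) auto
    then have "connected (\<phi> ` ?U)" using co by (rule connected_continuous_image)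
    moreover have "\<phi> ` ?U \<inter> ?X = {}"
    proof (rule ccontr)
      assume "\<phi> ` ?U \<inter> ?X \<noteq> {}"
      then obtain y where y: "y \<in> outside ?Y" "y \<noteq> 0" "\<phi> y \<in> ?X" by auto
      then have "y \<in> ?Y" using psiY[OF \<psi>\<phi>(2)[OF y(2)]] \<psi>\<phi>(1)[OF y(2)] by simp
      then show False using y(1) outside_no_overlap[of ?Y] by blast
    qed
    moreover have "q \<in> \<phi> ` ?U" using i \<phi>q by (metis DiffI image_eqI singletonD)
    ultimately have sub: "\<phi> ` ?U \<subseteq> outside ?X" using q by (rule outside_absorb)
    have "\<not> bounded (outside ?Y)" using J' by simp
    then have "\<not> (\<forall>y\<in>outside ?Y. norm y \<le> 1 / r)" unfolding bounded_iff by blast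
    then obtain y where y: "y \<in> outside ?Y" "norm y > 1 / r" by auto
    then have y0: "norm y > 0" using r(1) by (meson less_trans zero_less_divide_1_iff)
    then have "inverse (norm y) < r" using y(2) r(1) by (simp add: field_simps)
    then have "norm (inverse y) < r" by (simp add: norm_inverse)
    then have "\<phi> y \<in> ball p0 r" by (simp add: \<phi>_def dist_norm)
    then have "\<phi> y \<in> inside ?X" using r(2) by blast
    moreover have "\<phi> y \<in> outside ?X" using sub y(1) y0 by auto
    ultimately show False using inside_Int_outside[of ?X] by blast
  qed
  have Q3: "\<psi> q \<in> inside ?Y \<longleftrightarrow> q \<notin> inside ?X" if q: "q \<notin> ?X" "q \<noteq> p0" for q
  proof (cases "q \<in> inside ?X")
    case True
    then show ?thesis using Q2[OF True q(2)] inside_Int_outside[of ?Y] by blast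
  next
    case False
    then have "q \<in> outside ?X" using q(1) inside_Un_outside[of ?X] by blast
    then show ?thesis using Q1 False by blast
  qed
  have E: "e \<in> insE E p' S' (cedges xs) \<longleftrightarrow> e \<notin> insE E p S (cedges xs)" if e: "e \<in> E" "e \<notin> cedges xs" for e
  proof -
    let ?o = "S e - p ` e"
    have o': "S' e - p' ` e = \<psi> ` ?o" unfolding S'_def img
    proof (rule inj_on_image_set_diff[symmetric, OF inj])
      show "S e - p ` e \<subseteq> - {p0}" using pS[OF e(1)] by auto
      show "p ` e \<subseteq> - {p0}" using pv e(1) by auto
    qed
    obtain t where t: "t \<in> ?o" using open_edge(2)[OF d es e(1)] by auto
    have oX: "?o \<inter> ?X = {}" by (rule open_edge(3)[OF d es e(1) K e(2)])
    have op: "q \<noteq> p0" "q \<notin> ?X" if "q \<in> ?o" for q using that pS[OF e(1)] oX by auto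
    have A: "?o \<subseteq> inside ?X" if "z \<in> ?o" "z \<in> inside ?X" for z
      by (rule inside_absorb[OF open_edge(1)[OF d es e(1)] oX that])
    have q: "q \<in> inside ?X \<longleftrightarrow> t \<in> inside ?X" if "q \<in> ?o" for q
      using A[OF that] A[OF t] subsetD[of ?o "inside ?X"] that t by metis
    have "e \<in> insE E p S (cedges xs) \<longleftrightarrow> ?o \<subseteq> inside ?X" unfolding insE_def using e by simp
    moreover have "?o \<subseteq> inside ?X \<longleftrightarrow> t \<in> inside ?X" using A[OF t] t by (metis subsetD)
    ultimately have "e \<in> insE E p S (cedges xs) \<longleftrightarrow> t \<in> inside ?X" by simp
    moreover have "e \<in> insE E p' S' (cedges xs) \<longleftrightarrow> S' e - p' ` e \<subseteq> inside ?Y"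
      unfolding insE_def using e by simp
    moreover have "\<dots> \<longleftrightarrow> (\<forall>q\<in>?o. \<psi> q \<in> inside ?Y)" unfolding o' by (rule image_subset_iff)
    moreover have "\<psi> z \<in> inside ?Y \<longleftrightarrow> t \<notin> inside ?X" if "z \<in> ?o" for z
      using Q3[OF op(2)[OF that] op(1)[OF that]] q[OF that] by simp
    then have "(\<forall>q\<in>?o. \<psi> q \<in> inside ?Y) \<longleftrightarrow> t \<notin> inside ?X" using t by metis
    ultimately show ?thesis by metis
  qed
  have "insE E p' S' (cedges xs) = E - cedges xs - insE E p S (cedges xs)"
  proof (rule set_eqI)
    fix e show "e \<in> insE E p' S' (cedges xs) \<longleftrightarrow> e \<in> E - cedges xs - insE E p S (cedges xs)"
      using E[of e] insE_sub[of E p' S' "cedges xs"] by blast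
  qed
  moreover have "insV E p' S' (cedges xs) = \<Union>E - set xs - insV E p S (cedges xs)"
  proof (rule set_eqI)
    fix v show "v \<in> insV E p' S' (cedges xs) \<longleftrightarrow> v \<in> \<Union>E - set xs - insV E p S (cedges xs)"
    proof (cases "v \<in> \<Union>E")
      case False
      then show ?thesis by (simp add: insV_def del: Union_iff)
    next
      case True
      have U: "p v \<in> ?X \<longleftrightarrow> v \<in> set xs" using curve_vertex[OF d K True] Union_cedges[OF c] by simp
      show ?thesis
      proof (cases "v \<in> set xs")
        case True
        have "set xs \<inter> insV E p' S' (cedges xs) = {}"
          using insV_disjoint[OF d' K] Union_cedges[OF c] by blast
        then show ?thesis using True by blast
      next
        case False
        have "p v \<noteq> p0" using pv True by blast
        then have "\<psi> (p v) \<in> inside ?Y \<longleftrightarrow> p v \<notin> inside ?X" using Q3 U False by simp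
        then show ?thesis using True False by (simp add: insV_def p'_def del: Union_iff)
      qed
    qed
  qed
  ultimately show thesis using that[OF d'] by blast
qed

section \<open>Reducible configurations\<close>

definition plane9 :: "'a set set \<Rightarrow> bool" where
  "plane9 E \<longleftrightarrow> edgeset E \<and> (\<forall>v. degree E v \<le> 3) \<and> girth9 E \<and> drawable E"

text \<open>A counterexample with the fewest edges. The competitors have vertices of the same type,
  so a reduction that needs new vertices reuses deleted ones.\<close>

definition crit :: "'a set set \<Rightarrow> bool" where
  "crit E \<longleftrightarrow> plane9 E \<and> \<not> dec E \<and> (\<forall>F :: 'a set set. plane9 F \<and> card F < card E \<longrightarrow> dec F)"

section \<open>Vertices of small degree in a minimal counterexample\<close>

lemma edgeset_subset: "edgeset E \<Longrightarrow> F \<subseteq> E \<Longrightarrow> edgeset F"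
  unfolding edgeset_def using finite_subset by auto

lemma plane9_subset:
  assumes "plane9 E" "F \<subseteq> E" shows "plane9 F"
proof -
  have "degree F v \<le> 3" for v
  proof -
    have "degree F v \<le> degree E v" using assms by (intro degree_mono) (auto simp: plane9_def edgeset_def)
    also have "\<dots> \<le> 3" using assms by (simp add: plane9_def)
    finally show ?thesis .
  qed
  then show ?thesis using assms edgeset_subset[OF _ assms(2)] girth9_mono[OF assms(2)] drawable_subset[OF _ assms(2)]
    by (auto simp: plane9_def)
qed

lemma edge_nbr:
  assumes "edgeset E" "e \<in> E" "v \<in> e"
  obtains u where "e = {v, u}" "u \<noteq> v"
  using assms unfolding edgeset_def by (metis doubleton_eq_iff insert_iff singletonD)

lemma degree_Suc_le:
  assumes "finite E" "F \<subseteq> E" "e \<in> E" "e \<notin> F" "x \<in> e"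
  shows "Suc (degree F x) \<le> degree E x"
proof -
  have "{f \<in> F. x \<in> f} \<subset> {f \<in> E. x \<in> f}" using assms by auto
  then show ?thesis unfolding degree_def using assms(1) by (simp add: psubset_card_mono Suc_leI)
qed

lemma degree_pos: "finite F \<Longrightarrow> e \<in> F \<Longrightarrow> x \<in> e \<Longrightarrow> 1 \<le> degree F x"
  using degree_Suc_le[of F "{}" e x] by simp

lemma card_le_degree:
  assumes "finite E" "W \<subseteq> E" "\<And>e. e \<in> W \<Longrightarrow> v \<in> e"
  shows "card W \<le> degree E v"
  unfolding degree_def using assms by (intro card_mono) auto

lemma degree_Un:
  assumes "finite L" "finite M" "L \<inter> M = {}"
  shows "degree (L \<union> M) v = degree L v + degree M v"
proof -
  have "{e \<in> L \<union> M. v \<in> e} = {e \<in> L. v \<in> e} \<union> {e \<in> M. v \<in> e}" by auto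
  then show ?thesis unfolding degree_def using assms by (simp add: card_Un_disjoint disjoint_iff)
qed

lemma crit_dec_subset:
  assumes "crit E" "F \<subset> E" shows "dec F"
proof -
  have "finite E" "plane9 F" using assms plane9_subset[of E F] by (auto simp: crit_def plane9_def edgeset_def)
  then show ?thesis using assms psubset_card_mono[of E F] by (auto simp: crit_def)
qed

lemma crit_facts:
  assumes "crit E"
  shows "edgeset E" "finite E" "degree E v \<le> 3" "girth9 E" "drawable E" "\<not> dec E"
  using assms by (auto simp: crit_def plane9_def edgeset_def)

text \<open>A pendant edge goes into \<open>L\<close> unless its other end already has degree 2
  there. In that case all remaining edges at this end are in \<open>L\<close>, and the pendant edge
  can be a matching edge.\<close>

lemma crit_min_degree:
  assumes c: "crit E" and v: "v \<in> \<Union>E"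
  shows "degree E v \<ge> 2"
proof (rule ccontr)
  assume n: "\<not> degree E v \<ge> 2"
  note cf = crit_facts[OF c]
  obtain e where e: "e \<in> E" "v \<in> e" using v by auto
  obtain u where u: "e = {v, u}" "u \<noteq> v" using edge_nbr[OF cf(1) e] .
  let ?F = "E - {e}"
  have "Suc (degree ?F v) \<le> degree E v" using e cf(2) by (intro degree_Suc_le) auto
  then have d0: "degree ?F v = 0" using n by simp
  have vF: "v \<notin> \<Union>?F"
  proof
    assume "v \<in> \<Union>?F"
    then obtain f where "f \<in> ?F" "v \<in> f" by auto
    then have "1 \<le> degree ?F v" using cf(2) by (intro degree_pos) auto
    then show False using d0 by simp
  qed
  have "dec ?F" using e by (intro crit_dec_subset[OF c]) auto
  then obtain L M where LM: "ok L M" "L \<union> M = ?F" by (auto simp: dec_def)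
  have fin: "finite L" "finite M" "L \<inter> M = {}" using LM cf(2) finite_subset[of L ?F] finite_subset[of M ?F] by (auto simp: ok_def)
  have vLM: "v \<notin> \<Union>L" "v \<notin> \<Union>M" using vF LM(2) by auto
  then have eLM: "{v, u} \<notin> L" "{v, u} \<notin> M" by auto
  show False
  proof (cases "degree L u \<le> 1")
    case True
    have "ok (insert {v, u} L) M" using ok_insert_pendant[OF LM(1) vLM(1) _ True eLM(2)] u(2) by auto
    moreover have "insert {v, u} L \<union> M = E" using LM(2) e(1) u(1) by auto
    ultimately show False using cf(6) by (auto simp: dec_def)
  next
    case False
    have "Suc (degree ?F u) \<le> degree E u" using e u cf(2) by (intro degree_Suc_le) auto
    then have "degree L u + degree M u \<le> 2" using degree_Un[OF fin, of u] LM(2) cf(3)[of u] by simp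
    then have "degree M u = 0" using False by simp
    then have uM: "u \<notin> \<Union>M" using degree_pos[OF fin(2)] by fastforce
    have "ok L (insert {v, u} M)" by (rule ok_insert_M[OF LM(1) vLM(2) uM eLM(1)])
    moreover have "L \<union> insert {v, u} M = E" using LM(2) e(1) u(1) by auto
    ultimately show False using cf(6) by (auto simp: dec_def)
  qed
qed

lemma leaf_exclusive:
  assumes "ok L M" "finite M" "degree (L \<union> M) v \<le> 1" "v \<in> \<Union>M"
  shows "v \<notin> \<Union>L"
proof
  assume "v \<in> \<Union>L"
  have fin: "finite L" "L \<inter> M = {}" using assms(1) by (auto simp: ok_def)
  have "1 \<le> degree L v" "1 \<le> degree M v"
    using \<open>v \<in> \<Union>L\<close> assms(4) degree_pos[OF fin(1)] degree_pos[OF assms(2)] by auto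
  then show False using degree_Un[OF fin(1) assms(2) fin(2), of v] assms(3) by simp
qed

lemma avail_leaf:
  assumes "ok L M" "finite M" "degree (L \<union> M) v \<le> 1"
  shows "avail L M v" "degree L v \<le> 1"
proof -
  have fin: "finite L" "L \<inter> M = {}" using assms(1) by (auto simp: ok_def)
  show "degree L v \<le> 1" using degree_Un[OF fin(1) assms(2) fin(2), of v] assms(3) by simp
  then show "avail L M v" using leaf_exclusive[OF assms] by (auto simp: avail_def)
qed

text \<open>After deletion of the edge, an end covered by \<open>M\<close> is not met by
  \<open>L\<close>, so the edge can be added to \<open>L\<close> as a pendant edge. If
  \<open>M\<close> covers neither end, the edge itself joins \<open>M\<close>.\<close>

lemma crit_two_adjacent:
  assumes c: "crit E" and uv: "{u, v} \<in> E" and d: "degree E u \<le> 2" "degree E v \<le> 2"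
  shows False
proof -
  note cf = crit_facts[OF c]
  have ne: "u \<noteq> v" using cf(1) uv unfolding edgeset_def by (metis doubleton_eq_iff insert_absorb2)
  let ?F = "E - {{u, v}}"
  have "Suc (degree ?F u) \<le> degree E u" "Suc (degree ?F v) \<le> degree E v"
    using uv cf(2) degree_Suc_le[of E ?F "{u, v}" u] degree_Suc_le[of E ?F "{u, v}" v] by auto
  then have dF: "degree ?F u \<le> 1" "degree ?F v \<le> 1" using d by auto
  have "dec ?F" using uv by (intro crit_dec_subset[OF c]) auto
  then obtain L M where LM: "ok L M" "L \<union> M = ?F" by (auto simp: dec_def)
  have fin: "finite M" using LM cf(2) finite_subset[of M ?F] by auto
  have eLM: "{u, v} \<notin> L" "{u, v} \<notin> M" "{v, u} \<notin> M" using LM(2) by (auto simp: insert_commute)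
  have au: "degree L u \<le> 1" and av: "degree L v \<le> 1" using avail_leaf(2)[OF LM(1) fin] dF LM(2) by auto
  have eq: "insert {u, v} L \<union> M = E" "insert {v, u} L \<union> M = E" "L \<union> insert {u, v} M = E"
    using LM(2) uv by (auto simp: insert_commute)
  consider "u \<in> \<Union>M" | "v \<in> \<Union>M" | "u \<notin> \<Union>M" "v \<notin> \<Union>M" by blast
  then show False
  proof cases
    case 1
    have "u \<notin> \<Union>L" using leaf_exclusive[OF LM(1) fin _ 1] dF(1) LM(2) by simp
    then have "ok (insert {u, v} L) M" using ok_insert_pendant[OF LM(1) _ ne av eLM(2)] by simp
    then show False using cf(6) eq(1) by (auto simp: dec_def)
  next
    case 2
    have "v \<notin> \<Union>L" using leaf_exclusive[OF LM(1) fin _ 2] dF(2) LM(2) by simp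
    then have "ok (insert {v, u} L) M" using ok_insert_pendant[OF LM(1) _ ne[symmetric] au eLM(3)] by simp
    then show False using cf(6) eq(2) by (auto simp: dec_def)
  next
    case 3
    have "ok L (insert {u, v} M)" by (rule ok_insert_M[OF LM(1) 3 eLM(1)])
    then show False using cf(6) eq(3) by (auto simp: dec_def)
  qed
qed

section \<open>The star reduction\<close>

text \<open>The two edges at \<open>a\<close> close the walk up, and 7 is 9 less these two.\<close>

lemma girth9_walk:
  assumes "girth9 E" "{x, a} \<in> E" "{a, y} \<in> E" "x \<noteq> y" "F \<subseteq> E" "a \<notin> \<Union>F" "walk F n x y"
  shows "n \<ge> 7"
proof (rule ccontr)
  assume "\<not> n \<ge> 7"
  have far: "far (E - {{x, a}}) 8 x a" using assms(1,2) by (simp add: girth9_def)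
  have "F \<subseteq> E - {{x, a}}" using assms(5,6) by auto
  then have 1: "walk (E - {{x, a}}) n x y" using assms(7) by (rule walk_mono)
  have 2: "{y, a} \<in> E - {{x, a}}" using assms(3,4) by (auto simp: insert_commute doubleton_eq_iff)
  have "n + 1 < 8" using \<open>\<not> n \<ge> 7\<close> by simp
  then show False by (rule farD[OF far walk_trans[OF 1 walk_edge[OF 2]]])
qed

lemma girth9_no_triangle:
  assumes "girth9 E" "{x, a} \<in> E" "{a, y} \<in> E" "x \<noteq> a" "y \<noteq> a" "x \<noteq> y" shows "{x, y} \<notin> E"
proof
  assume "{x, y} \<in> E"
  then have "walk {{x, y}} 1 x y" by auto
  then have "(1::nat) \<ge> 7" using assms \<open>{x, y} \<in> E\<close>
    by (intro girth9_walk[OF assms(1-3,6), of "{{x, y}}" 1]) auto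
  then show False by simp
qed

text \<open>The reduction behind both bad cycles: a 3-vertex \<open>v\<close> with 2-neighbours \<open>a\<close>, \<open>a'\<close> leading to
  \<open>l\<close>, \<open>r\<close> and third neighbour \<open>w\<close> is replaced by a 3-vertex adjacent to \<open>l\<close>, \<open>r\<close> and (through the
  2-vertex \<open>a\<close>) to \<open>w\<close>. The new \<open>v\<close> must be covered by the matching, so at least one of
  \<open>w\<close>, \<open>l\<close>, \<open>r\<close> becomes available for the old configuration.\<close>

lemma shrink_star:
  assumes pl: "plane9 E" and E: "{v, a} \<in> E" "{a, l} \<in> E" "{v, a'} \<in> E" "{a', r} \<in> E" "{v, w} \<in> E"
    and dist: "distinct [v, a, l, a', r, w]" and F: "F \<subseteq> E" "v \<notin> \<Union>F" "a \<notin> \<Union>F" "a' \<notin> \<Union>F"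
    and far: "far F 7 l r"
  shows "plane9 (insert {v, r} (insert {v, l} (insert {v, a} (insert {a, w} F))))" (is "plane9 ?G")
    "card (insert {v, r} (insert {v, l} (insert {v, a} (insert {a, w} F)))) < card E"
proof -
  have es: "edgeset E" and fin: "finite E" and g9: "girth9 E" and dr: "drawable E" and d3: "\<And>x. degree E x \<le> 3"
    using pl by (auto simp: plane9_def edgeset_def)
  have finF: "finite F" using F(1) fin by (rule finite_subset)
  \<comment> \<open>Five edges disappear and at most four new ones are added.\<close>
  let ?N = "{{v, a}, {a, l}, {v, a'}, {a', r}, {v, w}}"
  have NE: "?N \<subseteq> E" and NF: "?N \<inter> F = {}" using E F by auto
  have N5: "card ?N = 5" using dist by (auto simp: doubleton_eq_iff card_insert_if)
  have "card F + 5 = card (?N \<union> F)" using N5 NF finF by (subst card_Un_disjoint) auto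
  also have "\<dots> \<le> card E" using NE F(1) fin by (intro card_mono) auto
  finally have cF: "card F + 5 \<le> card E" .
  have "card ?G \<le> card F + 4"
    using card_insert_le_m1[of 1] finF by (simp add: card_insert_if)
  then show "card ?G < card E" using cF by simp
  have "edgeset F" by (rule edgeset_subset[OF es F(1)])
  then have "edgeset ?G" using dist unfolding edgeset_def by auto
  moreover have "degree ?G x \<le> 3" for x
  proof -
    have lt: "Suc (degree F x) \<le> 3" if "e \<in> ?N" "x \<in> e" for e
      using degree_Suc_le[OF fin F(1), of e x] that NE NF d3[of x] by fastforce
    consider "x = v" | "x = a" | "x = l" | "x = r" | "x = w" | "x \<notin> {v, a, l, r, w}" by auto
    then show ?thesis
    proof cases
      case 1
      have "degree (insert {a, w} F) x = 0" using 1 dist F(2) by (intro degree_0) auto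
      then show ?thesis using degree_insert_le[of "{v,r}" "insert {v, l} (insert {v, a} (insert {a, w} F))" x]
        degree_insert_le[of "{v,l}" "insert {v, a} (insert {a, w} F)" x] degree_insert_le[of "{v,a}" "insert {a, w} F" x] by simp
    next
      case 2
      have "degree F x = 0" using 2 F(3) by (intro degree_0) auto
      then show ?thesis using 2 dist degree_insert_le[of "{v,a}" "insert {a, w} F" x] degree_insert_le[of "{a,w}" F x]
        by (auto simp: degree_insert_edge_other)
    next
      case 3
      then show ?thesis using dist lt[of "{a, l}"] degree_insert_le[of "{v,l}" F x] degree_insert_le[of "{v,l}" "insert {v, a} (insert {a, w} F)" x]
        by (auto simp: degree_insert_edge_other)
    next
      case 4
      then show ?thesis using dist lt[of "{a', r}"] degree_insert_le[of "{v,r}" "insert {v, l} (insert {v, a} (insert {a, w} F))" x]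
        by (auto simp: degree_insert_edge_other)
    next
      case 5
      then show ?thesis using dist lt[of "{v, w}"] degree_insert_le[of "{a,w}" F x]
        by (auto simp: degree_insert_edge_other)
    next
      case 6
      then have "degree ?G x = degree F x" by (simp add: degree_insert_edge_other)
      then show ?thesis using degree_mono[OF fin F(1), of x] d3[of x] by simp
    qed
  qed
  moreover have "girth9 ?G"
  proof -
    \<comment> \<open>A walk from \<open>w\<close> to \<open>s\<close> closes up through
      \<open>w\<close>, \<open>v\<close>, \<open>b\<close>, \<open>s\<close>, hence 6 = 9 - 3. The
      two pendant edges \<open>{a, w}\<close> and \<open>{v, a}\<close> then raise the distances to
      \<open>l\<close> and \<open>r\<close> to 8, as required for joining \<open>v\<close> to
      them.\<close>
    have w6: "far F 6 w s" if s: "{v, b} \<in> E" "{b, s} \<in> E" "s \<noteq> v" "b \<noteq> w" "b \<noteq> v" "s \<noteq> w" for b s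
      unfolding far_def
    proof (intro allI impI notI)
      fix n assume n: "n < 6" "walk F n w s"
      have f8: "far (E - {{v, w}}) 8 v w" using g9 E(5) by (simp add: girth9_def)
      have "F \<subseteq> E - {{v, w}}" using F(1,2) by auto
      then have 1: "walk (E - {{v, w}}) n s w" using walk_sym[OF n(2)] by (rule walk_mono)
      have 2: "{v, b} \<in> E - {{v, w}}" "{b, s} \<in> E - {{v, w}}" using s by (auto simp: doubleton_eq_iff)
      have "1 + (1 + n) < 8" using n(1) by simp
      then show False by (rule farD[OF f8 walk_trans[OF walk_edge[OF 2(1)] walk_trans[OF walk_edge[OF 2(2)] 1]]])
    qed
    let ?F2 = "insert {a, w} F" and ?F3 = "insert {v, a} (insert {a, w} F)"
    have vF2: "v \<notin> \<Union>?F2" using F(2) dist by auto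
    have g1: "girth9 F" by (rule girth9_mono[OF F(1) g9])
    have g2: "girth9 ?F2" using dist by (intro girth9_insert[OF g1] far_isolated[OF F(3)]) auto
    have g3: "girth9 ?F3" using dist by (intro girth9_insert[OF g2] far_isolated[OF vF2]) auto
    have wl: "far F 6 w l" "far F 6 w r" using w6[OF E(1,2)] w6[OF E(3,4)] dist by auto
    have ne: "l \<noteq> a" "r \<noteq> a" "l \<noteq> v" "r \<noteq> v" using dist by auto
    have "far ?F2 7 a l" "far ?F2 7 a r"
      using far_insert_pendant[OF wl(1) F(3) ne(1)] far_insert_pendant[OF wl(2) F(3) ne(2)] by simp_all
    then have vl: "far ?F3 8 v l" and vr: "far ?F3 8 v r"
      using far_insert_pendant[OF _ vF2 ne(3), of 7 a] far_insert_pendant[OF _ vF2 ne(4), of 7 a] by simp_all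
    have lr: "far ?F3 7 l r"
      by (rule far_insert_other[OF far_insert_other[OF far F(3) ne(1,2)] vF2 ne(3,4)])
    have g4: "girth9 (insert {v, l} ?F3)" by (rule girth9_insert[OF g3 vl])
    have "far (insert {v, l} ?F3) 8 v r"
    proof (rule far_insert[OF vr])
      fix i j assume "i + j + 1 < (8::nat)" and j: "walk ?F3 j l r"
      then show False by (intro farD[OF lr j]) simp
    next
      fix i j assume "i + j + 1 < (8::nat)" and i: "walk ?F3 i v l"
      then show False by (intro farD[OF vl i]) simp
    qed
    then show ?thesis by (rule girth9_insert[OF g4])
  qed
  moreover have "drawable ?G"
  proof -
    have nvl: "{v, l} \<notin> E" "{v, r} \<notin> E" using girth9_no_triangle[OF g9 E(1,2)] girth9_no_triangle[OF g9 E(3,4)] dist by auto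
    \<comment> \<open>Suppressing \<open>a\<close> and \<open>a'\<close> makes \<open>v\<close>
      adjacent to \<open>l\<close>, \<open>r\<close> and \<open>w\<close>; the freed vertex
      \<open>a\<close> then subdivides \<open>{v, w}\<close>. Edges outside
      \<open>?N \<union> F\<close> are dropped beforehand, so that \<open>a\<close> and
      \<open>a'\<close> have no others.\<close>
    define E0 where "E0 = ?N \<union> F"
    have "drawable E0" by (rule drawable_subset[OF dr]) (use NE F(1) in \<open>auto simp: E0_def\<close>)
    moreover have "{v, a} \<in> E0" "{a, l} \<in> E0" by (auto simp: E0_def)
    moreover have "{v, l} \<notin> E0" using nvl NE F(1) by (auto simp: E0_def)
    moreover have "e = {v, a} \<or> e = {a, l}" if "e \<in> E0" "a \<in> e" for e
      using that F(3) dist unfolding E0_def by auto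
    ultimately have 1: "drawable (insert {v, l} (E0 - {{v, a}, {a, l}}))"
      using dist by (intro drawable_contract) auto
    define E1 where "E1 = {{v, l}, {v, a'}, {a', r}, {v, w}} \<union> F"
    have "E1 \<subseteq> insert {v, l} (E0 - {{v, a}, {a, l}})"
      using NF dist unfolding E1_def E0_def by (auto simp: doubleton_eq_iff)
    with 1 have "drawable E1" by (rule drawable_subset)
    moreover have "{v, a'} \<in> E1" "{a', r} \<in> E1" by (auto simp: E1_def)
    moreover have "{v, r} \<notin> E1" using nvl NE F(1) dist by (auto simp: E1_def doubleton_eq_iff)
    moreover have "e = {v, a'} \<or> e = {a', r}" if "e \<in> E1" "a' \<in> e" for e
      using that F(4) dist unfolding E1_def by auto
    ultimately have 2: "drawable (insert {v, r} (E1 - {{v, a'}, {a', r}}))"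
      using dist by (intro drawable_contract) auto
    define E2 where "E2 = {{v, l}, {v, r}, {v, w}} \<union> F"
    have "E2 \<subseteq> insert {v, r} (E1 - {{v, a'}, {a', r}})"
      using NF dist unfolding E2_def E1_def by (auto simp: doubleton_eq_iff)
    with 2 have "drawable E2" by (rule drawable_subset)
    moreover have "{v, w} \<in> E2" "v \<noteq> w" "a \<notin> \<Union>E2" using dist F(3) by (auto simp: E2_def)
    ultimately have 3: "drawable (insert {v, a} (insert {a, w} (E2 - {{v, w}})))" by (rule drawable_subdivide)
    have "?G \<subseteq> insert {v, a} (insert {a, w} (E2 - {{v, w}}))"
      using NF dist unfolding E2_def by (auto simp: doubleton_eq_iff)
    with 3 show ?thesis by (rule drawable_subset)
  qed
  ultimately show "plane9 ?G" by (simp add: plane9_def)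
qed

text \<open>The edge \<open>{v, w}\<close> inherits the class of \<open>{a, w}\<close>. If this is
  \<open>L\<close>, no edge of the new matching meets \<open>v\<close>. If it is \<open>M\<close>,
  then \<open>{v, a}\<close> is in \<open>L\<close>, so one of \<open>{v, l}\<close> and
  \<open>{v, r}\<close> must have been in \<open>M\<close>; its disappearance leaves
  \<open>l\<close> or \<open>r\<close> uncovered.\<close>

lemma unshrink_star:
  assumes LM: "ok L M" "L \<union> M = insert {v, r} (insert {v, l} (insert {v, a} (insert {a, w} F)))"
    and dist: "distinct [v, a, l, r, w]" and F: "finite F" "v \<notin> \<Union>F" "a \<notin> \<Union>F"
  obtains L0 M0 where "ok L0 M0" "L0 \<union> M0 = insert {v, w} F" "v \<notin> \<Union>M0 \<or> l \<notin> \<Union>M0 \<or> r \<notin> \<Union>M0"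
proof -
  have ok: "ok (L \<inter> F) (M \<inter> F)" by (rule ok_subset[OF LM(1)]) auto
  have sub: "F \<subseteq> L \<union> M" using LM(2) by auto
  have finL: "finite L" and dL: "degree L x \<le> 2" and mat: "matching M" and disj: "L \<inter> M = {}" for x
    using LM(1) by (auto simp: ok_def)
  have vw: "{v, w} \<notin> F" "{a, w} \<notin> F" "{v, l} \<notin> F" "{v, r} \<notin> F" using F(2,3) by auto
  have vLF: "v \<notin> \<Union>(L \<inter> F)" "v \<notin> \<Union>(M \<inter> F)" using F(2) by auto
  have M: "e = f" if "e \<in> M" "f \<in> M" "x \<in> e" "x \<in> f" for e f x
    using mat that unfolding matching_def by blast
  have mem: "{a, w} \<in> L \<union> M" "{v, a} \<in> L \<union> M" "{v, l} \<in> L \<union> M" "{v, r} \<in> L \<union> M" using LM(2) by auto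
  show thesis
  proof (cases "{a, w} \<in> L")
    case True
    have "Suc (degree (L \<inter> F) w) \<le> degree L w"
      using True vw(2) by (intro degree_Suc_le[OF finL]) auto
    then have "degree (L \<inter> F) w \<le> 1" using dL[of w] by simp
    then have 1: "ok (insert {v, w} (L \<inter> F)) (M \<inter> F)"
      using ok_insert_pendant[OF ok vLF(1)] dist vw(1) by auto
    have 2: "insert {v, w} (L \<inter> F) \<union> (M \<inter> F) = insert {v, w} F" using sub by auto
    show thesis by (rule that[OF 1 2]) (use vLF(2) in simp)
  next
    case False
    then have awM: "{a, w} \<in> M" using mem(1) by blast
    have wM: "w \<notin> \<Union>(M \<inter> F)"
    proof
      assume "w \<in> \<Union>(M \<inter> F)"
      then obtain f where f: "f \<in> M" "f \<in> F" "w \<in> f" by auto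
      then have "f = {a, w}" using M[OF f(1) awM f(3)] by simp
      then show False using f(2) vw(2) by simp
    qed
    have "{v, w} \<notin> L \<inter> F" using vw(1) by simp
    then have ok0: "ok (L \<inter> F) (insert {v, w} (M \<inter> F))" using ok_insert_M[OF ok vLF(2) wM] by simp
    have "{v, a} \<notin> M"
    proof
      assume "{v, a} \<in> M"
      then have "{v, a} = {a, w}" using M[OF _ awM, of "{v, a}" a] by simp
      then show False using dist by (auto simp: doubleton_eq_iff)
    qed
    then have vaL: "{v, a} \<in> L" using mem(2) by blast
    have key: "s \<notin> \<Union>(insert {v, w} (M \<inter> F))" if s: "{v, s} \<in> M" "s \<noteq> w" "s \<noteq> v" for s
    proof
      assume "s \<in> \<Union>(insert {v, w} (M \<inter> F))"
      then obtain f where f: "f \<in> M" "f \<in> F" "s \<in> f" using s by auto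
      then have "f = {v, s}" using M[OF f(1) s(1) f(3)] by simp
      then show False using f(2) F(2) by auto
    qed
    have "\<not> ({v, l} \<in> L \<and> {v, r} \<in> L)"
    proof
      assume "{v, l} \<in> L \<and> {v, r} \<in> L"
      then have "card {{v, a}, {v, l}, {v, r}} \<le> degree L v" using vaL by (intro card_le_degree[OF finL]) auto
      moreover have "card {{v, a}, {v, l}, {v, r}} = 3" using dist by (auto simp: doubleton_eq_iff card_insert_if)
      ultimately show False using dL[of v] by simp
    qed
    then have "{v, l} \<in> M \<or> {v, r} \<in> M" using mem by blast
    then have 1: "l \<notin> \<Union>(insert {v, w} (M \<inter> F)) \<or> r \<notin> \<Union>(insert {v, w} (M \<inter> F))"
      using key[of l] key[of r] dist by auto
    have 2: "(L \<inter> F) \<union> insert {v, w} (M \<inter> F) = insert {v, w} F" using sub by auto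
    show thesis by (rule that[OF ok0 2 disjI2[OF 1]])
  qed
qed

section \<open>Extending decompositions over cycles of length 10 and 9\<close>

lemma fits_leaves:
  assumes "ok L M" "finite M" "\<And>a y. (a, y) \<in> set ps \<Longrightarrow> a \<notin> \<Union>(L \<union> M) \<and> degree (L \<union> M) y \<le> 1"
  shows "fits L M ps"
  unfolding fits_def
proof clarify
  fix a y assume "(a, y) \<in> set ps"
  from assms(3)[OF this] have "a \<notin> \<Union>(L \<union> M)" "avail L M y" using avail_leaf(1)[OF assms(1,2)] by auto
  then show "a \<notin> \<Union>L \<and> a \<notin> \<Union>M \<and> avail L M y" by simp
qed

lemma extend_10:
  assumes ok: "ok L M" and LM: "L \<union> M = F" and fin: "finite F"
    and dist: "distinct [u, b1, y1, b2, y2, b3, y3, b4, y4, b5]"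
    and b: "b1 \<notin> \<Union>F" "b2 \<notin> \<Union>F" "b3 \<notin> \<Union>F" "b4 \<notin> \<Union>F" "b5 \<notin> \<Union>F"
    and y: "degree F u \<le> 1" "degree F y1 \<le> 1" "degree F y2 \<le> 1" "degree F y3 \<le> 1" "degree F y4 \<le> 1"
    and u: "u \<notin> \<Union>M"
  shows "dec (F \<union> cedges [u, b1, y1, b2, y2, b3, y3, b4, y4, b5])"
proof -
  have finM: "finite M" using LM fin by (metis finite_Un)
  let ?ps = "[(b1, y1), (b2, y2), (b3, y3), (b4, y4)]"
  have f: "fits L M ?ps" using b y LM by (intro fits_leaves[OF ok finM]) auto
  have b5: "b5 \<notin> \<Union>L" "b5 \<notin> \<Union>M" using b LM by auto
  have "degree L u \<le> 1" using avail_leaf(2)[OF ok finM] y LM by simp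
  from cycle_close[OF ok this u f b5] dist
  have "dec (L \<union> M \<union> zig u ?ps \<union> {{zend u ?ps, b5}, {b5, u}})" by simp
  also have "L \<union> M \<union> zig u ?ps \<union> {{zend u ?ps, b5}, {b5, u}} = F \<union> cedges [u, b1, y1, b2, y2, b3, y3, b4, y4, b5]"
    using LM by (auto simp: cedges_def)
  finally show ?thesis .
qed

text \<open>The edge between the two consecutive 3-vertices decides the case. If \<open>M\<close>
  covers neither \<open>v1\<close> nor \<open>v5\<close>, this edge joins \<open>M\<close>, and the
  rest of the cycle is a chain whose ends are both served. Otherwise one of its ends is not met by
  \<open>L\<close>, so that the edge can enter \<open>L\<close>, and the tour starts at some
  3-vertex missed by \<open>M\<close>.\<close>

lemma extend_9:
  assumes ok: "ok L M" and LM: "L \<union> M = F" and fin: "finite F"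
    and dist: "distinct [v1, a1, v2, a2, v3, a3, v4, a4, v5]"
    and a: "a1 \<notin> \<Union>F" "a2 \<notin> \<Union>F" "a3 \<notin> \<Union>F" "a4 \<notin> \<Union>F"
    and v: "degree F v1 \<le> 1" "degree F v2 \<le> 1" "degree F v3 \<le> 1" "degree F v4 \<le> 1" "degree F v5 \<le> 1"
    and vF: "v2 \<in> \<Union>F" "v3 \<in> \<Union>F" "v4 \<in> \<Union>F"
    and new: "{v1, v5} \<notin> F"
    and types: "(v2 \<notin> \<Union>M \<or> v3 \<notin> \<Union>M \<or> v4 \<notin> \<Union>M) \<or> v1 \<notin> \<Union>M \<and> (v5 \<in> \<Union>M \<or> \<not> conn L v1 v5)"
  shows "dec (F \<union> cedges [v1, a1, v2, a2, v3, a3, v4, a4, v5])" (is "dec ?E")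
proof -
  have finM: "finite M" using LM fin by (metis finite_Un)
  have E: "?E = F \<union> {{v1, a1}, {a1, v2}, {v2, a2}, {a2, v3}, {v3, a3}, {a3, v4}, {v4, a4}, {a4, v5}, {v5, v1}}"
    by (simp add: cedges_def)
  have aL: "a1 \<notin> \<Union>L" "a2 \<notin> \<Union>L" "a3 \<notin> \<Union>L" "a4 \<notin> \<Union>L" "a1 \<notin> \<Union>M" "a2 \<notin> \<Union>M" "a3 \<notin> \<Union>M" "a4 \<notin> \<Union>M"
    using a LM by auto
  have newM: "{v1, v5} \<notin> M" "{v1, v5} \<notin> L" "{v5, v1} \<notin> M" using new LM by (auto simp: insert_commute)
  have fits: "fits L M ps" if "\<forall>(a, y) \<in> set ps. a \<notin> \<Union>F \<and> degree F y \<le> 1" for ps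
    using that LM by (intro fits_leaves[OF ok finM]) auto
  have dL: "degree L v1 \<le> 1" "degree L v2 \<le> 1" "degree L v3 \<le> 1" "degree L v4 \<le> 1" "degree L v5 \<le> 1"
    using avail_leaf(2)[OF ok finM] v LM by auto
  have excl: "x \<notin> \<Union>L" if "degree F x \<le> 1" "x \<in> \<Union>M" for x
    using leaf_exclusive[OF ok finM _ that(2)] that(1) LM by simp
  show ?thesis
  proof (cases "v1 \<in> \<Union>M")
    case False
    show ?thesis
    proof (cases "v5 \<in> \<Union>M")
      case True
      let ?qs = "[(a4, v4), (a3, v3), (a2, v2)]"
      have "dec (L \<union> M \<union> zig v1 [] \<union> {{zend v1 [], v5}} \<union> zig v5 ?qs \<union> {{zend v5 ?qs, a1}, {a1, v1}})"
        using dist a v by (intro cycle_close_direct[OF ok dL(1) False _ excl[OF v(5) True] _ aL(1,5)] fits) (auto simp: newM(1))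
      also have "L \<union> M \<union> zig v1 [] \<union> {{zend v1 [], v5}} \<union> zig v5 ?qs \<union> {{zend v5 ?qs, a1}, {a1, v1}} = ?E"
        unfolding E using LM by (auto simp: insert_commute)
      finally show ?thesis .
    next
      case v5: False
      let ?M = "insert {v1, v5} M" and ?ps = "[(a1, v2), (a2, v3), (a3, v4)]"
      have ok': "ok L ?M" by (rule ok_insert_M[OF ok False v5 newM(2)])
      have f0: "fits L M ?ps" using a v by (intro fits) auto
      have f: "fits L ?M ?ps"
        by (rule fits_frame[OF f0, of L "{{v1, v5}}"]) (use dist in auto)
      \<comment> \<open>A vertex among \<open>v2\<close>, \<open>v3\<close>, \<open>v4\<close> that
        \<open>M\<close> misses still has its third edge in \<open>F\<close>, so it is met by
        \<open>L\<close>.\<close>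
      have "\<not> conn L v1 v5 \<or> (\<exists>(a, z) \<in> set ?ps. z \<in> \<Union>L)"
        using types v5 vF LM by auto
      then have "dec (L \<union> ?M \<union> zig v1 ?ps \<union> {{zend v1 ?ps, a4}, {a4, v5}})"
        using dist aL(4,8) by (intro live_chain[OF ok' dL(1,5) f]) auto
      also have "L \<union> ?M \<union> zig v1 ?ps \<union> {{zend v1 ?ps, a4}, {a4, v5}} = ?E"
        unfolding E using LM by (auto simp: insert_commute)
      finally show ?thesis .
    qed
  next
    case True
    have v1L: "v1 \<notin> \<Union>L" by (rule excl[OF v(1) True])
    show ?thesis
    proof (cases "v5 \<in> \<Union>M")
      case False
      let ?qs = "[(a1, v2), (a2, v3), (a3, v4)]"
      have "dec (L \<union> M \<union> zig v5 [] \<union> {{zend v5 [], v1}} \<union> zig v1 ?qs \<union> {{zend v1 ?qs, a4}, {a4, v5}})"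
        using dist a v by (intro cycle_close_direct[OF ok dL(5) False _ v1L _ aL(4,8)] fits) (auto simp: newM(3))
      also have "L \<union> M \<union> zig v5 [] \<union> {{zend v5 [], v1}} \<union> zig v1 ?qs \<union> {{zend v1 ?qs, a4}, {a4, v5}} = ?E"
        unfolding E using LM by (auto simp: insert_commute)
      finally show ?thesis .
    next
      case v5: True
      have v5L: "v5 \<notin> \<Union>L" by (rule excl[OF v(5) v5])
      consider "v2 \<notin> \<Union>M" | "v3 \<notin> \<Union>M" | "v4 \<notin> \<Union>M" using types True by blast
      then show ?thesis
      proof cases
        case 1
        let ?ps = "[(a1, v1)]" and ?qs = "[(a4, v4), (a3, v3)]"
        have "dec (L \<union> M \<union> zig v2 ?ps \<union> {{zend v2 ?ps, v5}} \<union> zig v5 ?qs \<union> {{zend v5 ?qs, a2}, {a2, v2}})"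
          using dist a v by (intro cycle_close_direct[OF ok dL(2) 1 _ v5L _ aL(2,6)] fits) (auto simp: newM(1))
        also have "L \<union> M \<union> zig v2 ?ps \<union> {{zend v2 ?ps, v5}} \<union> zig v5 ?qs \<union> {{zend v5 ?qs, a2}, {a2, v2}} = ?E"
          unfolding E using LM by (auto simp: insert_commute)
        finally show ?thesis .
      next
        case 2
        let ?ps = "[(a2, v2), (a1, v1)]" and ?qs = "[(a4, v4)]"
        have "dec (L \<union> M \<union> zig v3 ?ps \<union> {{zend v3 ?ps, v5}} \<union> zig v5 ?qs \<union> {{zend v5 ?qs, a3}, {a3, v3}})"
          using dist a v by (intro cycle_close_direct[OF ok dL(3) 2 _ v5L _ aL(3,7)] fits) (auto simp: newM(1))
        also have "L \<union> M \<union> zig v3 ?ps \<union> {{zend v3 ?ps, v5}} \<union> zig v5 ?qs \<union> {{zend v5 ?qs, a3}, {a3, v3}} = ?E"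
          unfolding E using LM by (auto simp: insert_commute)
        finally show ?thesis .
      next
        case 3
        let ?ps = "[(a3, v3), (a2, v2), (a1, v1)]" and ?qs = "[]"
        have "dec (L \<union> M \<union> zig v4 ?ps \<union> {{zend v4 ?ps, v5}} \<union> zig v5 ?qs \<union> {{zend v5 ?qs, a4}, {a4, v4}})"
          using dist a v by (intro cycle_close_direct[OF ok dL(4) 3 _ v5L _ aL(4,8)] fits) (auto simp: newM(1))
        also have "L \<union> M \<union> zig v4 ?ps \<union> {{zend v4 ?ps, v5}} \<union> zig v5 ?qs \<union> {{zend v5 ?qs, a4}, {a4, v4}} = ?E"
          unfolding E using LM by (auto simp: insert_commute)
        finally show ?thesis .
      qed
    qed
  qed
qed

section \<open>Reducibility of the two kinds of cycle\<close>

lemma degree_cedges: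
  assumes "cyc E xs" "v \<in> set xs" shows "degree (cedges xs) v = 2"
proof -
  obtain ys where ys: "cyc E (v # ys)" "cedges (v # ys) = cedges xs"
    using cyc_rotate_to[OF assms] by metis
  then have "length ys \<ge> 2" by (simp add: cyc_def)
  then obtain y zs z where yz: "ys = y # zs @ [z]"
    by (cases ys; cases "tl ys" rule: rev_cases) auto
  have "cedges xs = insert {v, y} (insert {z, v} (pedges (y # zs @ [z])))"
    using ys(2) yz pedges_append[of "y # zs" z "[v]"] by (auto simp: cedges_def)
  moreover have "v \<notin> e" if "e \<in> pedges (y # zs @ [z])" for e
    using pedges_subset[OF that] ys(1) yz by (auto simp: cyc_def)
  ultimately have "{e \<in> cedges xs. v \<in> e} = {{v, y}, {z, v}}" by auto
  moreover have "{v, y} \<noteq> {z, v}" using ys(1) yz by (auto simp: cyc_def doubleton_eq_iff)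
  ultimately show ?thesis by (simp add: degree_def)
qed

lemma degree_residual:
  assumes "finite E" "cyc E xs" "v \<in> set xs"
  shows "degree (E - cedges xs) v + 2 = degree E v"
proof -
  have "E = (E - cedges xs) \<union> cedges xs" using assms(2) by (auto simp: cyc_def)
  then have "degree E v = degree (E - cedges xs) v + degree (cedges xs) v"
    using degree_Un[of "E - cedges xs" "cedges xs" v] assms(1) by auto
  then show ?thesis using degree_cedges[OF assms(2,3)] by simp
qed

lemma degree_0_iff: "finite F \<Longrightarrow> degree F v = 0 \<longleftrightarrow> v \<notin> \<Union>F"
  using degree_pos[of F _ v] degree_0[of v F] by fastforce

text \<open>\<open>D\<close> is a set of cycle edges that are kept during the reduction: none, or
  the edge between the two consecutive 3-vertices of a 9-cycle.\<close>

lemma star_step: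
  assumes c: "crit E" and cy: "cyc E xs" and F0: "F0 = E - cedges xs"
    and K: "{v, a} \<in> cedges xs" "{a, l} \<in> cedges xs" "{v, a'} \<in> cedges xs" "{a', r} \<in> cedges xs"
    and dist: "distinct [v, a, l, a', r]" and two: "degree E a = 2" "degree E a' = 2" and three: "degree E v = 3"
    and D: "D \<subseteq> cedges xs" "v \<notin> \<Union>D" "a \<notin> \<Union>D" "a' \<notin> \<Union>D"
    and far: "far (F0 \<union> D) 7 l r"
  shows "\<exists>L M. ok L M \<and> L \<union> M = F0 \<union> D \<and> (v \<notin> \<Union>M \<or> l \<notin> \<Union>M \<or> r \<notin> \<Union>M)"
proof -
  note cf = crit_facts[OF c]
  have KE: "cedges xs \<subseteq> E" using cy by (simp add: cyc_def)
  have inC: "v \<in> set xs" "a \<in> set xs" "a' \<in> set xs" using K Union_cedges[OF cy] by blast+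
  have res: "degree F0 x + 2 = degree E x" if "x \<in> set xs" for x
    unfolding F0 by (rule degree_residual[OF cf(2) cy that])
  have finF0: "finite F0" using cf(2) F0 by simp
  have a: "a \<notin> \<Union>F0" "a' \<notin> \<Union>F0"
    using res[OF inC(2)] res[OF inC(3)] two degree_0_iff[OF finF0] by auto
  have v1: "degree F0 v = 1" using res[OF inC(1)] three by simp
  then have "v \<in> \<Union>F0" using degree_0_iff[OF finF0, of v] by auto
  then obtain e where e: "e \<in> F0" "v \<in> e" by blast
  then obtain w where w: "e = {v, w}" "w \<noteq> v" using edge_nbr[OF cf(1), of e v] F0 by blast
  have vwE: "{v, w} \<in> E" "{v, w} \<in> F0" using e w F0 by auto
  let ?F = "(F0 - {{v, w}}) \<union> D"
  have "Suc (degree (F0 - {{v, w}}) v) \<le> degree F0 v" using vwE finF0 by (intro degree_Suc_le) auto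
  then have "degree (F0 - {{v, w}}) v = 0" using v1 by simp
  then have "v \<notin> \<Union>(F0 - {{v, w}})" using degree_0_iff[of "F0 - {{v, w}}" v] finF0 by simp
  then have vF: "v \<notin> \<Union>?F" using D(2) by auto
  have aF: "a \<notin> \<Union>?F" "a' \<notin> \<Union>?F" using a D(3,4) by auto
  have E: "{v, a} \<in> E" "{a, l} \<in> E" "{v, a'} \<in> E" "{a', r} \<in> E" using K KE by auto
  have "{v, l} \<notin> E" "{v, r} \<notin> E"
    using girth9_no_triangle[OF cf(4) E(1,2)] girth9_no_triangle[OF cf(4) E(3,4)] dist by auto
  then have "w \<noteq> l" "w \<noteq> r" using vwE by auto
  moreover have "w \<noteq> a" "w \<noteq> a'" using a vwE(2) by auto
  ultimately have dist': "distinct [v, a, l, a', r, w]" using dist w(2) by auto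
  have FE: "?F \<subseteq> E" using F0 D(1) KE by auto
  have fr: "far ?F 7 l r" by (rule far_mono[OF _ far]) auto
  let ?G = "insert {v, r} (insert {v, l} (insert {v, a} (insert {a, w} ?F)))"
  have pl: "plane9 E" using c by (simp add: crit_def)
  have "plane9 ?G" "card ?G < card E"
    using shrink_star[OF pl E vwE(1) dist' FE vF aF fr] by blast+
  then have "dec ?G" using c by (simp add: crit_def)
  then obtain L1 M1 where 1: "ok L1 M1" "L1 \<union> M1 = ?G" by (auto simp: dec_def)
  have finF: "finite ?F" using FE cf(2) by (rule finite_subset)
  have d5: "distinct [v, a, l, r, w]" using dist' by auto
  obtain L M where LM: "ok L M" "L \<union> M = insert {v, w} ?F" "v \<notin> \<Union>M \<or> l \<notin> \<Union>M \<or> r \<notin> \<Union>M"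
    using unshrink_star[OF 1 d5 finF vF aF(1)] .
  have "insert {v, w} ?F = F0 \<union> D" using vwE(2) by auto
  then have eq: "L \<union> M = F0 \<union> D" using LM(2) by simp
  show ?thesis by (intro exI conjI, rule LM(1), rule eq, rule LM(3))
qed

text \<open>Two walks that must meet, as alternating ears on the same side of a cycle do.\<close>

definition crosses :: "'a set set \<Rightarrow> 'a \<Rightarrow> 'a \<Rightarrow> 'a \<Rightarrow> 'a \<Rightarrow> bool" where
  "crosses F s t s' t' \<longleftrightarrow> (\<forall>i j. walk F i s t \<longrightarrow> walk F j s' t' \<longrightarrow>
     (\<exists>p i1 i2 j1 j2. walk F i1 s p \<and> walk F i2 t p \<and> walk F j1 s' p \<and> walk F j2 t' p \<and>
        i1 + i2 \<le> i \<and> j1 + j2 \<le> j))"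

text \<open>At the meeting point the halves recombine to walks from \<open>s\<close> to
  \<open>s'\<close> and from \<open>t\<close> to \<open>t'\<close>. Each closes up through a
  2-vertex and so has length at least 7. Two walks of length at most 6 do not add up to 14.\<close>

lemma crosses_far:
  assumes g: "girth9 E" and F: "F \<subseteq> E" and x: "crosses F s t s' t'"
    and s: "{s, b} \<in> E" "{b, s'} \<in> E" "s \<noteq> s'" "b \<notin> \<Union>F"
    and t: "{t, c} \<in> E" "{c, t'} \<in> E" "t \<noteq> t'" "c \<notin> \<Union>F"
    and w: "walk F j s' t'" "j < 7"
  shows "far F 7 s t"
  unfolding far_def
proof (intro allI impI notI)
  fix i assume i: "i < 7" "walk F i s t"
  obtain p i1 i2 j1 j2 where p: "walk F i1 s p" "walk F i2 t p" "walk F j1 s' p" "walk F j2 t' p"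
    "i1 + i2 \<le> i" "j1 + j2 \<le> j" using x i(2) w(1) unfolding crosses_def by metis
  have "walk F (i1 + j1) s s'" by (rule walk_trans[OF p(1) walk_sym[OF p(3)]])
  then have "i1 + j1 \<ge> 7" by (rule girth9_walk[OF g s(1-3) F s(4)])
  moreover have "walk F (i2 + j2) t t'" by (rule walk_trans[OF p(2) walk_sym[OF p(4)]])
  then have "i2 + j2 \<ge> 7" by (rule girth9_walk[OF g t(1-3) F t(4)])
  ultimately show False using p(5,6) i(1) w(2) by linarith
qed

text \<open>Two centres suffice for the star: \<open>v3\<close>, or else \<open>v2\<close>, for
  which a short walk from \<open>v2\<close> to \<open>v4\<close> rules out one from
  \<open>v1\<close> to \<open>v3\<close>. Either star leaves one of three consecutive 3-vertices
  uncovered, and any one of them can start the tour.\<close>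

lemma reducible_10:
  assumes c: "crit E" and cy: "cyc E [v1, a1, v2, a2, v3, a3, v4, a4, v5, a5]"
    and two: "degree E a1 = 2" "degree E a2 = 2" "degree E a3 = 2" "degree E a4 = 2" "degree E a5 = 2"
    and three: "degree E v2 = 3" "degree E v3 = 3"
    and X: "crosses (E - cedges [v1, a1, v2, a2, v3, a3, v4, a4, v5, a5]) v1 v3 v2 v4"
  shows False
proof -
  note cf = crit_facts[OF c]
  define C where "C = [v1, a1, v2, a2, v3, a3, v4, a4, v5, a5]"
  define F where "F = E - cedges C"
  have cyC: "cyc E C" using cy by (simp add: C_def)
  have dist: "distinct C" and KE: "cedges C \<subseteq> E" using cyC by (auto simp: cyc_def)
  have d: "distinct [v1, a1, v2, a2, v3, a3, v4, a4, v5, a5]" using dist by (simp only: C_def)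
  have K: "cedges C = {{v1, a1}, {a1, v2}, {v2, a2}, {a2, v3}, {v3, a3}, {a3, v4}, {v4, a4}, {a4, v5}, {v5, a5}, {a5, v1}}"
    by (simp add: C_def cedges_def)
  have finF: "finite F" using cf(2) by (simp add: F_def)
  have res: "degree F x + 2 = degree E x" if "x \<in> set C" for x
    unfolding F_def by (rule degree_residual[OF cf(2) cyC that])
  have deg1: "degree F x \<le> 1" if "x \<in> set C" for x using res[OF that] cf(3)[of x] by simp
  have iso: "x \<notin> \<Union>F" if "x \<in> set C" "degree E x = 2" for x
    using res[OF that(1)] that(2) degree_0_iff[OF finF, of x] by simp
  have a: "a1 \<notin> \<Union>F" "a2 \<notin> \<Union>F" "a3 \<notin> \<Union>F" "a4 \<notin> \<Union>F" "a5 \<notin> \<Union>F"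
    using iso two by (auto simp: C_def)
  have v: "degree F v1 \<le> 1" "degree F v2 \<le> 1" "degree F v3 \<le> 1" "degree F v4 \<le> 1" "degree F v5 \<le> 1"
    using deg1 by (auto simp: C_def)
  have EF: "F \<union> cedges C = E" using KE by (auto simp: F_def)
  have nodec: "\<not> dec (F \<union> cedges C)" using EF cf(6) by simp
  have extend: False if ok: "ok L M" "L \<union> M = F" and u: "v1 \<notin> \<Union>M \<or> v2 \<notin> \<Union>M \<or> v3 \<notin> \<Union>M \<or> v4 \<notin> \<Union>M" for L M
  proof -
    have r: "cedges [v2, a2, v3, a3, v4, a4, v5, a5, v1, a1] = cedges C"
      "cedges [v3, a3, v4, a4, v5, a5, v1, a1, v2, a2] = cedges C"
      "cedges [v4, a4, v5, a5, v1, a1, v2, a2, v3, a3] = cedges C"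
      unfolding K by (auto simp: cedges_def)
    consider "v1 \<notin> \<Union>M" | "v2 \<notin> \<Union>M" | "v3 \<notin> \<Union>M" | "v4 \<notin> \<Union>M" using u by metis
    then have "dec (F \<union> cedges C)"
    proof cases
      case 1
      show ?thesis unfolding C_def by (rule extend_10[OF ok finF]) (use d a v 1 in simp_all)
    next
      case 2
      show ?thesis unfolding r(1)[symmetric] by (rule extend_10[OF ok finF]) (use d a v 2 in auto)
    next
      case 3
      show ?thesis unfolding r(2)[symmetric] by (rule extend_10[OF ok finF]) (use d a v 3 in auto)
    next
      case 4
      show ?thesis unfolding r(3)[symmetric] by (rule extend_10[OF ok finF]) (use d a v 4 in auto)
    qed
    then show False using nodec by metis
  qed
  show False
  proof (cases "far F 7 v2 v4")
    case True
    then have fr: "far (F \<union> {}) 7 v2 v4" by simp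
    have "\<exists>L M. ok L M \<and> L \<union> M = F \<union> {} \<and> (v3 \<notin> \<Union>M \<or> v2 \<notin> \<Union>M \<or> v4 \<notin> \<Union>M)"
      by (rule star_step[OF c cyC F_def _ _ _ _ _ two(2,3) three(2) _ _ _ _ fr])
        (use d in \<open>auto simp: K insert_commute\<close>)
    then obtain L M where LM: "ok L M" "L \<union> M = F" "v3 \<notin> \<Union>M \<or> v2 \<notin> \<Union>M \<or> v4 \<notin> \<Union>M"
      unfolding Un_empty_right by (elim exE conjE) (rule that)
    then show False by (intro extend[OF LM(1,2)]) metis
  next
    case False
    then obtain j where j: "j < 7" "walk F j v2 v4" by (auto simp: far_def)
    have "far F 7 v1 v3"
    proof (rule crosses_far[OF cf(4) _ X[folded C_def, folded F_def] _ _ _ _ _ _ _ _ j(2,1)])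
      show "F \<subseteq> E" by (auto simp: F_def)
      show "{v1, a1} \<in> E" "{a1, v2} \<in> E" "{v3, a3} \<in> E" "{a3, v4} \<in> E" using KE K by auto
    qed (use a d in auto)
    then have fr: "far (F \<union> {}) 7 v1 v3" by simp
    have "\<exists>L M. ok L M \<and> L \<union> M = F \<union> {} \<and> (v2 \<notin> \<Union>M \<or> v1 \<notin> \<Union>M \<or> v3 \<notin> \<Union>M)"
      by (rule star_step[OF c cyC F_def _ _ _ _ _ two(1,2) three(1) _ _ _ _ fr])
        (use d in \<open>auto simp: K insert_commute\<close>)
    then obtain L M where LM: "ok L M" "L \<union> M = F" "v2 \<notin> \<Union>M \<or> v1 \<notin> \<Union>M \<or> v3 \<notin> \<Union>M"
      unfolding Un_empty_right by (elim exE conjE) (rule that)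
    then show False by (intro extend[OF LM(1,2)]) metis
  qed
qed

text \<open>The star at \<open>v3\<close> leaves one of \<open>v2\<close>, \<open>v3\<close>,
  \<open>v4\<close> uncovered, which is enough. The star at \<open>v2\<close> may only uncover
  \<open>v1\<close>, which is not enough if \<open>L\<close> connects \<open>v1\<close> with
  \<open>v5\<close>. So \<open>{v1, v5}\<close> is kept in the reduced graph: if \<open>v1\<close>
  is uncovered there, this edge lies in the acyclic \<open>L\<close>, and its removal separates its
  ends.\<close>

lemma reducible_9:
  assumes c: "crit E" and cy: "cyc E [v1, a1, v2, a2, v3, a3, v4, a4, v5]"
    and two: "degree E a1 = 2" "degree E a2 = 2" "degree E a3 = 2" "degree E a4 = 2"
    and three: "degree E v2 = 3" "degree E v3 = 3" "degree E v4 = 3"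
    and X: "crosses (E - cedges [v1, a1, v2, a2, v3, a3, v4, a4, v5]) v1 v3 v2 v4"
     "crosses (E - cedges [v1, a1, v2, a2, v3, a3, v4, a4, v5]) v3 v5 v2 v4"
  shows False
proof -
  note cf = crit_facts[OF c]
  define C where "C = [v1, a1, v2, a2, v3, a3, v4, a4, v5]"
  define F where "F = E - cedges C"
  have cyC: "cyc E C" using cy by (simp add: C_def)
  have dist: "distinct C" and KE: "cedges C \<subseteq> E" using cyC by (auto simp: cyc_def)
  have d: "distinct [v1, a1, v2, a2, v3, a3, v4, a4, v5]" using dist by (simp only: C_def)
  have K: "cedges C = {{v1, a1}, {a1, v2}, {v2, a2}, {a2, v3}, {v3, a3}, {a3, v4}, {v4, a4}, {a4, v5}, {v5, v1}}"
    by (simp add: C_def cedges_def)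
  have finF: "finite F" using cf(2) by (simp add: F_def)
  have res: "degree F x + 2 = degree E x" if "x \<in> set C" for x
    unfolding F_def by (rule degree_residual[OF cf(2) cyC that])
  have deg1: "degree F x \<le> 1" if "x \<in> set C" for x using res[OF that] cf(3)[of x] by simp
  have iso: "x \<notin> \<Union>F \<longleftrightarrow> degree E x = 2" if "x \<in> set C" for x
    unfolding res[OF that, symmetric] degree_0_iff[OF finF, symmetric] by simp
  have a: "a1 \<notin> \<Union>F" "a2 \<notin> \<Union>F" "a3 \<notin> \<Union>F" "a4 \<notin> \<Union>F"
    using iso two by (auto simp: C_def)
  have v: "degree F v1 \<le> 1" "degree F v2 \<le> 1" "degree F v3 \<le> 1" "degree F v4 \<le> 1" "degree F v5 \<le> 1"
    using deg1 by (auto simp: C_def)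
  have vF: "v2 \<in> \<Union>F" "v3 \<in> \<Union>F" "v4 \<in> \<Union>F"
    using iso[of v2] iso[of v3] iso[of v4] three by (simp_all add: C_def del: Union_iff)
  have new: "{v1, v5} \<notin> F" by (auto simp: F_def K insert_commute)
  have EF: "F \<union> cedges C = E" using KE by (auto simp: F_def)
  have nodec: "\<not> dec (F \<union> cedges C)" using EF cf(6) by simp
  have extend: False if "ok L M" "L \<union> M = F"
    "(v2 \<notin> \<Union>M \<or> v3 \<notin> \<Union>M \<or> v4 \<notin> \<Union>M) \<or> v1 \<notin> \<Union>M \<and> (v5 \<in> \<Union>M \<or> \<not> conn L v1 v5)" for L M
    using extend_9[OF that(1,2) finF d a v vF new that(3)] nodec unfolding C_def by metis
  have FE: "F \<subseteq> E" by (auto simp: F_def)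
  have kE: "{v1, a1} \<in> E" "{a1, v2} \<in> E" "{v3, a3} \<in> E" "{a3, v4} \<in> E" "{v3, a2} \<in> E" "{a2, v2} \<in> E"
    "{v5, a4} \<in> E" "{a4, v4} \<in> E" using KE unfolding K by (auto simp: insert_commute)
  have ne: "v1 \<noteq> v2" "v3 \<noteq> v4" "v3 \<noteq> v2" "v5 \<noteq> v4" using d by auto
  show False
  proof (cases "far F 7 v2 v4")
    case True
    then have fr: "far (F \<union> {}) 7 v2 v4" by simp
    have "\<exists>L M. ok L M \<and> L \<union> M = F \<union> {} \<and> (v3 \<notin> \<Union>M \<or> v2 \<notin> \<Union>M \<or> v4 \<notin> \<Union>M)"
      by (rule star_step[OF c cyC F_def _ _ _ _ _ two(2,3) three(2) _ _ _ _ fr])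
        (use d in \<open>auto simp: K insert_commute\<close>)
    then obtain L M where LM: "ok L M" "L \<union> M = F" "v3 \<notin> \<Union>M \<or> v2 \<notin> \<Union>M \<or> v4 \<notin> \<Union>M"
      unfolding Un_empty_right by (elim exE conjE) (rule that)
    then show False by (intro extend[OF LM(1,2)]) metis
  next
    case False
    then obtain j where j: "j < 7" "walk F j v2 v4" by (auto simp: far_def)
    have f13: "far F 7 v1 v3"
      by (rule crosses_far[OF cf(4) FE X(1)[folded C_def, folded F_def] kE(1,2) ne(1) a(1) kE(3,4) ne(2) a(3) j(2,1)])
    have f35: "far F 7 v3 v5"
      by (rule crosses_far[OF cf(4) FE X(2)[folded C_def, folded F_def] kE(5,6) ne(3) a(2) kE(7,8) ne(4) a(4) j(2,1)])
    \<comment> \<open>A new short walk would pass through \<open>{v1, v5}\<close> and contain a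
      short walk from \<open>v5\<close> to \<open>v3\<close>. The second crossing hypothesis
      excludes it.\<close>
    have "far (insert {v1, v5} F) 7 v1 v3"
    proof (rule far_insert[OF f13])
      fix i j assume "i + j + 1 < (7::nat)" and j: "walk F j v5 v3"
      then show False by (intro farD[OF far_sym[OF f35] j]) simp
    next
      fix i j assume "i + j + 1 < (7::nat)" and j: "walk F j v1 v3"
      then show False by (intro farD[OF f13 j]) simp
    qed
    then have fr: "far (F \<union> {{v5, v1}}) 7 v1 v3" by (simp add: insert_commute)
    have "\<exists>L M. ok L M \<and> L \<union> M = F \<union> {{v5, v1}} \<and> (v2 \<notin> \<Union>M \<or> v1 \<notin> \<Union>M \<or> v3 \<notin> \<Union>M)"
      by (rule star_step[OF c cyC F_def _ _ _ _ _ two(1,2) three(1) _ _ _ _ fr])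
        (use d in \<open>auto simp: K insert_commute\<close>)
    then obtain L M where LM: "ok L M" "L \<union> M = F \<union> {{v5, v1}}" "v2 \<notin> \<Union>M \<or> v1 \<notin> \<Union>M \<or> v3 \<notin> \<Union>M"
      by (elim exE conjE) (rule that)
    have ok': "ok (L \<inter> F) (M \<inter> F)" by (rule ok_subset[OF LM(1)]) auto
    have LM': "L \<inter> F \<union> M \<inter> F = F" using LM(2) by auto
    show False
    proof (cases "v1 \<in> \<Union>M")
      case True
      then have "v2 \<notin> \<Union>(M \<inter> F) \<or> v3 \<notin> \<Union>(M \<inter> F)" using LM(3) by auto
      then show False by (intro extend[OF ok' LM']) metis
    next
      case False
      then have "{v1, v5} \<in> L" using LM(2) by (auto simp: insert_commute)
      moreover have "acyc L" using LM(1) by (simp add: ok_def)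
      ultimately have "\<not> conn (L - {{v1, v5}}) v1 v5" by (simp add: acyc_def)
      moreover have "L \<inter> F \<subseteq> L - {{v1, v5}}" using new by auto
      ultimately have "\<not> conn (L \<inter> F) v1 v5" using conn_mono[of "L \<inter> F" "L - {{v1, v5}}" v1 v5] by metis
      moreover have "v1 \<notin> \<Union>(M \<inter> F)" using False by auto
      ultimately show False by (intro extend[OF ok' LM']) metis
    qed
  qed
qed

section \<open>Crossing ears\<close>

text \<open>The first ear splits the inside of the cycle. A path that starts in \<open>as\<close>,
  runs inside and avoids this ear stays on \<open>as\<close> and inside the new cycle through
  \<open>as\<close>, so it never arrives in \<open>bs\<close>.\<close>

lemma ears_meet:
  assumes d: "drawing E p S" and es: "edgeset E" and cy: "cyc E (x # as @ y # bs)"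
    and K: "K = cedges (x # as @ y # bs)"
    and Q: "distinct (x # zs @ [y])" "set zs \<inter> set (x # as @ y # bs) = {}" "pedges (x # zs @ [y]) \<subseteq> insE E p S K"
    and u: "u \<in> set as" and v: "v \<in> set bs" and ws: "set ws \<inter> set (x # as @ y # bs) = {}" "set ws \<inter> set zs = {}"
    and R: "pedges (u # ws @ [v]) \<subseteq> insE E p S K"
  shows False
proof -
  define K1 where "K1 = pedges (x # as @ [y])"
  define K2 where "K2 = pedges (y # bs @ [x])"
  define KQ where "KQ = pedges (x # zs @ [y])"
  have dist: "distinct (x # as @ y # bs)" and KE: "K \<subseteq> E" using cy K by (auto simp: cyc_def)
  have KK: "K = K1 \<union> K2" unfolding K K1_def K2_def by (rule cedges_split)
  have Qi: "KQ \<subseteq> insE E p S K" using Q(3) KQ_def by simp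
  have QE: "KQ \<subseteq> E - K" using Qi insE_sub by (rule order_trans)
  have sub: "K1 \<subseteq> E" "K2 \<subseteq> E" "KQ \<subseteq> E" using KK KE QE by auto
  have dj: "K1 \<inter> K2 = {}" "K1 \<inter> KQ = {}" "K2 \<inter> KQ = {}"
  proof -
    have "as \<noteq> []" using u by auto
    then show "K1 \<inter> K2 = {}" unfolding K1_def K2_def using dist by (intro pedges_disjoint) auto
    show "K1 \<inter> KQ = {}" "K2 \<inter> KQ = {}" using QE KK by auto
  qed
  have zsd: "set zs \<inter> (set as \<union> set bs) = {}" using Q(2) by auto
  obtain e0 where e0: "e0 \<in> KQ" unfolding KQ_def by (cases zs) auto
  have e0': "e0 \<in> insE E p S (K1 \<union> K2)" using Qi e0 KK by auto
  note sp = split_sides[OF d es dist Q(1) zsd K1_def K2_def KQ_def sub dj e0 e0']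
  have s1: "K1 \<union> KQ \<subseteq> E" "K2 \<union> KQ \<subseteq> E" using sub by auto
  have "\<Union>K1 = set (x # as @ [y])" "\<Union>K2 = set (y # bs @ [x])" "\<Union>KQ = set (x # zs @ [y])"
    unfolding K1_def K2_def KQ_def by (rule Union_pedges; simp)+
  then have U: "\<Union>(K1 \<union> KQ) = {x, y} \<union> set as \<union> set zs" "\<Union>(K2 \<union> KQ) = {x, y} \<union> set bs \<union> set zs"
    unfolding Union_Un_distrib by auto
  have UK: "\<Union>K = {x, y} \<union> set as \<union> set bs" unfolding K Union_cedges[OF cy] by auto
  let ?V = "insV E p S K" and ?V1 = "insV E p S (K1 \<union> KQ)" and ?V2 = "insV E p S (K2 \<union> KQ)"
  have V: "?V = ?V1 \<union> ?V2 \<union> set zs" using sp(3) KK by simp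
  have VK: "?V \<inter> \<Union>K = {}" by (rule insV_disjoint[OF d KE])
  \<comment> \<open>One step of the path: its edge neither belongs to the ear nor lies inside the
    other new cycle, since \<open>s\<close> is on neither and not inside the latter.\<close>
  have step: "t \<in> set as \<union> ?V1" if st: "{s, t} \<in> insE E p S K" and s: "s \<in> set as \<union> ?V1"
    and t: "t \<notin> {x, y} \<union> set zs" for s t
  proof -
    have sV2: "s \<notin> ?V2" using s sp(4) V VK UK by auto
    have s2: "s \<notin> {x, y} \<union> set bs \<union> set zs"
      using s dist zsd V VK UK sp(5) by auto
    have "{s, t} \<notin> KQ"
    proof
      assume "{s, t} \<in> KQ"
      then have "s \<in> \<Union>(K2 \<union> KQ)" by auto
      then show False using s2 U(2) by auto
    qed
    moreover have "{s, t} \<notin> insE E p S (K2 \<union> KQ)"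
    proof
      assume "{s, t} \<in> insE E p S (K2 \<union> KQ)"
      then have "s \<in> \<Union>(K2 \<union> KQ) \<or> s \<in> ?V2" by (rule insE_endpoint[OF d es s1(2)]) simp
      then show False using s2 sV2 U(2) by auto
    qed
    ultimately have "{s, t} \<in> insE E p S (K1 \<union> KQ)" using st sp(1) KK by auto
    then have "t \<in> \<Union>(K1 \<union> KQ) \<or> t \<in> ?V1" by (rule insE_endpoint[OF d es s1(1)]) simp
    then show ?thesis using t U(1) by auto
  qed
  have all: "set us \<subseteq> set as \<union> ?V1"
    if "us \<noteq> []" "pedges us \<subseteq> insE E p S K" "set us \<inter> ({x, y} \<union> set zs) = {}" "hd us \<in> set as \<union> ?V1" for us
    using that
  proof (induction us rule: pedges.induct)
    case (1 s t us)
    have "t \<in> set as \<union> ?V1" using step[of s t] 1(3,4,5) by auto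
    then show ?case using 1 by auto
  qed auto
  have "set (u # ws @ [v]) \<subseteq> set as \<union> ?V1"
  proof (rule all[OF _ R])
    show "set (u # ws @ [v]) \<inter> ({x, y} \<union> set zs) = {}" using ws u v dist zsd by auto
  qed (use u in auto)
  then have "v \<in> set as \<union> ?V1" by auto
  then show False using v dist V VK UK by auto
qed

text \<open>A vertex of \<open>C\<close> has at most one edge in \<open>F\<close>, so a path in
  \<open>F\<close> cannot pass through it.\<close>

lemma ear_of_walk:
  assumes w: "walk F i s t" and ne: "s \<noteq> t" and fin: "finite F"
    and leaf: "\<And>z. z \<in> C \<Longrightarrow> degree F z \<le> 1"
  obtains zs where "distinct (s # zs @ [t])" "pedges (s # zs @ [t]) \<subseteq> F" "set zs \<inter> C = {}" "length zs + 1 \<le> i"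
proof -
  obtain xs where xs: "distinct xs" "xs \<noteq> []" "hd xs = s" "last xs = t" "pedges xs \<subseteq> F" "length xs \<le> Suc i"
    using walk_imp_path[OF w] .
  obtain xs' where xs': "xs = s # xs'" using xs(2,3) by (cases xs) auto
  then have "xs' \<noteq> []" using xs(4) ne by auto
  then obtain zs where zs: "xs' = zs @ [t]" using xs(4) xs' by (cases xs' rule: rev_cases) auto
  have eq: "xs = s # zs @ [t]" using xs' zs by simp
  have "z \<notin> C" if z: "z \<in> set zs" for z
  proof
    assume zC: "z \<in> C"
    obtain as bs where ab: "zs = as @ z # bs" using z by (meson split_list)
    have sp: "xs = (s # as) @ z # (bs @ [t])" using eq ab by simp
    have "{z, last (s # as)} \<in> F" "{z, hd (bs @ [t])} \<in> F"
      using pedges_neighbours[OF sp] xs(5) by (auto simp: insert_commute)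
    then have "card {last (s # as), hd (bs @ [t])} \<le> degree F z"
      by (intro card_nbrs_le_degree[OF fin]) auto
    moreover have "last (s # as) \<noteq> hd (bs @ [t])"
    proof
      assume "last (s # as) = hd (bs @ [t])"
      moreover have "last (s # as) \<in> set (s # as)" by (rule last_in_set) simp
      moreover have "hd (bs @ [t]) \<in> set (bs @ [t])" by (rule hd_in_set) simp
      moreover have "set (s # as) \<inter> set (bs @ [t]) = {}" using xs(1) sp by auto
      ultimately show False by auto
    qed
    ultimately show False using leaf[OF zC] by simp
  qed
  then show thesis using that[of zs] xs eq by auto
qed

lemma crosses_sym: "crosses F s t s' t' \<Longrightarrow> crosses F s t t' s'"
  unfolding crosses_def using walk_sym by (metis add.commute)

text \<open>Both walks contain ears, which lie on the same side and alternate, so by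
  \<open>ears_meet\<close> they share a vertex. This vertex cuts each ear into the two required
  pieces.\<close>

lemma crosses_ears:
  assumes d: "drawing E p S" and es: "edgeset E" and cy: "cyc E (x # as @ y # bs)"
    and K: "K = cedges (x # as @ y # bs)"
    and leaf: "\<And>z. z \<in> set (x # as @ y # bs) \<Longrightarrow> degree (E - K) z \<le> 1"
    and ear: "\<And>s t zs. s \<in> set (x # as @ y # bs) \<Longrightarrow> t \<in> set (x # as @ y # bs) \<Longrightarrow> distinct (s # zs @ [t]) \<Longrightarrow>
       pedges (s # zs @ [t]) \<subseteq> E - K \<Longrightarrow> pedges (s # zs @ [t]) \<subseteq> insE E p S K"
    and u: "u \<in> set as" and v: "v \<in> set bs"
  shows "crosses (E - K) x y u v"
  unfolding crosses_def
proof (intro allI impI)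
  fix i j assume i: "walk (E - K) i x y" and j: "walk (E - K) j u v"
  have fin: "finite (E - K)" using es by (simp add: edgeset_def)
  have dist: "distinct (x # as @ y # bs)" using cy by (simp add: cyc_def)
  have ne: "x \<noteq> y" "u \<noteq> v" using dist u v by auto
  obtain zs where zs: "distinct (x # zs @ [y])" "pedges (x # zs @ [y]) \<subseteq> E - K"
    "set zs \<inter> set (x # as @ y # bs) = {}" "length zs + 1 \<le> i"
    using ear_of_walk[OF i ne(1) fin leaf] by blast
  obtain ws where ws: "distinct (u # ws @ [v])" "pedges (u # ws @ [v]) \<subseteq> E - K"
    "set ws \<inter> set (x # as @ y # bs) = {}" "length ws + 1 \<le> j"
    using ear_of_walk[OF j ne(2) fin leaf] by blast
  have "pedges (x # zs @ [y]) \<subseteq> insE E p S K" "pedges (u # ws @ [v]) \<subseteq> insE E p S K"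
    using ear[OF _ _ zs(1,2)] ear[OF _ _ ws(1,2)] u v by auto
  then have "set ws \<inter> set zs \<noteq> {}" using ears_meet[OF d es cy K zs(1,3) _ u v ws(3)] by blast
  then obtain z where z: "z \<in> set zs" "z \<in> set ws" by auto
  have W: "\<exists>i1 i2. walk (E - K) i1 s z \<and> walk (E - K) i2 t z \<and> i1 + i2 = length qs + 1"
    if q: "z \<in> set qs" "pedges (s # qs @ [t]) \<subseteq> E - K" for s t qs
  proof -
    obtain as bs where ab: "qs = as @ z # bs" using q(1) by (meson split_list)
    have p: "pedges (s # as @ [z]) \<subseteq> E - K" "pedges (z # bs @ [t]) \<subseteq> E - K"
      using q(2) ab pedges_append[of "s # as" z "bs @ [t]"] by auto
    have "walk (E - K) (length as + 1) s z" "walk (E - K) (length bs + 1) z t"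
      using walk_pedges[OF _ p(1)] walk_pedges[OF _ p(2)] by (simp_all del: walk.simps)
    then have "walk (E - K) (length as + 1) s z \<and> walk (E - K) (length bs + 1) t z \<and> (length as + 1) + (length bs + 1) = length qs + 1"
      using walk_sym[of "E - K" "length bs + 1" z t] ab by (simp del: walk.simps)
    then show ?thesis by blast
  qed
  obtain i1 i2 where I: "walk (E - K) i1 x z" "walk (E - K) i2 y z" "i1 + i2 = length zs + 1" using W[OF z(1) zs(2)] by blast
  obtain j1 j2 where J: "walk (E - K) j1 u z" "walk (E - K) j2 v z" "j1 + j2 = length ws + 1" using W[OF z(2) ws(2)] by blast
  have "walk (E - K) i1 x z \<and> walk (E - K) i2 y z \<and> walk (E - K) j1 u z \<and> walk (E - K) j2 v z \<and> i1 + i2 \<le> i \<and> j1 + j2 \<le> j"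
    using I J zs(4) ws(4) by simp
  then show "\<exists>p i1 i2 j1 j2. walk (E - K) i1 x p \<and> walk (E - K) i2 y p \<and> walk (E - K) j1 u p \<and> walk (E - K) j2 v p \<and> i1 + i2 \<le> i \<and> j1 + j2 \<le> j"
    by (intro exI)
qed

section \<open>Parts without bridges\<close>

definition cut :: "'a set set \<Rightarrow> 'a set \<Rightarrow> 'a set set" where
  "cut E A = {e \<in> E. e \<inter> A \<noteq> {} \<and> \<not> e \<subseteq> A}"

definition inner_edges :: "'a set set \<Rightarrow> 'a set \<Rightarrow> 'a set set" where
  "inner_edges E A = {e \<in> E. e \<subseteq> A}"

text \<open>A minimal vertex set with at most one outgoing edge, i.e. an end part behind at most one
  bridge. The condition on proper subsets replaces 2-edge-connectedness.\<close>

definition part :: "'a set set \<Rightarrow> 'a set \<Rightarrow> bool" where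
  "part E A \<longleftrightarrow> A \<noteq> {} \<and> A \<subseteq> \<Union>E \<and> card (cut E A) \<le> 1 \<and> (\<forall>B. B \<subset> A \<longrightarrow> B \<noteq> {} \<longrightarrow> card (cut E B) \<ge> 2)"

lemma partD: "part E A \<Longrightarrow> A \<noteq> {}" "part E A \<Longrightarrow> A \<subseteq> \<Union>E" "part E A \<Longrightarrow> card (cut E A) \<le> 1"
  by (simp_all add: part_def)

lemma part_exists:
  assumes es: "edgeset E" and ne: "E \<noteq> {}" obtains A where "part E A"
proof -
  have finV: "finite (\<Union>E)" using es by (auto simp: edgeset_def)
  let ?P = "\<lambda>A. A \<noteq> {} \<and> A \<subseteq> \<Union>E \<and> card (cut E A) \<le> 1"
  have "cut E (\<Union>E) = {}" by (auto simp: cut_def)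
  moreover have "\<Union>E \<noteq> {}" using es ne unfolding edgeset_def by fastforce
  ultimately have "?P (\<Union>E)" by simp
  then obtain A where A: "?P A" "\<And>B. ?P B \<Longrightarrow> card A \<le> card B"
    using ex_has_least_nat[of ?P "\<Union>E" card] by auto
  have "card (cut E B) \<ge> 2" if B: "B \<subset> A" "B \<noteq> {}" for B
  proof (rule ccontr)
    assume "\<not> card (cut E B) \<ge> 2"
    then have "?P B" using A(1) B by auto
    then have "card A \<le> card B" by (rule A(2))
    moreover have "finite A" using A(1) finV finite_subset by auto
    then have "card B < card A" using B(1) by (rule psubset_card_mono)
    ultimately show False by simp
  qed
  then show thesis using that[of A] A(1) by (simp add: part_def)
qed

text \<open>The bridge leaving \<open>A\<close>, if there is one, has a single end in
  \<open>A\<close>, which lies in \<open>T\<close> or in \<open>A - T\<close>. For the other of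
  these two sets, every outgoing edge stays within \<open>A\<close> and separates \<open>T\<close>
  from \<open>A - T\<close>.\<close>

lemma part_inner_cut:
  assumes es: "edgeset E" and A: "part E A" and T: "T \<subset> A" "T \<noteq> {}"
  shows "card {e \<in> inner_edges E A. e \<inter> T \<noteq> {} \<and> \<not> e \<subseteq> T} \<ge> 2"
proof -
  let ?B = "{e \<in> inner_edges E A. e \<inter> T \<noteq> {} \<and> \<not> e \<subseteq> T}"
  have fin: "finite E" using es by (simp add: edgeset_def)
  have finB: "finite ?B" using fin by (simp add: inner_edges_def)
  have c1: "card (cut E A) \<le> 1" and c2: "\<And>B. B \<subset> A \<Longrightarrow> B \<noteq> {} \<Longrightarrow> card (cut E B) \<ge> 2"
    using A by (auto simp: part_def)
  have finc: "finite (cut E A)" using fin by (simp add: cut_def)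
  have "cut E T \<subseteq> ?B \<or> cut E (A - T) \<subseteq> ?B"
  proof (rule ccontr)
    assume "\<not> ?thesis"
    then obtain e f where e: "e \<in> cut E T" "e \<notin> ?B" and f: "f \<in> cut E (A - T)" "f \<notin> ?B" by blast
    have eA: "e \<in> cut E A" "e \<inter> T \<noteq> {}" using e T(1) by (auto simp: cut_def inner_edges_def)
    have fA: "f \<in> cut E A" "f \<inter> (A - T) \<noteq> {}" using f T(1) by (auto simp: cut_def inner_edges_def)
    have ef: "e = f"
    proof (rule ccontr)
      assume "e \<noteq> f"
      then have "card {e, f} = 2" by simp
      moreover have "card {e, f} \<le> card (cut E A)" using eA fA finc by (intro card_mono) auto
      ultimately show False using c1 by simp
    qed
    have "e \<in> E" using eA(1) by (simp add: cut_def)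
    then obtain u v where "e = {u, v}" using es unfolding edgeset_def by metis
    then show False using eA fA(2) T(1) ef by (auto simp: cut_def)
  qed
  then show ?thesis
  proof
    assume "cut E T \<subseteq> ?B"
    then have "card (cut E T) \<le> card ?B" using finB by (intro card_mono)
    then show ?thesis using c2[OF T] by simp
  next
    assume "cut E (A - T) \<subseteq> ?B"
    then have "card (cut E (A - T)) \<le> card ?B" using finB by (intro card_mono)
    moreover have "card (cut E (A - T)) \<ge> 2" using T by (intro c2) auto
    ultimately show ?thesis by simp
  qed
qed

lemma two_members:
  assumes "card X \<ge> 2" obtains f where "f \<in> X" "f \<noteq> e"
proof -
  have "X \<noteq> {}" "X \<noteq> {e}" using assms by auto
  then show thesis using that by blast
qed

text \<open>A path that leaves \<open>A\<close> has to return. The first edge out and the first edge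
  back in are different, but at most one edge leaves \<open>A\<close>.\<close>

lemma path_in_part:
  assumes es: "edgeset E" and A: "card (cut E A) \<le> 1" and xs: "distinct xs" "xs \<noteq> []" "pedges xs \<subseteq> E"
    and ends: "hd xs \<in> A" "last xs \<in> A"
  shows "set xs \<subseteq> A"
proof (rule ccontr)
  assume "\<not> set xs \<subseteq> A"
  then have "\<exists>q\<in>set xs. q \<notin> A" by auto
  from split_list_first_prop[OF this] obtain as q bs where 1: "xs = as @ q # bs" "q \<notin> A" "\<forall>y\<in>set as. y \<in> A"
    by auto
  have as: "as \<noteq> []" using 1 ends(1) by auto
  have "last (q # bs) \<in> A" using ends(2) 1(1) by (metis last_appendR list.distinct(1))
  then have "bs \<noteq> []" "last bs \<in> A" using 1(2) by (auto split: if_splits)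
  then have "\<exists>r\<in>set bs. r \<in> A" by (meson last_in_set)
  from split_list_first_prop[OF this] obtain cs r ds where 2: "bs = cs @ r # ds" "r \<in> A" "\<forall>y\<in>set cs. y \<notin> A"
    by auto
  have sp: "xs = (as @ q # cs) @ r # ds" using 1 2 by simp
  let ?e = "{last as, q}" and ?f = "{last (as @ q # cs), r}"
  have e: "?e \<in> E" using pedges_neighbours(1)[OF 1(1) as] xs(3) by auto
  have f: "?f \<in> E" using pedges_neighbours(1)[OF sp] xs(3) by auto
  have l: "last (as @ q # cs) \<in> set (q # cs)" "last as \<in> set as" using as last_in_set[of "q # cs"] last_in_set[OF as] by auto
  then have lA: "last (as @ q # cs) \<notin> A" "last as \<in> A" using 1 2 by auto
  have "?e \<in> cut E A" "?f \<in> cut E A" using e f lA 1(2) 2(2) by (auto simp: cut_def)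
  moreover have "r \<noteq> last as" "r \<noteq> q" using xs(1) sp l(2) by auto
  then have "?e \<noteq> ?f" by auto
  moreover have "finite (cut E A)" using es by (simp add: cut_def edgeset_def)
  ultimately have "card {?e, ?f} \<le> card (cut E A)" by (intro card_mono) auto
  then show False using A \<open>?e \<noteq> ?f\<close> by simp
qed

text \<open>No inner edge is a bridge: the vertices reachable from one of its ends without it would
  have this edge as their only inner way out. An inner edge exists, because a single vertex already
  has two outgoing edges.\<close>

lemma part_cycle:
  assumes es: "edgeset E" and A: "part E A" and d2: "\<And>v. v \<in> \<Union>E \<Longrightarrow> degree E v \<ge> 2"
  obtains C where "cyc (inner_edges E A) C"
proof -
  obtain v where v: "v \<in> A" "v \<in> \<Union>E" using partD(1,2)[OF A] by (metis ex_in_conv subsetD)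
  have "A \<noteq> {v}"
  proof
    assume Av: "A = {v}"
    have "\<not> e \<subseteq> {v}" if "e \<in> E" for e
      using es that unfolding edgeset_def by (metis insert_subset singletonD)
    then have "cut E A = {e \<in> E. v \<in> e}" unfolding Av cut_def by auto
    then have "card (cut E A) = degree E v" by (simp add: degree_def)
    then show False using d2[OF v(2)] partD(3)[OF A] by simp
  qed
  then have "{v} \<subset> A" using v by auto
  then have c2: "card {e \<in> inner_edges E A. e \<inter> {v} \<noteq> {} \<and> \<not> e \<subseteq> {v}} \<ge> 2" by (rule part_inner_cut[OF es A]) simp
  obtain e where "e \<in> {e \<in> inner_edges E A. e \<inter> {v} \<noteq> {} \<and> \<not> e \<subseteq> {v}}" using two_members[OF c2, of "{}"] .
  then have e: "e \<in> inner_edges E A" "v \<in> e" by auto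
  have "e \<in> E" using e(1) by (simp add: inner_edges_def)
  then obtain u where u: "e = {v, u}" "u \<noteq> v" using edge_nbr[OF es _ e(2)] by metis
  let ?F = "inner_edges E A - {{v, u}}"
  have "conn ?F v u"
  proof (rule ccontr)
    assume n: "\<not> conn ?F v u"
    let ?T = "{w \<in> A. conn ?F v w}"
    have uA: "u \<in> A" using e u by (auto simp: inner_edges_def)
    have T: "?T \<subset> A" "?T \<noteq> {}" using v uA n by auto
    obtain f where f0: "f \<in> {e \<in> inner_edges E A. e \<inter> ?T \<noteq> {} \<and> \<not> e \<subseteq> ?T}" "f \<noteq> {v, u}"
      using two_members[OF part_inner_cut[OF es A T], of "{v, u}"] .
    then have f: "f \<in> inner_edges E A" "f \<inter> ?T \<noteq> {}" "\<not> f \<subseteq> ?T" "f \<noteq> {v, u}" by auto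
    obtain s where s: "s \<in> f" "s \<in> ?T" using f(2) by auto
    have fE: "f \<in> E" using f(1) by (simp add: inner_edges_def)
    obtain t where t: "f = {s, t}" using edge_nbr[OF es fE s(1)] by metis
    have "conn ?F s t" using f t by (intro conn_edge) auto
    moreover have "conn ?F v s" using s(2) by simp
    ultimately have "conn ?F v t" using conn_trans by metis
    moreover have "t \<in> A" using f(1) t by (auto simp: inner_edges_def)
    ultimately show False using f(3) s(2) t by auto
  qed
  then obtain n where "walk ?F n v u" by (auto simp: conn_def)
  then show thesis using path_of_short_walk[of v u "inner_edges E A" n] u e that by metis
qed

text \<open>The ear runs through \<open>T\<close>, the inner vertices of \<open>A\<close> that are
  reachable inside the cycle from the end of \<open>e\<close>. At least two inner edges leave
  \<open>T\<close>, hence one other than \<open>e\<close>. It leads to the cycle, and not back to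
  \<open>x\<close>, since \<open>x\<close> has only one edge off the cycle.\<close>

lemma find_ear:
  assumes es: "edgeset E" and d: "drawing E p S" and A: "part E A" and cy: "cyc (inner_edges E A) C"
    and K: "K = cedges C" and leaf: "\<And>z. z \<in> set C \<Longrightarrow> degree (E - K) z \<le> 1"
    and e: "e \<in> inner_edges E A" "e \<in> insE E p S K" "x \<in> e" "x \<in> set C"
  obtains y zs where "y \<in> set C" "y \<noteq> x" "distinct (x # zs @ [y])" "set zs \<inter> set C = {}"
    "pedges (x # zs @ [y]) \<subseteq> inner_edges E A" "pedges (x # zs @ [y]) \<subseteq> insE E p S K"
proof -
  let ?V = "insV E p S K"
  have iE: "inner_edges E A \<subseteq> E" by (auto simp: inner_edges_def)
  have cyE: "cyc E C" using cy iE by (auto simp: cyc_def)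
  have KE: "K \<subseteq> E" using cyE K by (simp add: cyc_def)
  have UK: "\<Union>K = set C" using Union_cedges[OF cyE] K by simp
  have VC: "?V \<inter> set C = {}" using insV_disjoint[OF d KE] UK by simp
  have finEK: "finite (E - K)" using es by (simp add: edgeset_def)
  have "e \<in> E" using e(1) iE by auto
  then obtain z where z: "e = {x, z}" "z \<noteq> x" using edge_nbr[OF es _ e(3)] by metis
  have "z \<in> \<Union>K \<or> z \<in> ?V" by (rule insE_endpoint[OF d es KE e(2)]) (simp add: z)
  then consider "z \<in> set C" | "z \<in> ?V" using UK by auto
  then show thesis
  proof cases
    case 1
    show thesis by (rule that[of z "[]"]) (use 1 z e in auto)
  next
    case 2
    define I where "I = {f \<in> inner_edges E A. f \<subseteq> ?V}"
    define T where "T = {u \<in> A \<inter> ?V. conn I z u}"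
    have zA: "z \<in> A" "x \<in> A" using e(1) z by (auto simp: inner_edges_def)
    have zT: "z \<in> T" using zA 2 by (simp add: T_def)
    have xT: "x \<notin> T" using VC e(4) by (auto simp: T_def)
    have TA: "T \<subset> A" using zA xT by (auto simp: T_def)
    have "T \<noteq> {}" using zT by auto
    then have c2: "card {e \<in> inner_edges E A. e \<inter> T \<noteq> {} \<and> \<not> e \<subseteq> T} \<ge> 2" by (rule part_inner_cut[OF es A TA])
    obtain f where f0: "f \<in> {e \<in> inner_edges E A. e \<inter> T \<noteq> {} \<and> \<not> e \<subseteq> T}" "f \<noteq> e"
      using two_members[OF c2, of e] .
    then have f: "f \<in> inner_edges E A" "f \<inter> T \<noteq> {}" "\<not> f \<subseteq> T" "f \<noteq> e" by auto
    obtain s where s: "s \<in> f" "s \<in> T" using f(2) by auto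
    have fE: "f \<in> E" using f(1) iE by auto
    obtain y where y: "f = {s, y}" using edge_nbr[OF es fE s(1)] by metis
    have sV: "s \<in> ?V" "conn I z s" using s(2) by (auto simp: T_def)
    have fi: "f \<in> insE E p S K" by (rule insE_of_insV[OF d es KE sV(1) fE s(1)])
    have yT: "y \<notin> T" using f(3) y s(2) by auto
    have "y \<notin> ?V"
    proof
      assume yV: "y \<in> ?V"
      then have "f \<in> I" using f(1) y sV(1) by (auto simp: I_def)
      then have "conn I s y" using y by (intro conn_edge) simp
      then have "conn I z y" using sV(2) conn_trans by metis
      moreover have "y \<in> A" using f(1) y by (auto simp: inner_edges_def)
      ultimately show False using yT yV by (simp add: T_def)
    qed
    moreover have "y \<in> \<Union>K \<or> y \<in> ?V" by (rule insE_endpoint[OF d es KE fi]) (simp add: y)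
    ultimately have yC: "y \<in> set C" using UK by simp
    have yx: "y \<noteq> x"
    proof
      assume "y = x"
      have "e \<in> E - K" "f \<in> E - K" using e(2) fi subsetD[OF insE_sub] by metis+
      then have "card {e, f} \<le> degree (E - K) x" using e(3) y \<open>y = x\<close> by (intro card_le_degree[OF finEK]) auto
      then show False using leaf[OF e(4)] f(4) by simp
    qed
    obtain P where P: "distinct P" "P \<noteq> []" "hd P = z" "last P = s" "pedges P \<subseteq> I"
      using conn_imp_path[OF sV(2)] .
    have PV: "set P \<subseteq> ?V"
    proof (cases "length P \<ge> 2")
      case True
      then show ?thesis using Union_pedges[OF True] P(5) by (auto simp: I_def)
    next
      case False
      then have "P = [z]" using P(2,3) by (cases P; cases "tl P") auto
      then show ?thesis using 2 by simp
    qed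
    have "pedges (x # P @ [y]) = insert e (pedges P \<union> {f})"
    proof -
      have "pedges (x # P @ [y]) = insert {x, z} (pedges (P @ [y]))" using P(2,3) by (cases P) auto
      moreover have "pedges (P @ [y]) = pedges P \<union> {{s, y}}"
        using pedges_snoc[OF P(2), of y] P(4) by simp
      ultimately show ?thesis using z(1) y by simp
    qed
    moreover have "I \<subseteq> insE E p S K"
    proof
      fix g assume g: "g \<in> I"
      then have gE: "g \<in> E" "g \<subseteq> ?V" using iE by (auto simp: I_def)
      obtain a b where "g = {a, b}" using gE(1) es unfolding edgeset_def by metis
      then show "g \<in> insE E p S K" using insE_of_insV[OF d es KE _ gE(1), of a] gE(2) by auto
    qed
    moreover have "I \<subseteq> inner_edges E A" by (auto simp: I_def)
    ultimately have "pedges (x # P @ [y]) \<subseteq> inner_edges E A" "pedges (x # P @ [y]) \<subseteq> insE E p S K"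
      using P(5) e(1,2) f(1) fi by auto
    moreover have PC: "set P \<inter> set C = {}" using PV VC by auto
    moreover have "distinct (x # P @ [y])" using P(1) PC e(4) yC yx by auto
    ultimately show thesis using that[OF yC yx, of P] by metis
  qed
qed

section \<open>Discharging inside a cycle\<close>

text \<open>When an ear splits a cycle into two, the total weights of the two add up to that of the old
  cycle plus 6, so that ``total weight at least 6'' is inherited from cycles without inward edges.
  A bridge end inside the cycle has weight 2, since an ear through it makes it a vertex of weight 1
  on both new cycles.\<close>

definition inward :: "'a set set \<Rightarrow> 'a set set \<Rightarrow> 'a \<Rightarrow> bool" where
  "inward B I v \<longleftrightarrow> (\<exists>e \<in> B \<inter> I. v \<in> e)"

definition weight :: "'a set set \<Rightarrow> 'a set set \<Rightarrow> 'a set \<Rightarrow> 'a set \<Rightarrow> 'a set set \<Rightarrow> 'a set \<Rightarrow> 'a \<Rightarrow> int" where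
  "weight E B X U I V v = (if v \<in> U then (if degree E v = 3 then (if inward B I v then - 1 else 1) else 0)
     else if v \<in> V \<and> v \<in> X then 2 else 0)"

abbreviation cweight where
  "cweight E B X p S C \<equiv> weight E B X (set C) (insE E p S (cedges C)) (insV E p S (cedges C))"

definition bridge_ends :: "'a set set \<Rightarrow> 'a set \<Rightarrow> 'a set" where
  "bridge_ends E A = {v \<in> A. \<exists>e \<in> cut E A. v \<in> e}"

lemma weight_le_1: "v \<in> U \<Longrightarrow> weight E B X U I V v \<le> 1"
  by (simp add: weight_def)

lemma inner_edge:
  assumes "e \<in> E" "v \<in> e" "v \<in> A" "v \<notin> bridge_ends E A" shows "e \<in> inner_edges E A"
  using assms by (auto simp: bridge_ends_def inner_edges_def cut_def)

lemma third_edge: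
  assumes "finite E" "cyc E C" "v \<in> set C" "degree E v = 3"
  obtains g where "g \<in> E" "g \<notin> cedges C" "v \<in> g"
proof -
  have "degree (E - cedges C) v = 1" using degree_residual[OF assms(1-3)] assms(4) by simp
  then have "v \<in> \<Union>(E - cedges C)" using degree_0_iff[of "E - cedges C" v] assms(1) by auto
  then show thesis using that by auto
qed

text \<open>If \<open>e\<close> does not touch the cycle, the vertices of \<open>A\<close> inside it
  form a nonempty proper subset of \<open>A\<close>. An inner edge leaving this subset ends on the
  cycle.\<close>

lemma part_inward:
  assumes es: "edgeset E" and d: "drawing E p S" and A: "part E A" and cy: "cyc (inner_edges E A) C"
    and e: "e \<in> inner_edges E A" "e \<in> insE E p S (cedges C)"
  obtains f x where "f \<in> inner_edges E A" "f \<in> insE E p S (cedges C)" "x \<in> f" "x \<in> set C"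
proof -
  let ?K = "cedges C" and ?V = "insV E p S (cedges C)"
  have iE: "inner_edges E A \<subseteq> E" by (auto simp: inner_edges_def)
  have cyE: "cyc E C" using cy iE by (auto simp: cyc_def)
  have KE: "?K \<subseteq> E" using cyE by (simp add: cyc_def)
  have UK: "\<Union>?K = set C" by (rule Union_cedges[OF cyE])
  have VC: "?V \<inter> set C = {}" using insV_disjoint[OF d KE] UK by simp
  have CA: "set C \<subseteq> A" using Union_cedges[OF cy] cy by (auto simp: cyc_def inner_edges_def)
  have end': "v \<in> set C \<or> v \<in> ?V" if "g \<in> insE E p S ?K" "v \<in> g" for g v
    using insE_endpoint[OF d es KE that] UK by simp
  show thesis
  proof (cases "e \<inter> set C = {}")
    case False
    then show thesis using that e by auto
  next
    case True
    have "e \<in> E" using e(1) iE by auto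
    then obtain u w where "e = {u, w}" using es unfolding edgeset_def by metis
    then have u: "u \<in> e" by simp
    then have uT: "u \<in> ?V \<inter> A" using end'[OF e(2) u] True e(1) by (auto simp: inner_edges_def)
    have "C \<noteq> []" using cy by (auto simp: cyc_def)
    then obtain c where "c \<in> set C" by (cases C) auto
    then have "?V \<inter> A \<subset> A" using VC CA by auto
    then have c2: "card {f \<in> inner_edges E A. f \<inter> (?V \<inter> A) \<noteq> {} \<and> \<not> f \<subseteq> ?V \<inter> A} \<ge> 2"
      by (rule part_inner_cut[OF es A]) (use uT in auto)
    obtain f where "f \<in> {f \<in> inner_edges E A. f \<inter> (?V \<inter> A) \<noteq> {} \<and> \<not> f \<subseteq> ?V \<inter> A}" using two_members[OF c2, of "{}"] .
    then have f: "f \<in> inner_edges E A" "f \<inter> (?V \<inter> A) \<noteq> {}" "\<not> f \<subseteq> ?V \<inter> A" by auto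
    obtain s where s: "s \<in> f" "s \<in> ?V" using f(2) by auto
    have fE: "f \<in> E" using f(1) iE by auto
    have fi: "f \<in> insE E p S ?K" by (rule insE_of_insV[OF d es KE s(2) fE s(1)])
    obtain y where y: "y \<in> f" "y \<notin> ?V \<inter> A" using f(3) by auto
    have "y \<in> A" using y(1) f(1) by (auto simp: inner_edges_def)
    then have "y \<in> set C" using end'[OF fi y(1)] y(2) by auto
    then show thesis using that f(1) fi y(1) by metis
  qed
qed

text \<open>Induction on the number of edges inside: an ear turns the cycle into two with fewer
  edges inside. In the base case only inner edges are absent; the bridge, with whatever lies behind
  it, may well be inside the cycle.\<close>

lemma discharge:
  assumes es: "edgeset E" and d3: "\<And>v. degree E v \<le> 3" and d: "drawing E p S" and A: "part E A"
    and base: "\<And>C. cyc (inner_edges E A) C \<Longrightarrow> inner_edges E A \<inter> insE E p S (cedges C) = {} \<Longrightarrow>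
      6 \<le> card {v \<in> set C. degree E v = 3}"
  shows "cyc (inner_edges E A) C \<Longrightarrow>
    6 \<le> (\<Sum>v\<in>A. cweight E (inner_edges E A) (bridge_ends E A) p S C v)"
proof (induction "card (insE E p S (cedges C))" arbitrary: C rule: less_induct)
  case less
  let ?B = "inner_edges E A" and ?X = "bridge_ends E A"
  note cy = less.prems
  have fin: "finite E" using es by (simp add: edgeset_def)
  have iE: "?B \<subseteq> E" by (auto simp: inner_edges_def)
  have finA: "finite A"
  proof (rule finite_subset[OF partD(2)[OF A]])
    show "finite (\<Union>E)" using es by (auto simp: edgeset_def)
  qed
  have cyE: "cyc E D" if "cyc ?B D" for D using that iE by (auto simp: cyc_def)
  have CA: "set D \<subseteq> A" if "cyc ?B D" for D
    using Union_cedges[OF that] that by (auto simp: cyc_def inner_edges_def)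
  have leaf: "degree (E - cedges D) z \<le> 1" if "cyc ?B D" "z \<in> set D" for D z
    using degree_residual[OF fin cyE[OF that(1)] that(2)] d3[of z] by simp
  show ?case
  proof (cases "?B \<inter> insE E p S (cedges C) = {}")
    case True
    have "6 \<le> int (card {v \<in> set C. degree E v = 3})" using base[OF cy True] by simp
    also have "\<dots> = (\<Sum>v\<in>set C. if degree E v = 3 then 1 else 0)"
      by (simp add: sum.If_cases Int_def)
    also have "\<dots> \<le> (\<Sum>v\<in>A. cweight E ?B ?X p S C v)"
    proof (rule sum_mono2[OF finA CA[OF cy], THEN order_trans[rotated]])
      show "(\<Sum>v\<in>set C. if degree E v = 3 then 1 else 0) \<le> (\<Sum>v\<in>set C. cweight E ?B ?X p S C v)"
      proof (rule sum_mono)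
        fix v assume v: "v \<in> set C"
        have "\<not> inward ?B (insE E p S (cedges C)) v" using True by (simp add: inward_def)
        then show "(if degree E v = 3 then 1 else 0) \<le> cweight E ?B ?X p S C v"
          using v by (simp add: weight_def)
      qed
    qed (simp add: weight_def)
    finally show ?thesis .
  next
    case False
    then obtain e' where e': "e' \<in> ?B" "e' \<in> insE E p S (cedges C)" by auto
    obtain e x where e: "e \<in> ?B" "e \<in> insE E p S (cedges C)" "x \<in> e" "x \<in> set C"
      using part_inward[OF es d A cy e'] .
    obtain y zs where y: "y \<in> set C" "y \<noteq> x" and Q: "distinct (x # zs @ [y])" "set zs \<inter> set C = {}"
      and QB: "pedges (x # zs @ [y]) \<subseteq> ?B" and Qi: "pedges (x # zs @ [y]) \<subseteq> insE E p S (cedges C)"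
      using find_ear[OF es d A cy refl leaf[OF cy] e] .
    obtain D where D: "cyc ?B (x # D)" "set (x # D) = set C" "cedges (x # D) = cedges C"
      using cyc_rotate_to[OF cy e(4)] .
    have "y \<in> set D" using y D(2) by auto
    then obtain as bs where ab: "D = as @ y # bs" by (meson split_list)
    have cy': "cyc ?B (x # as @ y # bs)" using D(1) ab by simp
    have setC: "set C = set (x # as @ y # bs)" and ceC: "cedges C = cedges (x # as @ y # bs)" using D(2,3) ab by auto
    define K1 where "K1 = pedges (x # as @ [y])"
    define K2 where "K2 = pedges (y # bs @ [x])"
    define KQ where "KQ = pedges (x # zs @ [y])"
    have KC: "cedges C = K1 \<union> K2" unfolding ceC K1_def K2_def by (rule cedges_split)
    have dist: "distinct (x # as @ y # bs)" and len: "length (x # as @ y # bs) \<ge> 3" and KB: "cedges C \<subseteq> ?B"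
      using cy' ceC by (auto simp: cyc_def)
    have Qi': "KQ \<subseteq> insE E p S (K1 \<union> K2)" using Qi KC KQ_def by simp
    have QE: "KQ \<subseteq> E - (K1 \<union> K2)" using Qi' insE_sub by (rule order_trans)
    have sub: "K1 \<subseteq> E" "K2 \<subseteq> E" "KQ \<subseteq> E" using KC KB iE QE by auto
    have dj: "K1 \<inter> K2 = {}" "K1 \<inter> KQ = {}" "K2 \<inter> KQ = {}"
    proof -
      show "K1 \<inter> K2 = {}" unfolding K1_def K2_def using dist len by (intro pedges_disjoint) auto
      show "K1 \<inter> KQ = {}" "K2 \<inter> KQ = {}" using QE by auto
    qed
    have zsd: "set zs \<inter> (set as \<union> set bs) = {}" using Q(2) setC by auto
    obtain e0 where e0: "e0 \<in> KQ" unfolding KQ_def by (cases zs) auto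
    have e0': "e0 \<in> insE E p S (K1 \<union> K2)" using Qi' e0 by auto
    note sp = split_sides[OF d es dist Q(1) zsd K1_def K2_def KQ_def sub dj e0 e0']
    let ?C1 = "x # as @ y # rev zs" and ?C2 = "y # bs @ x # zs"
    have "pedges (y # rev zs @ [x]) = KQ" using pedges_rev[of "x # zs @ [y]"] by (simp add: KQ_def)
    then have c1: "cedges ?C1 = K1 \<union> KQ" using cedges_split[of x as y "rev zs"] by (simp add: K1_def)
    have c2: "cedges ?C2 = K2 \<union> KQ" using cedges_split[of y bs x zs] by (simp add: K2_def KQ_def)
    have KQB: "KQ \<subseteq> ?B" using QB KQ_def by simp
    have ne1: "as \<noteq> [] \<or> zs \<noteq> []"
    proof (rule ccontr)
      assume "\<not> ?thesis"
      then have "K1 = KQ" by (simp add: K1_def KQ_def)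
      then show False using dj(2) e0 by auto
    qed
    have ne2: "bs \<noteq> [] \<or> zs \<noteq> []"
    proof (rule ccontr)
      assume "\<not> ?thesis"
      then have "K2 = KQ" by (auto simp: K2_def KQ_def insert_commute)
      then show False using dj(3) e0 by auto
    qed
    have l1: "length ?C1 \<ge> 3" using ne1 by (cases as; cases zs) auto
    have l2: "length ?C2 \<ge> 3" using ne2 by (cases bs; cases zs) auto
    have "distinct ?C1" using dist Q(1) zsd by auto
    then have cy1: "cyc ?B ?C1" using l1 c1 KC KB KQB unfolding cyc_def by auto
    have "distinct ?C2" using dist Q(1) zsd by auto
    then have cy2: "cyc ?B ?C2" using l2 c2 KC KB KQB unfolding cyc_def by auto
    have finI: "finite (insE E p S (cedges C))" using fin by (simp add: insE_def)
    have "insE E p S (K1 \<union> KQ) \<inter> KQ = {}" "insE E p S (K2 \<union> KQ) \<inter> KQ = {}" by (auto simp: insE_def)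
    then have "insE E p S (cedges ?C1) \<subset> insE E p S (cedges C)" "insE E p S (cedges ?C2) \<subset> insE E p S (cedges C)"
      unfolding c1 c2 KC sp(1) using e0 by auto
    then have lt: "card (insE E p S (cedges ?C1)) < card (insE E p S (cedges C))"
      "card (insE E p S (cedges ?C2)) < card (insE E p S (cedges C))"
      using finI by (auto intro: psubset_card_mono)
    let ?f = "cweight E ?B ?X p S C" and ?f1 = "cweight E ?B ?X p S ?C1" and ?f2 = "cweight E ?B ?X p S ?C2"
    have ih: "6 \<le> sum ?f1 A" "6 \<le> sum ?f2 A" using less.hyps[OF lt(1) cy1] less.hyps[OF lt(2) cy2] by auto
    let ?I = "insE E p S (K1 \<union> K2)" and ?I1 = "insE E p S (K1 \<union> KQ)" and ?I2 = "insE E p S (K2 \<union> KQ)"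
    let ?V = "insV E p S (K1 \<union> K2)" and ?V1 = "insV E p S (K1 \<union> KQ)" and ?V2 = "insV E p S (K2 \<union> KQ)"
    have s: "K1 \<union> K2 \<subseteq> E" "K1 \<union> KQ \<subseteq> E" "K2 \<union> KQ \<subseteq> E" using sub by auto
    have "\<Union>K1 = set (x # as @ [y])" "\<Union>K2 = set (y # bs @ [x])" and UQ: "\<Union>KQ = set (x # zs @ [y])"
      unfolding K1_def K2_def KQ_def by (rule Union_pedges; simp)+
    then have U: "\<Union>(K1 \<union> K2) = {x, y} \<union> set as \<union> set bs"
      "\<Union>(K1 \<union> KQ) = {x, y} \<union> set as \<union> set zs" "\<Union>(K2 \<union> KQ) = {x, y} \<union> set bs \<union> set zs"
      unfolding Union_Un_distrib by auto
    have VU: "?V \<inter> ({x, y} \<union> set as \<union> set bs) = {}" using insV_disjoint[OF d s(1)] unfolding U .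
    have end1: "v \<in> {x, y} \<union> set as \<union> set zs \<or> v \<in> ?V1" if "g \<in> ?I1" "v \<in> g" for g v
      using insE_endpoint[OF d es s(2) that] unfolding U .
    have end2: "v \<in> {x, y} \<union> set bs \<union> set zs \<or> v \<in> ?V2" if "g \<in> ?I2" "v \<in> g" for g v
      using insE_endpoint[OF d es s(3) that] unfolding U .
    have F: "?f v = weight E ?B ?X ({x, y} \<union> set as \<union> set bs) ?I ?V v"
      "?f1 v = weight E ?B ?X ({x, y} \<union> set as \<union> set zs) ?I1 ?V1 v"
      "?f2 v = weight E ?B ?X ({x, y} \<union> set bs \<union> set zs) ?I2 ?V2 v" for v
    proof -
      have "set C = {x, y} \<union> set as \<union> set bs" using setC by auto
      then show "?f v = weight E ?B ?X ({x, y} \<union> set as \<union> set bs) ?I ?V v" by (simp only: KC)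
      have "set ?C1 = {x, y} \<union> set as \<union> set zs" by auto
      then show "?f1 v = weight E ?B ?X ({x, y} \<union> set as \<union> set zs) ?I1 ?V1 v" by (simp only: c1)
      have "set ?C2 = {x, y} \<union> set bs \<union> set zs" by auto
      then show "?f2 v = weight E ?B ?X ({x, y} \<union> set bs \<union> set zs) ?I2 ?V2 v" by (simp only: c2)
    qed
    \<comment> \<open>The surplus 3 at \<open>x\<close> and \<open>y\<close> only uses that weights
      on a cycle lie between -1 and 1. Any other vertex of the old cycle is on just one new cycle
      and keeps its inward edge there.\<close>
    have key: "?f1 v + ?f2 v \<le> ?f v + (if v = x \<or> v = y then 3 else 0)" if vA: "v \<in> A" for v
    proof -
      consider "v = x \<or> v = y" | "v \<in> set as" | "v \<in> set bs" | "v \<in> set zs"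
        | "v \<notin> {x, y} \<union> set as \<union> set bs \<union> set zs" by auto
      then show ?thesis
      proof cases
        case 1
        have "?f1 v \<le> 1" "?f2 v \<le> 1" using 1 by (auto intro: weight_le_1)
        moreover have "?f v \<ge> - 1" by (simp add: weight_def)
        ultimately show ?thesis using 1 by simp
      next
        case 2
        have out: "v \<notin> {x, y} \<union> set bs \<union> set zs" using 2 dist zsd by auto
        have vV: "v \<notin> ?V" using 2 VU by auto
        then have vV2: "v \<notin> ?V2" using sp(3) by auto
        have f2: "?f2 v = 0" unfolding F(3) using out vV2 by (simp add: weight_def)
        have inw: "inward ?B ?I1 v" if iw: "inward ?B ?I v"
        proof -
          obtain g where g: "g \<in> ?B" "g \<in> ?I" "v \<in> g" using iw by (auto simp: inward_def)
          have "v \<notin> \<Union>KQ" unfolding UQ using 2 dist zsd by auto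
          then have "g \<notin> KQ" using g(3) by auto
          moreover have "g \<notin> ?I2" using end2[OF _ g(3)] out vV2 by auto
          ultimately have "g \<in> ?I1" using g(2) sp(1) by auto
          then show ?thesis using g by (auto simp: inward_def)
        qed
        have "?f1 v \<le> ?f v" unfolding F(1,2) using 2 inw by (auto simp: weight_def)
        then show ?thesis using f2 by simp
      next
        case 3
        have out: "v \<notin> {x, y} \<union> set as \<union> set zs" using 3 dist zsd by auto
        have vV: "v \<notin> ?V" using 3 VU by auto
        then have vV1: "v \<notin> ?V1" using sp(3) by auto
        have f1: "?f1 v = 0" unfolding F(2) using out vV1 by (simp add: weight_def)
        have inw: "inward ?B ?I2 v" if iw: "inward ?B ?I v"
        proof -
          obtain g where g: "g \<in> ?B" "g \<in> ?I" "v \<in> g" using iw by (auto simp: inward_def)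
          have "v \<notin> \<Union>KQ" unfolding UQ using 3 dist zsd by auto
          then have "g \<notin> KQ" using g(3) by auto
          moreover have "g \<notin> ?I1" using end1[OF _ g(3)] out vV1 by auto
          ultimately have "g \<in> ?I2" using g(2) sp(1) by auto
          then show ?thesis using g by (auto simp: inward_def)
        qed
        have "?f2 v \<le> ?f v" unfolding F(1,3) using 3 inw by (auto simp: weight_def)
        then show ?thesis using f1 by simp
      next
        case 4
        have vV: "v \<in> ?V" using 4 sp(3) by auto
        then have vC: "v \<notin> {x, y} \<union> set as \<union> set bs" using VU by auto
        have m: "v \<in> {x, y} \<union> set as \<union> set zs" "v \<in> {x, y} \<union> set bs \<union> set zs" using 4 by auto
        have f0: "?f v = (if v \<in> ?X then 2 else 0)" unfolding F(1) using vC vV by (simp add: weight_def)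
        have le: "?f1 v \<le> 1" "?f2 v \<le> 1" using 4 by (auto intro: weight_le_1)
        show ?thesis
        \<comment> \<open>For a bridge end the old weight 2 pays for weight at most 1 on both new
          cycles. At any other 3-vertex of the ear the third edge is inner and lies inside one of
          the new cycles, which provides the weight -1.\<close>
        proof (cases "v \<in> ?X \<or> degree E v \<noteq> 3")
          case True
          then show ?thesis
          proof
            assume "v \<in> ?X"
            then show ?thesis using f0 le by simp
          next
            assume "degree E v \<noteq> 3"
            then have "?f1 v = 0" "?f2 v = 0" unfolding F(2,3) using m by (simp_all add: weight_def)
            then show ?thesis using f0 by simp
          qed
        next
          case False
          have v1: "v \<in> set ?C1" using 4 by auto
          obtain g where g: "g \<in> E" "g \<notin> cedges ?C1" "v \<in> g"
            using third_edge[OF fin cyE[OF cy1] v1] False by metis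
          have gB: "g \<in> ?B" using inner_edge[OF g(1,3) vA] False by simp
          have "g \<in> ?I" by (rule insE_of_insV[OF d es s(1) vV g(1,3)])
          then have "g \<in> ?I1 \<or> g \<in> ?I2" using sp(1) g(2) c1 by auto
          then have "inward ?B ?I1 v \<or> inward ?B ?I2 v" using gB g(3) by (auto simp: inward_def)
          then have "?f1 v = - 1 \<or> ?f2 v = - 1" unfolding F(2,3) using m False by (auto simp: weight_def)
          then show ?thesis using le f0 by auto
        qed
      next
        case 5
        have o: "v \<notin> {x, y} \<union> set as \<union> set bs" "v \<notin> {x, y} \<union> set as \<union> set zs" "v \<notin> {x, y} \<union> set bs \<union> set zs"
          using 5 by auto
        have V: "v \<in> ?V \<longleftrightarrow> v \<in> ?V1 \<or> v \<in> ?V2" "\<not> (v \<in> ?V1 \<and> v \<in> ?V2)" using sp(3,4) 5 by auto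
        have f0: "?f v = (if v \<in> ?V \<and> v \<in> ?X then 2 else 0)" unfolding F(1) using o(1) by (simp add: weight_def)
        have f1: "?f1 v = (if v \<in> ?V1 \<and> v \<in> ?X then 2 else 0)" unfolding F(2) using o(2) by (simp add: weight_def)
        have f2: "?f2 v = (if v \<in> ?V2 \<and> v \<in> ?X then 2 else 0)" unfolding F(3) using o(3) by (simp add: weight_def)
        have "v \<noteq> x" "v \<noteq> y" using 5 by auto
        then show ?thesis unfolding f0 f1 f2 using V by auto
      qed
    qed
    have xyA: "{x, y} \<subseteq> A" using CA[OF cy] e(4) y(1) by auto
    have "sum ?f1 A + sum ?f2 A = (\<Sum>v\<in>A. ?f1 v + ?f2 v)" by (simp only: sum.distrib)
    also have "\<dots> \<le> (\<Sum>v\<in>A. ?f v + (if v = x \<or> v = y then 3 else 0))" by (rule sum_mono) (rule key)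
    also have "\<dots> = sum ?f A + (\<Sum>v\<in>A. if v = x \<or> v = y then 3 else 0)" by (rule sum.distrib)
    also have "(\<Sum>v\<in>A. if v = x \<or> v = y then 3 else 0) = (\<Sum>v\<in>{x, y}. 3::int)"
      by (rule sum.mono_neutral_cong_right[OF finA xyA]) auto
    also have "\<dots> = 6" using y(2) by simp
    finally have "sum ?f1 A + sum ?f2 A \<le> sum ?f A + 6" .
    then show ?thesis using ih by linarith
  qed
qed

text \<open>In one of the two drawings that the inversion relates, the third edge of a 3-vertex of
  \<open>C\<close> points inward, so its two weights add up to at most 0 unless it is the bridge
  end. The bridge end contributes at most 2 in total, against a required total of 12.\<close>

lemma no_part:
  assumes es: "edgeset E" and d3: "\<And>v. degree E v \<le> 3" and dr: "drawing E p S" and A: "part E A"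
    and base: "\<And>p S C. drawing E p S \<Longrightarrow> cyc (inner_edges E A) C \<Longrightarrow> inner_edges E A \<inter> insE E p S (cedges C) = {} \<Longrightarrow>
      6 \<le> card {v \<in> set C. degree E v = 3}"
    and cy: "cyc (inner_edges E A) C"
  shows False
proof -
  let ?B = "inner_edges E A" and ?X = "bridge_ends E A"
  have fin: "finite E" using es by (simp add: edgeset_def)
  have finA: "finite A"
  proof (rule finite_subset[OF partD(2)[OF A]])
    show "finite (\<Union>E)" using es by (auto simp: edgeset_def)
  qed
  have cyE: "cyc E C" using cy by (auto simp: cyc_def inner_edges_def)
  obtain p' S' where d': "drawing E p' S'"
    and iE: "insE E p' S' (cedges C) = E - cedges C - insE E p S (cedges C)"
    and iV: "insV E p' S' (cedges C) = \<Union>E - set C - insV E p S (cedges C)"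
    using swap_sides[OF dr es cyE] .
  let ?f = "cweight E ?B ?X p S C" and ?f' = "cweight E ?B ?X p' S' C"
  have h: "6 \<le> sum ?f A" by (rule discharge[OF es d3 dr A base[OF dr] cy])
  have h': "6 \<le> sum ?f' A" by (rule discharge[OF es d3 d' A base[OF d'] cy])
  have key: "?f v + ?f' v \<le> (if v \<in> ?X then 2 else 0)" if vA: "v \<in> A" for v
  proof (cases "v \<in> set C")
    case False
    have "\<not> (v \<in> insV E p S (cedges C) \<and> v \<in> insV E p' S' (cedges C))" using iV by auto
    then have "?f v = 0 \<or> ?f' v = 0" "?f v \<le> (if v \<in> ?X then 2 else 0)" "?f' v \<le> (if v \<in> ?X then 2 else 0)"
      using False by (auto simp: weight_def)
    then show ?thesis by auto
  next
    case True
    have le: "?f v \<le> 1" "?f' v \<le> 1" using True by (auto intro: weight_le_1)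
    show ?thesis
    proof (cases "v \<in> ?X \<or> degree E v \<noteq> 3")
      case t: True
      then show ?thesis
      proof
        assume "v \<in> ?X" then show ?thesis using le by simp
      next
        assume "degree E v \<noteq> 3"
        then have "?f v = 0" "?f' v = 0" using True by (simp_all add: weight_def)
        then show ?thesis by simp
      qed
    next
      case False
      obtain g where g: "g \<in> E" "g \<notin> cedges C" "v \<in> g" using third_edge[OF fin cyE True] False by metis
      have gB: "g \<in> ?B" using inner_edge[OF g(1,3) vA] False by simp
      have "g \<in> insE E p S (cedges C) \<or> g \<in> insE E p' S' (cedges C)" using iE g by auto
      then have "inward ?B (insE E p S (cedges C)) v \<or> inward ?B (insE E p' S' (cedges C)) v"
        using gB g(3) by (auto simp: inward_def)
      then have "?f v = - 1 \<or> ?f' v = - 1" using True False by (auto simp: weight_def)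
      then show ?thesis using le False by auto
    qed
  qed
  \<comment> \<open>The single outgoing edge has only one end in \<open>A\<close>.\<close>
  have X1: "card ?X \<le> 1"
  proof (rule ccontr)
    assume "\<not> card ?X \<le> 1"
    then have c2: "card ?X \<ge> 2" by simp
    obtain u where u: "u \<in> ?X" using two_members[OF c2] by metis
    obtain w where w: "w \<in> ?X" "w \<noteq> u" using two_members[OF c2, of u] .
    obtain e f where e: "e \<in> cut E A" "u \<in> e" and f: "f \<in> cut E A" "w \<in> f" using u w by (auto simp: bridge_ends_def)
    have finc: "finite (cut E A)" using fin by (simp add: cut_def)
    have "e = f"
    proof (rule ccontr)
      assume "e \<noteq> f"
      then have "card {e, f} = 2" by simp
      moreover have "card {e, f} \<le> card (cut E A)" using e f finc by (intro card_mono) auto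
      ultimately show False using partD(3)[OF A] by simp
    qed
    have eE: "e \<in> E" "\<not> e \<subseteq> A" using e(1) by (auto simp: cut_def)
    obtain b where "e = {u, b}" using edge_nbr[OF es eE(1) e(2)] by metis
    then have "e = {u, w}" using f(2) w(2) \<open>e = f\<close> by auto
    then show False using eE(2) u w(1) by (auto simp: bridge_ends_def)
  qed
  have XA: "?X \<subseteq> A" by (auto simp: bridge_ends_def)
  have "12 \<le> sum ?f A + sum ?f' A" using h h' by simp
  also have "\<dots> = (\<Sum>v\<in>A. ?f v + ?f' v)" by (simp only: sum.distrib)
  also have "\<dots> \<le> (\<Sum>v\<in>A. if v \<in> ?X then 2 else 0)" by (rule sum_mono) (rule key)
  also have "\<dots> = (\<Sum>v\<in>?X. 2::int)" by (rule sum.mono_neutral_cong_right[OF finA XA]) auto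
  also have "\<dots> = 2 * int (card ?X)" by simp
  finally show False using X1 by simp
qed

section \<open>Cycles with few 3-vertices\<close>

text \<open>A number rather than a predicate, so that counting 3-vertices along explicit lists
  becomes linear arithmetic.\<close>

definition tri :: "'a set set \<Rightarrow> 'a \<Rightarrow> nat" where
  "tri E v = (if degree E v = 3 then 1 else 0)"

lemma card_tri: "distinct xs \<Longrightarrow> card {v \<in> set xs. degree E v = 3} = sum_list (map (tri E) xs)"
proof (induction xs)
  case (Cons x xs)
  have "{v \<in> set (x # xs). degree E v = 3} = (if degree E x = 3 then insert x else id) {v \<in> set xs. degree E v = 3}"
    by auto
  then show ?case using Cons by (auto simp: tri_def)
qed simp

text \<open>Consecutive vertices are grouped in pairs, each of which contains a 3-vertex; the
  summand 1 is for a last vertex without partner.\<close>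

lemma length_le_tri:
  assumes "\<And>u v. {u, v} \<in> pedges xs \<Longrightarrow> tri E u + tri E v \<ge> 1"
  shows "length xs \<le> 2 * sum_list (map (tri E) xs) + 1"
  using assms
proof (induction xs rule: induct_list012)
  case (3 x y zs)
  have "length zs \<le> 2 * sum_list (map (tri E) zs) + 1"
  proof (rule 3(1))
    fix u v assume "{u, v} \<in> pedges zs"
    then have "{u, v} \<in> pedges (x # y # zs)" by (cases zs) auto
    then show "tri E u + tri E v \<ge> 1" by (rule 3(3))
  qed
  moreover have "tri E x + tri E y \<ge> 1" by (rule 3(3)) simp
  ultimately show ?case by simp
qed simp_all

lemma list9:
  assumes "length xs = 9" obtains a b c d e f g h i where "xs = [a, b, c, d, e, f, g, h, i]"
  using assms by (auto simp: length_Suc_conv eval_nat_numeral)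

lemma list10:
  assumes "length xs = 10" obtains a b c d e f g h i j where "xs = [a, b, c, d, e, f, g, h, i, j]"
  using assms by (auto simp: length_Suc_conv eval_nat_numeral)

lemma list11:
  assumes "length xs = 11" obtains a b c d e f g h i j k where "xs = [a, b, c, d, e, f, g, h, i, j, k]"
  using assms by (auto simp: length_Suc_conv eval_nat_numeral)

text \<open>Since adjacent 2-vertices are excluded, the degrees of all relevant vertices are
  determined once the cycle has been rotated to start at a 3-vertex, and in length 9 also to end at
  one. To survive the rotation, \<open>X\<close> is assumed for all lists with the same edge
  set.\<close>

lemma few_3_vertices:
  assumes c: "crit E" and cy: "cyc E C" and K: "K = cedges C" and few: "sum_list (map (tri E) C) \<le> 5"
    and X: "\<And>x as y bs u v. cyc E (x # as @ y # bs) \<Longrightarrow> cedges (x # as @ y # bs) = K \<Longrightarrow>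
      u \<in> set as \<Longrightarrow> v \<in> set bs \<Longrightarrow> crosses (E - K) x y u v"
  shows False
proof -
  note cf = crit_facts[OF c]
  define good where "good xs \<longleftrightarrow> cyc E xs \<and> cedges xs = K \<and> sum_list (map (tri E) xs) \<le> 5" for xs
  have gC: "good C" using cy K few by (simp add: good_def)
  have rot: "good (ys @ xs)" if "good (xs @ ys)" for xs ys
    using that cyc_rotate[of E xs ys] cedges_rotate[of xs ys] by (auto simp: good_def add.commute)
  have KE: "K \<subseteq> E" using cy K by (simp add: cyc_def)
  have deg2: "degree E v = 2 \<or> degree E v = 3" if "v \<in> set C" for v
    using degree_residual[OF cf(2) cy that] cf(3)[of v] by linarith
  have UK: "\<Union>K = set C" using Union_cedges[OF cy] K by simp
  have t0: "degree E v = 2" if "v \<in> \<Union>K" "tri E v = 0" for v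
    using deg2[of v] that UK by (auto simp: tri_def split: if_splits)
  have t1: "degree E v = 3" if "tri E v = 1" for v using that by (auto simp: tri_def split: if_splits)
  have le1: "tri E v \<le> 1" for v by (simp add: tri_def)
  have ge1: "tri E u + tri E v \<ge> 1" if uv: "{u, v} \<in> K" for u v
  proof (rule ccontr)
    assume "\<not> ?thesis"
    then have "tri E u = 0" "tri E v = 0" by auto
    moreover have "u \<in> \<Union>K" "v \<in> \<Union>K" using uv by auto
    ultimately have "degree E u = 2" "degree E v = 2" using t0 by auto
    then show False using crit_two_adjacent[OF c, of u v] uv KE by auto
  qed
  have mem: "xs \<noteq> [] \<Longrightarrow> good xs \<Longrightarrow> pedges (xs @ [hd xs]) = K" for xs by (simp add: good_def cedges_def)
  have c10: False if g: "good [v1, a1, v2, a2, v3, a3, v4, a4, v5, a5]" and h: "tri E v1 = 1" for v1 a1 v2 a2 v3 a3 v4 a4 v5 a5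
  proof -
    let ?C = "[v1, a1, v2, a2, v3, a3, v4, a4, v5, a5]"
    have KK: "K = {{v1, a1}, {a1, v2}, {v2, a2}, {a2, v3}, {v3, a3}, {a3, v4}, {v4, a4}, {a4, v5}, {v5, a5}, {a5, v1}}"
      using mem[OF _ g] by simp
    have s: "tri E v1 + tri E a1 + tri E v2 + tri E a2 + tri E v3 + tri E a3 + tri E v4 + tri E a4 + tri E v5 + tri E a5 \<le> 5"
      using g by (simp add: good_def)
    have p: "tri E a1 + tri E v2 \<ge> 1" "tri E v2 + tri E a2 \<ge> 1" "tri E a2 + tri E v3 \<ge> 1" "tri E v3 + tri E a3 \<ge> 1"
      "tri E a3 + tri E v4 \<ge> 1" "tri E v4 + tri E a4 \<ge> 1" "tri E a4 + tri E v5 \<ge> 1" "tri E v5 + tri E a5 \<ge> 1"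
      by (rule ge1, simp add: KK)+
    note l = le1[of a1] le1[of a2] le1[of a3] le1[of a4] le1[of a5] le1[of v2] le1[of v3] le1[of v4] le1[of v5]
    have "tri E a1 = 0 \<and> tri E a2 = 0 \<and> tri E a3 = 0 \<and> tri E a4 = 0 \<and> tri E a5 = 0 \<and> tri E v2 = 1 \<and> tri E v3 = 1"
      using s p h l by linarith
    then have d: "degree E a1 = 2" "degree E a2 = 2" "degree E a3 = 2" "degree E a4 = 2" "degree E a5 = 2"
      "degree E v2 = 3" "degree E v3 = 3" using t0 t1 by (auto simp: KK)
    have cyg: "cyc E ?C" and kg: "cedges ?C = K" using g by (auto simp: good_def)
    have "crosses (E - K) v1 v3 v2 v4"
      using X[of v1 "[a1, v2, a2]" v3 "[a3, v4, a4, v5, a5]" v2 v4] cyg kg by simp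
    then show False using reducible_10[OF c cyg d] kg by simp
  qed
  have c9: False if g: "good [v1, a1, v2, a2, v3, a3, v4, a4, v5]" and h: "tri E v1 = 1" "tri E v5 = 1"
    for v1 a1 v2 a2 v3 a3 v4 a4 v5
  proof -
    let ?C = "[v1, a1, v2, a2, v3, a3, v4, a4, v5]"
    have KK: "K = {{v1, a1}, {a1, v2}, {v2, a2}, {a2, v3}, {v3, a3}, {a3, v4}, {v4, a4}, {a4, v5}, {v5, v1}}"
      using mem[OF _ g] by simp
    have s: "tri E v1 + tri E a1 + tri E v2 + tri E a2 + tri E v3 + tri E a3 + tri E v4 + tri E a4 + tri E v5 \<le> 5"
      using g by (simp add: good_def)
    have p: "tri E a1 + tri E v2 \<ge> 1" "tri E v2 + tri E a2 \<ge> 1" "tri E a2 + tri E v3 \<ge> 1" "tri E v3 + tri E a3 \<ge> 1"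
      "tri E a3 + tri E v4 \<ge> 1" "tri E v4 + tri E a4 \<ge> 1"
      by (rule ge1, simp add: KK)+
    note l = le1[of a1] le1[of a2] le1[of a3] le1[of a4] le1[of v2] le1[of v3] le1[of v4]
    have "tri E a1 = 0 \<and> tri E a2 = 0 \<and> tri E a3 = 0 \<and> tri E a4 = 0 \<and> tri E v2 = 1 \<and> tri E v3 = 1 \<and> tri E v4 = 1"
      using s p h l by linarith
    then have d: "degree E a1 = 2" "degree E a2 = 2" "degree E a3 = 2" "degree E a4 = 2"
      "degree E v2 = 3" "degree E v3 = 3" "degree E v4 = 3" using t0 t1 by (auto simp: KK)
    have cyg: "cyc E ?C" and kg: "cedges ?C = K" using g by (auto simp: good_def)
    have x1: "crosses (E - K) v1 v3 v2 v4"
      using X[of v1 "[a1, v2, a2]" v3 "[a3, v4, a4, v5]" v2 v4] cyg kg by simp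
    have "good ([v3, a3, v4, a4, v5] @ [v1, a1, v2, a2])" by (rule rot) (use g in simp)
    then have "crosses (E - K) v3 v5 v4 v2"
      using X[of v3 "[a3, v4, a4]" v5 "[v1, a1, v2, a2]" v4 v2] by (simp add: good_def)
    then have x2: "crosses (E - K) v3 v5 v2 v4" by (rule crosses_sym)
    show False using reducible_9[OF c cyg d] kg x1 x2 by simp
  qed
  have "length C \<ge> 9" by (rule girth9_cyc[OF cf(4) cy])
  moreover have "length C \<le> 2 * sum_list (map (tri E) C) + 1"
  proof (rule length_le_tri)
    fix u v assume "{u, v} \<in> pedges C"
    moreover have "C \<noteq> []" using cy by (auto simp: cyc_def)
    ultimately have "{u, v} \<in> K" using cedges_eq[of C] K by simp
    then show "tri E u + tri E v \<ge> 1" by (rule ge1)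
  qed
  \<comment> \<open>Length 11 remains because \<open>length_le_tri\<close> ignores the closing edge.
    Summing over all 11 edges counts every 3-vertex twice and would require 11 \<le> 10.\<close>
  ultimately consider "length C = 9" | "length C = 10" | "length C = 11" using few by linarith
  then show False
  proof cases
    case 1
    then obtain x0 x1 x2 x3 x4 x5 x6 x7 x8 where C: "C = [x0, x1, x2, x3, x4, x5, x6, x7, x8]" by (rule list9)
    have g: "good [x0, x1, x2, x3, x4, x5, x6, x7, x8]" using gC C by simp
    have KK: "K = {{x0, x1}, {x1, x2}, {x2, x3}, {x3, x4}, {x4, x5}, {x5, x6}, {x6, x7}, {x7, x8}, {x8, x0}}"
      using mem[OF _ g] by simp
    have p: "tri E x0 + tri E x1 \<ge> 1" "tri E x1 + tri E x2 \<ge> 1" "tri E x2 + tri E x3 \<ge> 1" "tri E x3 + tri E x4 \<ge> 1"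
      "tri E x4 + tri E x5 \<ge> 1" "tri E x5 + tri E x6 \<ge> 1" "tri E x6 + tri E x7 \<ge> 1" "tri E x7 + tri E x8 \<ge> 1"
      "tri E x8 + tri E x0 \<ge> 1"
      by (rule ge1, simp add: KK)+
    \<comment> \<open>On a cycle of odd length 2- and 3-vertices cannot alternate all the way round,
      so two 3-vertices are adjacent. They become the last and the first vertex of the rotated
      list.\<close>
    have two: "\<exists>ys zs. [x0, x1, x2, x3, x4, x5, x6, x7, x8] = ys @ zs \<and> tri E (hd (zs @ ys)) = 1 \<and> tri E (last (zs @ ys)) = 1"
    proof (rule ccontr)
      assume n: "\<not> ?thesis"
      have nn: "\<not> (tri E (hd (zs @ ys)) = 1 \<and> tri E (last (zs @ ys)) = 1)"
        if "[x0, x1, x2, x3, x4, x5, x6, x7, x8] = ys @ zs" for ys zs using n that by blast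
      note q = nn[of "[]" "[x0, x1, x2, x3, x4, x5, x6, x7, x8]"] nn[of "[x0]" "[x1, x2, x3, x4, x5, x6, x7, x8]"]
        nn[of "[x0, x1]" "[x2, x3, x4, x5, x6, x7, x8]"] nn[of "[x0, x1, x2]" "[x3, x4, x5, x6, x7, x8]"]
        nn[of "[x0, x1, x2, x3]" "[x4, x5, x6, x7, x8]"] nn[of "[x0, x1, x2, x3, x4]" "[x5, x6, x7, x8]"]
        nn[of "[x0, x1, x2, x3, x4, x5]" "[x6, x7, x8]"] nn[of "[x0, x1, x2, x3, x4, x5, x6]" "[x7, x8]"]
        nn[of "[x0, x1, x2, x3, x4, x5, x6, x7]" "[x8]"]
      have z: "tri E v = 0 \<or> tri E v = 1" for v by (simp add: tri_def)
      show False
      proof (cases "tri E x0 = 1")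
        case True
        then show False using q p z[of x1] z[of x2] z[of x3] z[of x4] z[of x5] z[of x6] z[of x7] z[of x8] by auto
      next
        case False
        then show False using q p z[of x0] z[of x1] z[of x2] z[of x3] z[of x4] z[of x5] z[of x6] z[of x7] z[of x8] by auto
      qed
    qed
    then obtain ys zs where yz: "[x0, x1, x2, x3, x4, x5, x6, x7, x8] = ys @ zs" "tri E (hd (zs @ ys)) = 1"
      "tri E (last (zs @ ys)) = 1" by blast
    have g': "good (zs @ ys)" by (rule rot) (use g yz(1) in simp)
    have "length (zs @ ys) = 9" using arg_cong[OF yz(1), of length] by simp
    then obtain v1 a1 v2 a2 v3 a3 v4 a4 v5 where w: "zs @ ys = [v1, a1, v2, a2, v3, a3, v4, a4, v5]" by (rule list9)
    show False by (rule c9[OF g'[unfolded w]]) (use yz(2,3) w in simp_all)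
  next
    case 2
    then obtain x0 x1 x2 x3 x4 x5 x6 x7 x8 x9 where C: "C = [x0, x1, x2, x3, x4, x5, x6, x7, x8, x9]" by (rule list10)
    have g: "good [x0, x1, x2, x3, x4, x5, x6, x7, x8, x9]" using gC C by simp
    have "{x0, x1} \<in> K" using mem[OF _ g] by auto
    then have "tri E x0 + tri E x1 \<ge> 1" by (rule ge1)
    then have "tri E x0 = 1 \<or> tri E x1 = 1" using le1[of x0] le1[of x1] by linarith
    moreover have "good ([x1, x2, x3, x4, x5, x6, x7, x8, x9] @ [x0])" by (rule rot) (use g in simp)
    ultimately show False using c10[OF g] c10[of x1 x2 x3 x4 x5 x6 x7 x8 x9 x0] by auto
  next
    case 3
    then obtain x0 x1 x2 x3 x4 x5 x6 x7 x8 x9 x10 where C: "C = [x0, x1, x2, x3, x4, x5, x6, x7, x8, x9, x10]" by (rule list11)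
    have g: "good [x0, x1, x2, x3, x4, x5, x6, x7, x8, x9, x10]" using gC C by simp
    have KK: "K = {{x0, x1}, {x1, x2}, {x2, x3}, {x3, x4}, {x4, x5}, {x5, x6}, {x6, x7}, {x7, x8}, {x8, x9}, {x9, x10}, {x10, x0}}"
      using mem[OF _ g] by simp
    have p: "tri E x0 + tri E x1 \<ge> 1" "tri E x1 + tri E x2 \<ge> 1" "tri E x2 + tri E x3 \<ge> 1" "tri E x3 + tri E x4 \<ge> 1"
      "tri E x4 + tri E x5 \<ge> 1" "tri E x5 + tri E x6 \<ge> 1" "tri E x6 + tri E x7 \<ge> 1" "tri E x7 + tri E x8 \<ge> 1"
      "tri E x8 + tri E x9 \<ge> 1" "tri E x9 + tri E x10 \<ge> 1" "tri E x10 + tri E x0 \<ge> 1"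
      by (rule ge1, simp add: KK)+
    have "tri E x0 + tri E x1 + tri E x2 + tri E x3 + tri E x4 + tri E x5 + tri E x6 + tri E x7 + tri E x8 + tri E x9 + tri E x10 \<le> 5"
      using g by (simp add: good_def)
    then show False using p by linarith
  qed
qed

lemma not_crit:
  assumes c: "crit E" shows False
proof -
  note cf = crit_facts[OF c]
  have "ok {} {}" by (simp add: ok_def acyc_def matching_def degree_def)
  then have "dec {}" by (auto simp: dec_def)
  then have ne: "E \<noteq> {}" using cf(6) by auto
  obtain A where A: "part E A" using part_exists[OF cf(1) ne] .
  obtain C where C: "cyc (inner_edges E A) C" using part_cycle[OF cf(1) A crit_min_degree[OF c]] .
  obtain p S where d: "drawing E p S" using cf(5) by (auto simp: drawable_def)
  have base: "6 \<le> card {v \<in> set C. degree E v = 3}"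
    if d: "drawing E p S" and cy: "cyc (inner_edges E A) C" and no: "inner_edges E A \<inter> insE E p S (cedges C) = {}" for p S C
  proof (rule ccontr)
    assume n: "\<not> ?thesis"
    let ?K = "cedges C"
    have cyE: "cyc E C" using cy by (auto simp: cyc_def inner_edges_def)
    have UK: "\<Union>?K = set C" by (rule Union_cedges[OF cyE])
    have CA: "set C \<subseteq> A" using Union_cedges[OF cy] cy by (auto simp: cyc_def inner_edges_def)
    \<comment> \<open>No inner edge lies inside the cycle, so after the swap every inner edge off
      the cycle does. An ear cannot leave \<open>A\<close>, so all ears are now on the same side and
      alternating ones must meet.\<close>
    obtain p' S' where d': "drawing E p' S'" and iE: "insE E p' S' ?K = E - ?K - insE E p S ?K"
      using swap_sides[OF d cf(1) cyE] .
    have "distinct C" using cy by (simp add: cyc_def)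
    then have few: "sum_list (map (tri E) C) \<le> 5" using n card_tri[of C E] by simp
    show False
    proof (rule few_3_vertices[OF c cyE refl few])
      fix x as y bs u v
      assume D: "cyc E (x # as @ y # bs)" "cedges (x # as @ y # bs) = ?K" and u: "u \<in> set as" and v: "v \<in> set bs"
      have setD: "set (x # as @ y # bs) = set C" using Union_cedges[OF D(1)] D(2) UK by simp
      show "crosses (E - ?K) x y u v"
      proof (rule crosses_ears[OF d' cf(1) D(1) D(2)[symmetric] _ _ u v])
        fix z assume "z \<in> set (x # as @ y # bs)"
        then have "z \<in> set C" unfolding setD .
        then show "degree (E - ?K) z \<le> 1" using degree_residual[OF cf(2) cyE, of z] cf(3)[of z] by simp
      next
        fix s t zs
        assume st: "s \<in> set (x # as @ y # bs)" "t \<in> set (x # as @ y # bs)" and ds: "distinct (s # zs @ [t])"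
          and pe: "pedges (s # zs @ [t]) \<subseteq> E - ?K"
        have stA: "s \<in> A" "t \<in> A" using st CA unfolding setD by auto
        have "set (s # zs @ [t]) \<subseteq> A"
          by (rule path_in_part[OF cf(1) partD(3)[OF A] ds]) (use pe stA in auto)
        then have "e \<in> inner_edges E A" if "e \<in> pedges (s # zs @ [t])" for e
          using pedges_subset[OF that] that pe unfolding inner_edges_def by blast
        then show "pedges (s # zs @ [t]) \<subseteq> insE E p' S' ?K" unfolding iE using pe no by blast
      qed
    qed
  qed
  show False by (rule no_part[OF cf(1) cf(3) d A base C])
qed

lemma plane9_dec: "plane9 E \<Longrightarrow> dec E"
proof (induction "card E" arbitrary: E rule: less_induct)
  case less
  show ?case
  proof (rule ccontr)
    assume "\<not> dec E"
    then have "crit E" unfolding crit_def using less by blast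
    then show False by (rule not_crit)
  qed
qed

section \<open>Linear forests\<close>

lemma path_conn: "pedges xs \<subseteq> L \<Longrightarrow> u \<in> set xs \<Longrightarrow> conn L (hd xs) u"
proof (induction xs rule: pedges.induct)
  case (1 x y zs)
  show ?case
  proof (cases "u = x")
    case False
    then have "conn L y u" using 1 by auto
    moreover have "conn L x y" using 1(2) by (intro conn_edge) simp
    ultimately show ?thesis using conn_trans by (metis list.sel(1))
  qed simp
qed auto

text \<open>A longest path through \<open>v\<close> is the whole component: an inner vertex has no
  third neighbour, and a neighbour of an end off the path would prolong it. Further edges between
  its vertices would close a cycle.\<close>

lemma ok_linear_forest:
  assumes ok: "ok L M" and es: "edgeset L" shows "linear_forest V L"
  unfolding linear_forest_def
proof
  fix v
  have fin: "finite L" and acyc: "acyc L" and deg: "\<And>x. degree L x \<le> 2" using ok by (auto simp: ok_def)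
  have finU: "finite (insert v (\<Union>L))" using es by (auto simp: edgeset_def)
  let ?P = "\<lambda>xs. distinct xs \<and> pedges xs \<subseteq> L \<and> v \<in> set xs"
  have bound: "length xs \<le> card (insert v (\<Union>L))" if P: "?P xs" for xs
  proof -
    have "set xs \<subseteq> insert v (\<Union>L)"
    proof (cases "length xs \<ge> 2")
      case True
      have "\<Union>(pedges xs) \<subseteq> \<Union>L" using P by (intro Union_mono) simp
      then show ?thesis using Union_pedges[OF True] by auto
    next
      case False
      then have "xs = [v]" using P by (cases xs; cases "tl xs") auto
      then show ?thesis by simp
    qed
    then have "card (set xs) \<le> card (insert v (\<Union>L))" using finU by (intro card_mono)
    then show ?thesis using P distinct_card[of xs] by simp
  qed
  have P0: "?P [v]" by simp
  have "\<forall>xs. ?P xs \<longrightarrow> length xs < Suc (card (insert v (\<Union>L)))" using bound by (simp add: less_Suc_eq_le)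
  from Lattices_Big.ex_has_greatest_nat[of ?P, OF P0 this]
  obtain xs where xs: "?P xs" "\<And>ys. ?P ys \<Longrightarrow> length ys \<le> length xs" by blast
  have ne: "xs \<noteq> []" using xs(1) by auto
  have closed: "w \<in> set xs" if s: "s \<in> set xs" and sw: "{s, w} \<in> L" for s w
  proof (rule ccontr)
    assume w: "w \<notin> set xs"
    obtain as bs where ab: "xs = as @ s # bs" using s by (meson split_list)
    show False
    proof (cases "as = [] \<or> bs = []")
      case False
      have "{s, last as} \<in> L" "{s, hd bs} \<in> L"
        using pedges_neighbours[OF ab] False xs(1) by (auto simp: insert_commute)
      then have "card {last as, hd bs, w} \<le> degree L s" using sw by (intro card_nbrs_le_degree[OF fin]) auto
      moreover have "last as \<in> set as" "hd bs \<in> set bs" using False by auto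
      then have "last as \<noteq> hd bs" "last as \<noteq> w" "hd bs \<noteq> w" using xs(1) ab w by auto
      ultimately show False using deg[of s] by simp
    next
      case True
      then show False
      proof
        assume "as = []"
        then have "?P (w # xs)" using xs(1) w sw ab by (auto simp: insert_commute)
        then show False using xs(2)[of "w # xs"] by simp
      next
        assume "bs = []"
        then have "last xs = s" using ab by simp
        then have "?P (xs @ [w])" using xs(1) w sw pedges_snoc[OF ne, of w] by auto
        then show False using xs(2)[of "xs @ [w]"] by simp
      qed
    qed
  qed
  have walk_closed: "walk L n s w \<Longrightarrow> s \<in> set xs \<Longrightarrow> w \<in> set xs" for n s w
    by (induction n arbitrary: s) (use closed in auto)
  have comp: "set xs = component L v"
  proof
    show "set xs \<subseteq> component L v"
    proof
      fix u assume u: "u \<in> set xs"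
      have "conn L v (hd xs)" by (rule conn_sym[OF path_conn]) (use xs(1) in auto)
      moreover have "conn L (hd xs) u" by (rule path_conn) (use xs(1) u in auto)
      ultimately have "conn L v u" by (rule conn_trans)
      then show "u \<in> component L v" by (simp add: component_def conn_iff_rtranclp)
    qed
    show "component L v \<subseteq> set xs"
    proof
      fix u assume "u \<in> component L v"
      then have "conn L v u" by (simp add: component_def conn_iff_rtranclp)
      then obtain n where "walk L n v u" by (auto simp: conn_def)
      then show "u \<in> set xs" by (rule walk_closed) (use xs(1) in simp)
    qed
  qed
  have chord: "{s, w} \<in> pedges xs" if sp: "xs = as @ s # bs @ w # cs" and L: "{s, w} \<in> L" for s w as bs cs
  proof (rule ccontr)
    assume n: "{s, w} \<notin> pedges xs"
    have sub: "pedges (s # bs @ [w]) \<subseteq> pedges xs"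
      using pedges_append[of as s "bs @ w # cs"] pedges_append[of "s # bs" w cs] sp by auto
    have "bs \<noteq> []" using n sub by auto
    then have "length (s # bs @ [w]) \<ge> 3" by (cases bs) auto
    then have "cyc L (s # bs @ [w])"
      by (intro path_imp_cyc) (use xs(1) sp sub L in \<open>auto simp: insert_commute\<close>)
    then show False by (rule acyc_no_cyc[OF acyc])
  qed
  have "{e \<in> L. e \<subseteq> set xs} = pedges xs"
  proof
    show "pedges xs \<subseteq> {e \<in> L. e \<subseteq> set xs}" using xs(1) pedges_subset by auto
    show "{e \<in> L. e \<subseteq> set xs} \<subseteq> pedges xs"
    proof
      fix e assume e: "e \<in> {e \<in> L. e \<subseteq> set xs}"
      then have eL: "e \<in> L" by simp
      then obtain s w where sw: "e = {s, w}" "s \<noteq> w" using es unfolding edgeset_def by metis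
      have "s \<in> set xs" "w \<in> set xs" using e sw by auto
      then obtain as bs where ab: "xs = as @ s # bs" "w \<in> set as \<or> w \<in> set bs"
        using sw(2) by (metis in_set_conv_decomp set_append Un_iff set_ConsD)
      from ab(2) show "e \<in> pedges xs"
      proof
        assume "w \<in> set bs"
        then obtain cs ds where "bs = cs @ w # ds" by (meson split_list)
        then show ?thesis using chord[of as s cs w ds] ab(1) eL sw(1) by simp
      next
        assume "w \<in> set as"
        then obtain cs ds where "as = cs @ w # ds" by (meson split_list)
        then show ?thesis using chord[of cs w ds s bs] ab(1) eL sw(1) by (simp add: insert_commute)
      qed
    qed
  qed
  then show "\<exists>xs. distinct xs \<and> set xs = component L v \<and>
      {e\<in>L. e \<subseteq> set xs} = {{xs ! i, xs ! Suc i} | i. Suc i < length xs}"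
    using xs(1) comp pedges_nth[of xs] by (intro exI[of _ xs]) simp
qed

theorem theorem4:
  fixes V :: "'a set" and E :: "'a set set"
  assumes "simple_graph V E" and "subcubic V E" and "planar V E" and "girth_at_least E 9"
  shows "\<exists>L M. L \<union> M = E \<and> L \<inter> M = {} \<and> linear_forest V L \<and> matching M"
proof -
  have "E \<subseteq> Pow V" "finite V" using assms(1) by (auto simp: simple_graph_def)
  then have "finite E" using finite_subset by auto
  moreover have "\<forall>e\<in>E. \<exists>u v. e = {u, v} \<and> u \<noteq> v"
    using assms(1) unfolding simple_graph_def by metis
  ultimately have es: "edgeset E" by (simp add: edgeset_def)
  have "degree E v \<le> 3" for v
  proof (cases "v \<in> V")
    case True
    then show ?thesis using assms(2) by (simp add: subcubic_def)
  next
    case False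
    then have "v \<notin> \<Union>E" using \<open>E \<subseteq> Pow V\<close> by auto
    then show ?thesis using degree_0[of v E] by simp
  qed
  then have "plane9 E"
    using es girth_imp_girth9[OF assms(4) es] planar_drawable[OF assms(3,1)] by (simp add: plane9_def)
  then have "dec E" by (rule plane9_dec)
  then obtain L M where LM: "ok L M" "L \<union> M = E" by (auto simp: dec_def)
  have "edgeset L" by (rule edgeset_subset[OF es]) (use LM(2) in auto)
  then have "linear_forest V L" by (rule ok_linear_forest[OF LM(1)])
  then show ?thesis using LM by (auto simp: ok_def)
qed

end
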